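(* Let $n$ be a positive integer. For any partitions $\lambda$ and $\mu$ of $n$, $$U_{\overline{\lambda}}\, s_\mu \;=\; s_\lambda\odot s_\mu \;=\; \sum_{\alpha\vdash n} t_{\lambda,\mu}^{\alpha}\, s_\alpha ,$$ where $U_{\overline{\lambda}}:\Lambda^n\to\Lambda^n$ is the operator defined in the context, $\odot$ is the inner product of symmetric functions, and $t_{\lambda,\mu}^\alpha$ is the multiplicity of the irreducible character $\chi^\alpha$ of the symmetric group $S_n$ in the Kronecker product $\chi^\lambda\otimes\chi^\mu$.
   Context: $\Lambda$ is the ring of symmetric functions in $x_1,x_2,\ldots$ over $\mathbb{Q}$, and $\Lambda^n$ its homogeneous component of degree $n$. $h_r$ is the complete homogeneous symmetric function of degree $r$, with $h_0=1$ and $h_r=0$ for $r<0$; for a partition (or sequence) $\alpha=(\alpha_1,\dots,\alpha_m)$, $h_\alpha=h_{\alpha_1}\cdots h_{\alpha_m}$. $s_\lambda$ is the Schur function of $\lambda$. For $f\in\{s_\gamma\}$, $s_\gamma$ also denotes the operator of multiplication by $s_\gamma$ on $\Lambda$, and $s_\gamma^\perp$ is its adjoint with respect to the standard scalar product on $\Lambda$ (for which Schur functions are orthonormal): $\langle s_\gamma f,g\rangle=\langle f,s_\gamma^\perp g\rangle$ for all $f,g\in\Lambda$. $\chi^\lambda$ is the irreducible character of $S_n$ indexed by $\lambda\vdash n$, viewed as the element $\sum_{\sigma\in S_n}\chi^\lambda(\sigma)\sigma$ of the center $\mathcal{Z}_n$ of $\mathbb{Q}[S_n]$. Pointwise multiplication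 on $\mathbb{Q}[S_n]$ is $(\sum_\sigma a_\sigma\sigma)\cdot(\sum_\sigma b_\sigma\sigma)=\sum_\sigma a_\sigma b_\sigma\,\sigma$. The Kronecker product $\chi^\lambda\otimes\chi^\mu$ is the pointwise product $\chi^\lambda\cdot\chi^\mu$, and $\chi^\lambda\otimes\chi^\mu=\sum_{\alpha\vdash n}t_{\lambda,\mu}^\alpha\chi^\alpha$. The Frobenius map $\mathcal{F}:\mathcal{Z}_n\to\Lambda^n$ is the linear isomorphism with $\mathcal{F}(\chi^\lambda)=s_\lambda$. The inner product of $f,g\in\Lambda^n$ is $f\odot g=\mathcal{F}(\mathcal{F}^{-1}(f)\cdot\mathcal{F}^{-1}(g))$. Operator $U_{\overline\lambda}$: let $\lambda=(\lambda_1\ge\lambda_2\ge\dots\ge\lambda_r)\vdash n$ with $r$ parts and $\overline{\lambda}=(\lambda_2,\dots,\lambda_r)$. (a) Expand the $r\times r$ determinant whose first row has all entries equal to $1$ and whose $(i,j)$ entry, for $2\le i\le r$ and $1\le j\le r$, is $h_{\lambda_i-i+j}$, as a signed sum of monomials $h_\alpha=h_{\alpha_1}\cdots h_{\alpha_m}$ (using $h_0=1$ and $h_s=0$ for $s<0$). (b) Replace each monomial $h_\alpha=h_{\alpha_1}\cdots h_{\alpha_m}$ in this expansion by the operator $$\sum_{\nu^1\vdash\alpha_1,\ldots,\nu^m\vdash\alpha_m}(s_{\nu^1}\cdots s_{\nu^m})(s_{\nu^1}^\perp\cdots s_{\nu^m}^\perp)$$ (the constant monomial $1$ is replaced by the identity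 operator). The resulting linear operator on $\Lambda^n$ is $U_{\overline{\lambda}}$. For example $U_{(1)}=s_{(1)}s_{(1)}^\perp-1$. *)

theory Defs
  imports
    "HOL-Library.Poly_Mapping"
    "HOL-Library.Multiset"
    "HOL-Combinatorics.Permutations"
    "Jordan_Normal_Form.Determinant"
begin

section \<open>Partitions\<close>

definition partition_of :: "nat list \<Rightarrow> nat \<Rightarrow> bool"  (infix \<open>\<turnstile>\<close> 50) where
  "\<mu> \<turnstile> n \<longleftrightarrow> sorted_wrt (\<ge>) \<mu> \<and> 0 \<notin> set \<mu> \<and> sum_list \<mu> = n"

definition cells :: "nat list \<Rightarrow> (nat \<times> nat) set" where
  "cells \<mu> = {(i, j). i < length \<mu> \<and> j < \<mu> ! i}"

section \<open>Symmetric functions over the rationals\<close>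

text \<open>Formal power series over the rationals in the variables \<open>x\<^sub>0, x\<^sub>1, \<dots>\<close>. The multiset \<open>M\<close> of
  indices stands for the monomial \<open>\<Prod>i\<in>#M. x\<^sub>i\<close>, and a series is its coefficient function.\<close>

typedef series = "UNIV :: (nat multiset \<Rightarrow> rat) set"
  morphisms coeff_of series_of by simp

setup_lifting type_definition_series

lemma finite_sub_mset: "finite {A. A \<subseteq># (M :: 'a multiset)}"
proof (induction M)
  case (add x M)
  have "{A. A \<subseteq># add_mset x M} \<subseteq> {A. A \<subseteq># M} \<union> add_mset x ` {A. A \<subseteq># M}"
  proof
    fix A assume "A \<in> {A. A \<subseteq># add_mset x M}"
    then have A: "A \<subseteq># add_mset x M" by simp
    show "A \<in> {A. A \<subseteq># M} \<union> add_mset x ` {A. A \<subseteq># M}"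
    proof (cases "x \<in># A")
      case True
      then obtain B where B: "A = add_mset x B" by (meson multi_member_split)
      then have "B \<subseteq># M" using A by simp
      then show ?thesis using B by blast
    next
      case False
      then have "A \<subseteq># M" using A
        by (metis add_mset_remove_trivial diff_single_trivial subset_eq_diff_conv union_single_eq_member
            add_mset_add_single)
      then show ?thesis by blast
    qed
  qed
  then show ?case using add.IH by (meson finite_UnI finite_imageI finite_subset)
qed simp

lemma finite_mset_splittings: "finite {(A, B). A + B = (M :: 'a multiset)}"
  by (rule finite_subset[of _ "{A. A \<subseteq># M} \<times> {A. A \<subseteq># M}"])
     (auto simp: finite_sub_mset)

instantiation series :: comm_ring_1
begin

lift_definition zero_series :: series is "\<lambda>_. 0" .
lift_definition one_series :: series is "\<lambda>M. if M = {#} then 1 else 0" .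
lift_definition plus_series :: "series \<Rightarrow> series \<Rightarrow> series" is "\<lambda>f g M. f M + g M" .
lift_definition minus_series :: "series \<Rightarrow> series \<Rightarrow> series" is "\<lambda>f g M. f M - g M" .
lift_definition uminus_series :: "series \<Rightarrow> series" is "\<lambda>f M. - f M" .
lift_definition times_series :: "series \<Rightarrow> series \<Rightarrow> series" is
  "\<lambda>f g M. \<Sum>(A, B) | A + B = M. f A * g B" .

instance
proof
  fix a b c :: series
  show "a * b * c = a * (b * c)"
  proof (transfer, rule ext)
    fix f g h :: "nat multiset \<Rightarrow> rat" and M
    let ?S = "\<lambda>M :: nat multiset. {(A, B). A + B = M}"
    have "(\<Sum>(X, C)\<in>?S M. (\<Sum>(A, B)\<in>?S X. f A * g B) * h C)
        = (\<Sum>p\<in>?S M. \<Sum>q\<in>?S (fst p). f (fst q) * g (snd q) * h (snd p))"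
      by (simp add: sum_distrib_right case_prod_unfold)
    also have "\<dots> = (\<Sum>(p, q)\<in>Sigma (?S M) (\<lambda>p. ?S (fst p)). f (fst q) * g (snd q) * h (snd p))"
      by (rule sum.Sigma) (auto simp: finite_mset_splittings)
    also have "\<dots> = (\<Sum>(p, q)\<in>Sigma (?S M) (\<lambda>p. ?S (snd p)). f (fst p) * (g (fst q) * h (snd q)))"
      by (rule sum.reindex_bij_witness[where
            i = "\<lambda>(p, q). ((fst p + fst q, snd q), (fst p, fst q))" and
            j = "\<lambda>(p, q). ((fst q, snd q + snd p), (snd q, snd p))"])
         (auto simp: ac_simps)
    also have "\<dots> = (\<Sum>p\<in>?S M. \<Sum>q\<in>?S (snd p). f (fst p) * (g (fst q) * h (snd q)))"
      by (rule sum.Sigma[symmetric]) (auto simp: finite_mset_splittings)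
    also have "\<dots> = (\<Sum>(A, X)\<in>?S M. f A * (\<Sum>(B, C)\<in>?S X. g B * h C))"
      by (simp add: sum_distrib_left case_prod_unfold)
    finally show "(\<Sum>(X, C)\<in>?S M. (\<Sum>(A, B)\<in>?S X. f A * g B) * h C)
        = (\<Sum>(A, X)\<in>?S M. f A * (\<Sum>(B, C)\<in>?S X. g B * h C))" .
  qed
  show "a * b = b * a"
  proof (transfer, rule ext)
    fix f g :: "nat multiset \<Rightarrow> rat" and M
    show "(\<Sum>(A, B) | A + B = M. f A * g B) = (\<Sum>(A, B) | A + B = M. g A * f B)"
      by (rule sum.reindex_bij_witness[where i = prod.swap and j = prod.swap])
         (auto simp: ac_simps)
  qed
  show "1 * a = a"
  proof (transfer, rule ext)
    fix f :: "nat multiset \<Rightarrow> rat" and M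
    have "(\<Sum>(A, B) | A + B = M. (if A = {#} then 1 else 0) * f B)
        = (\<Sum>(A, B)\<in>{({#} :: nat multiset, M)}. (if A = {#} then 1 else 0) * f B)"
      by (rule sum.mono_neutral_right) (auto simp: finite_mset_splittings split: if_splits)
    then show "(\<Sum>(A, B) | A + B = M. (if A = {#} then 1 else 0) * f B) = f M" by simp
  qed
  show "(a + b) * c = a * c + b * c"
    by transfer (simp add: distrib_right sum.distrib case_prod_unfold)
  show "(0 :: series) \<noteq> 1"
    by transfer (metis zero_neq_one)
qed (transfer; simp add: fun_eq_iff ac_simps)+

end

lift_definition scale_series :: "rat \<Rightarrow> series \<Rightarrow> series"  (infixr \<open>*\<^sub>s\<close> 75) is
  "\<lambda>c f M. c * f M" .

interpretation series: vector_space scale_series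
  by unfold_locales (transfer; simp add: algebra_simps)+

text \<open>The ring of symmetric functions: symmetric series of bounded degree.\<close>

definition sym_functions :: "series set" where
  "sym_functions = {f.
     (\<forall>p M. bij p \<longrightarrow> coeff_of f (image_mset p M) = coeff_of f M) \<and>
     (\<exists>d. \<forall>M. coeff_of f M \<noteq> 0 \<longrightarrow> size M \<le> d)}"

definition semistandard :: "nat list \<Rightarrow> (nat \<times> nat \<Rightarrow> nat) \<Rightarrow> bool" where
  "semistandard \<mu> T \<longleftrightarrow>
     (\<forall>i j. (i, j + 1) \<in> cells \<mu> \<longrightarrow> T (i, j) \<le> T (i, j + 1)) \<and>
     (\<forall>i j. (i + 1, j) \<in> cells \<mu> \<longrightarrow> T (i, j) < T (i + 1, j)) \<and>
     (\<forall>c. c \<notin> cells \<mu> \<longrightarrow> T c = 0)"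

lift_definition schur :: "nat list \<Rightarrow> series" is
  "\<lambda>\<mu> M. of_nat (card {T. semistandard \<mu> T \<and> image_mset T (mset_set (cells \<mu>)) = M})" .

text \<open>The scalar product for which the basis of Schur functions is orthonormal.\<close>

definition scalar_product :: "series \<Rightarrow> series \<Rightarrow> rat" where
  "scalar_product f g =
     (let coord = series.representation (schur ` {\<mu>. \<exists>n. \<mu> \<turnstile> n})
      in \<Sum>b | coord f b \<noteq> 0. coord f b * coord g b)"

definition schur_perp :: "nat list \<Rightarrow> series \<Rightarrow> series" where
  "schur_perp \<gamma> g = (THE k. k \<in> sym_functions \<and>
     (\<forall>f\<in>sym_functions. scalar_product (schur \<gamma> * f) g = scalar_product f k))"

section \<open>Characters of the symmetric group\<close>

text \<open>Elements of the group algebra of \<open>S\<^sub>n\<close>, the group of permutations of \<open>{..<n}\<close>, are the formal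
  linear combinations supported on \<open>{p. p permutes {..<n}}\<close>. The product that the library defines on
  \<^type>\<open>poly_mapping\<close> comes from addition of the keys, so composition needs its own product.\<close>

type_synonym perm_comb = "(nat \<Rightarrow> nat) \<Rightarrow>\<^sub>0 rat"

lift_definition scale_comb :: "rat \<Rightarrow> perm_comb \<Rightarrow> perm_comb" is "\<lambda>c a p. c * a p"
  by (erule finite_subset[rotated]) auto

interpretation comb: vector_space scale_comb
  by unfold_locales
     (rule poly_mapping_eqI; simp add: scale_comb.rep_eq lookup_add algebra_simps)+

definition group_algebra :: "nat \<Rightarrow> perm_comb set" where
  "group_algebra n = {a. Poly_Mapping.keys a \<subseteq> {p. p permutes {..<n}}}"

definition comb_mult :: "perm_comb \<Rightarrow> perm_comb \<Rightarrow> perm_comb"  (infixl \<open>\<star>\<close> 70) where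
  "a \<star> b = (\<Sum>p\<in>Poly_Mapping.keys a. \<Sum>q\<in>Poly_Mapping.keys b.
     Poly_Mapping.single (p \<circ> q) (Poly_Mapping.lookup a p * Poly_Mapping.lookup b q))"

definition group_algebra_center :: "nat \<Rightarrow> perm_comb set" where
  "group_algebra_center n =
     {z \<in> group_algebra n. \<forall>a\<in>group_algebra n. z \<star> a = a \<star> z}"

lift_definition pointwise_mult :: "perm_comb \<Rightarrow> perm_comb \<Rightarrow> perm_comb" is
  "\<lambda>a b p. a p * b p"
  by (erule finite_subset[rotated]) auto

text \<open>The tableau of shape \<open>\<mu>\<close> with entries \<open>0, 1, 2, \<dots>\<close> in reading order.\<close>

definition reading_tableau :: "nat list \<Rightarrow> nat \<times> nat \<Rightarrow> nat" where
  "reading_tableau \<mu> = (\<lambda>(i, j). sum_list (take i \<mu>) + j)"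

definition row_group :: "nat list \<Rightarrow> (nat \<Rightarrow> nat) set" where
  "row_group \<mu> = {p. p permutes {..<sum_list \<mu>} \<and>
     (\<forall>i. let R = reading_tableau \<mu> ` {c \<in> cells \<mu>. fst c = i} in p ` R = R)}"

definition column_group :: "nat list \<Rightarrow> (nat \<Rightarrow> nat) set" where
  "column_group \<mu> = {p. p permutes {..<sum_list \<mu>} \<and>
     (\<forall>j. let C = reading_tableau \<mu> ` {c \<in> cells \<mu>. snd c = j} in p ` C = C)}"

definition young_symmetrizer :: "nat list \<Rightarrow> perm_comb" where
  "young_symmetrizer \<mu> =
     (\<Sum>p\<in>row_group \<mu>. Poly_Mapping.single p 1) \<star>
     (\<Sum>q\<in>column_group \<mu>. Poly_Mapping.single q (of_int (sign q)))"

text \<open>The irreducible \<open>S\<^sub>n\<close>-module indexed by \<open>\<mu>\<close>, as a left ideal of the group algebra; the one-row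
  shape gives the trivial and the one-column shape the sign representation.\<close>

definition specht_module :: "nat list \<Rightarrow> perm_comb set" where
  "specht_module \<mu> = (\<lambda>a. a \<star> young_symmetrizer \<mu>) ` group_algebra (sum_list \<mu>)"

definition trace_on :: "perm_comb set \<Rightarrow> (perm_comb \<Rightarrow> perm_comb) \<Rightarrow> rat" where
  "trace_on V L =
     (let B = (SOME B. comb.independent B \<and> comb.span B = V)
      in \<Sum>b\<in>B. comb.representation B (L b) b)"

definition irr_character :: "nat list \<Rightarrow> perm_comb" where
  "irr_character \<mu> = (\<Sum>p | p permutes {..<sum_list \<mu>}.
     Poly_Mapping.single p
       (trace_on (specht_module \<mu>) (\<lambda>v. Poly_Mapping.single p 1 \<star> v)))"

text \<open>The coordinate of \<open>z\<close> at \<open>\<chi>\<^sup>\<alpha>\<close> in the basis of irreducible characters of \<open>S\<^sub>n\<close>.\<close>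

definition character_coord :: "nat \<Rightarrow> perm_comb \<Rightarrow> nat list \<Rightarrow> rat" where
  "character_coord n z \<alpha> =
     comb.representation (irr_character ` {\<beta>. \<beta> \<turnstile> n}) z (irr_character \<alpha>)"

definition kronecker_coeff :: "nat list \<Rightarrow> nat list \<Rightarrow> nat list \<Rightarrow> rat" where
  "kronecker_coeff \<mu> \<nu> \<alpha> =
     character_coord (sum_list \<alpha>) (pointwise_mult (irr_character \<mu>) (irr_character \<nu>)) \<alpha>"

definition frobenius_map :: "nat \<Rightarrow> perm_comb \<Rightarrow> series" where
  "frobenius_map n z = (\<Sum>\<alpha> | \<alpha> \<turnstile> n. character_coord n z \<alpha> *\<^sub>s schur \<alpha>)"

definition inner_product :: "nat \<Rightarrow> series \<Rightarrow> series \<Rightarrow> series" where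
  "inner_product n f g =
     (let F_inv = inv_into (group_algebra_center n) (frobenius_map n)
      in frobenius_map n (pointwise_mult (F_inv f) (F_inv g)))"

section \<open>The operator of a partition with its first part removed\<close>

text \<open>The complete homogeneous functions \<open>h\<^sub>1, h\<^sub>2, \<dots>\<close> are algebraically independent, so the
  determinant is expanded in the polynomial ring in symbols \<open>h\<^sub>1, h\<^sub>2, \<dots>\<close>: the multiset \<open>\<alpha>\<close> of
  positive numbers stands for the monomial \<open>h\<^sub>\<alpha>\<close>.\<close>

type_synonym h_polynomial = "nat multiset \<Rightarrow>\<^sub>0 rat"

definition h_symbol :: "int \<Rightarrow> h_polynomial" where
  "h_symbol k =
     (if k < 0 then 0 else if k = 0 then 1 else Poly_Mapping.single {#nat k#} 1)"

text \<open>The argument \<open>\<kappa>\<close> is \<open>(\<lambda>\<^sub>2, \<dots>, \<lambda>\<^sub>r)\<close>. Rows and columns are counted from 0, so row \<open>i \<ge> 1\<close> here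
  is row \<open>i + 1\<close> of the usual numbering and holds \<open>h\<close> with index \<open>\<lambda>\<^bsub>i+1\<^esub> - i + j\<close>.\<close>

definition h_matrix :: "nat list \<Rightarrow> h_polynomial mat" where
  "h_matrix \<kappa> = mat (length \<kappa> + 1) (length \<kappa> + 1)
     (\<lambda>(i, j). if i = 0 then 1 else h_symbol (int (\<kappa> ! (i - 1)) - int i + int j))"

definition h_monomial_op :: "nat list \<Rightarrow> series \<Rightarrow> series" where
  "h_monomial_op \<alpha> f = (\<Sum>\<nu>s | list_all2 (\<turnstile>) \<nu>s \<alpha>.
     prod_list (map schur \<nu>s) * foldr schur_perp \<nu>s f)"

text \<open>The operators \<open>s\<^sub>\<nu>\<close> commute among themselves, and so do the operators \<open>s\<^sub>\<nu>\<^sup>\<bottom>\<close>; hence the order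
  in which the factors of a monomial are listed is immaterial.\<close>

definition U_op :: "nat list \<Rightarrow> series \<Rightarrow> series" where
  "U_op \<kappa> f = (let D = det (h_matrix \<kappa>)
     in \<Sum>\<alpha>\<in>Poly_Mapping.keys D.
          Poly_Mapping.lookup D \<alpha> *\<^sub>s h_monomial_op (sorted_list_of_multiset \<alpha>) f)"

end

theory Submission
  imports Defs "HOL-Combinatorics.Cycles"
begin

text \<open>Both sides are compared coefficient by coefficient. The coefficient of the Frobenius characteristic
  of a class function at the monomial of content \<open>M\<close> is its inner product with the permutation character
  \<open>\<eta>\<^sub>M\<close> on the words of content \<open>M\<close>, and a product \<open>\<eta>\<^sub>N \<eta>\<^sub>M\<close> is the sum of the \<open>\<eta>\<^sub>P\<close> over the matrices \<open>P\<close> of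
  natural numbers with margins \<open>N\<close> and \<open>M\<close>. The Jacobi--Trudi identity holds for Schur functions by
  row operations that mirror the removal of the largest variable from a tableau. It also holds for the
  irreducible characters: the alternating sum \<open>\<phi>\<^sup>\<lambda>\<close> of permutation characters has norm 1, since its
  characteristic is the Schur function; the character of the Specht module has norm 1, and the two have
  inner product 1 by the combinatorics of Young symmetrizers, so they agree. On the other side, the
  operator of a monomial \<open>h\<^sub>\<alpha>\<close> acts on \<open>s\<^sub>\<mu>\<close> by splitting each content along matrices with row sums \<open>\<alpha>\<close>,
  because complete homogeneous functions are dual to monomial functions; this is the characteristic of
  the product of a permutation character with \<open>\<chi>\<^sup>\<mu>\<close>.\<close>

text \<open>Almost every notion is defined indirectly: the scalar product by coordinates in a set
  not yet known to be a basis, the adjoint by a definite description, characters by traces in a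
  chosen basis. Access to them comes from the functional \<open>schur_coord\<close>: the
  Jacobi--Trudi determinant with each product of complete functions replaced by a coefficient of the
  argument. It is defined from coefficients alone, and two opposite dominance estimates show that it
  is dual to the Schur functions. Independence, coordinates, orthonormality and the adjoint of
  multiplication follow from it, and so does the orthonormality of the \<phi>, because pairing with
  \<phi> is this functional applied to the characteristic (\<open>class_ip_phi\<close>). The
  operators owe their form to the projection formula: multiplying a class function by the
  permutation character of a Young subgroup is restricting it to the subgroup and inducing back, and
  summing skewing followed by multiplication over all choices of partitions does both. The
  comparison of characters takes place over the rationals: norms 1 and 1 and inner product 1 make a
  sum of rational squares vanish.\<close>

text \<open>The name \<open>inv\<close> is taken by the group inverse of HOL-Algebra here.\<close>

abbreviation pinv :: "('a \<Rightarrow> 'b) \<Rightarrow> 'b \<Rightarrow> 'a" where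
  "pinv \<equiv> Hilbert_Choice.inv"

section \<open>Coefficients of series\<close>

lemmas coeff_of_simps = plus_series.rep_eq minus_series.rep_eq uminus_series.rep_eq
  zero_series.rep_eq scale_series.rep_eq

lemma series_eqI: "(\<And>M. coeff_of f M = coeff_of g M) \<Longrightarrow> f = g"
  by (meson coeff_of_inject ext)

lemma coeff_of_sum: "coeff_of (sum f A) M = (\<Sum>x\<in>A. coeff_of (f x) M)"
  by (induction A rule: infinite_finite_induct) (auto simp: coeff_of_simps)

lemma coeff_of_times: "coeff_of (f * g) M = (\<Sum>(A, B) | A + B = M. coeff_of f A * coeff_of g B)"
  by (simp add: times_series.rep_eq)

lemma coeff_of_one: "coeff_of 1 M = (if M = {#} then 1 else 0)"
  by (simp add: one_series.rep_eq)

lemma scale_mult_left: "(c *\<^sub>s f) * g = c *\<^sub>s (f * g)"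
  by (rule series_eqI)
     (auto simp: coeff_of_times coeff_of_simps sum_distrib_left case_prod_unfold mult.assoc intro!: sum.cong)

lemma scale_mult_right: "f * (c *\<^sub>s g) = c *\<^sub>s (f * g)"
  by (metis mult.commute scale_mult_left)

lemma scale_minus_one: "(- 1) *\<^sub>s f = - f"
  by (rule series_eqI) (simp add: coeff_of_simps)

lemma sign_mult_series: "of_int (sign p) * (f :: series) = of_int (sign p) *\<^sub>s f"
  by (cases "evenperm p") (auto simp: sign_def scale_minus_one)

lift_definition xmon :: "nat multiset \<Rightarrow> series" is "\<lambda>A M. if M = A then 1 else 0" .

lemma coeff_of_xmon_mult:
  "coeff_of (xmon A * f) M = (if A \<subseteq># M then coeff_of f (M - A) else 0)"
proof (cases "A \<subseteq># M")
  case True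
  have "coeff_of (xmon A * f) M = (\<Sum>(X, B)\<in>{(A, M - A)}. coeff_of (xmon A) X * coeff_of f B)"
    unfolding coeff_of_times
    by (rule sum.mono_neutral_right) (use True in \<open>auto simp: finite_mset_splittings xmon.rep_eq split: if_splits\<close>)
  then show ?thesis using True by (simp add: xmon.rep_eq)
next
  case False
  have "coeff_of (xmon A * f) M = 0"
    unfolding coeff_of_times by (rule sum.neutral) (use False in \<open>auto simp: xmon.rep_eq\<close>)
  then show ?thesis using False by simp
qed

lemma xmon_empty: "xmon {#} = 1"
  by (rule series_eqI) (auto simp: xmon.rep_eq coeff_of_one)

lemma xmon_add: "xmon (A + B) = xmon A * xmon B"
  by (rule series_eqI)
     (auto simp: xmon.rep_eq coeff_of_xmon_mult subset_mset.diff_add dest: mset_subset_eq_exists_conv[THEN iffD1])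

lemma xmon_replicate: "xmon (replicate_mset n k) = xmon {#k#} ^ n"
proof (induction n)
  case (Suc n)
  have "replicate_mset (Suc n) k = {#k#} + replicate_mset n k" by simp
  then show ?case using Suc by (metis xmon_add power_Suc)
qed (simp add: xmon_empty)

section \<open>Closure properties of the ring of symmetric functions\<close>

lemma sym_coeff: "f \<in> sym_functions \<Longrightarrow> bij p \<Longrightarrow> coeff_of f (image_mset p M) = coeff_of f M"
  by (simp add: sym_functions_def)

lemma sym_zero: "0 \<in> sym_functions"
  by (simp add: sym_functions_def coeff_of_simps)

lemma sym_one: "1 \<in> sym_functions"
  by (auto simp: sym_functions_def coeff_of_one)

lemma sym_add:
  assumes "f \<in> sym_functions" "g \<in> sym_functions"
  shows "f + g \<in> sym_functions"
proof -
  obtain d e where "\<And>M. coeff_of f M \<noteq> 0 \<Longrightarrow> size M \<le> d" "\<And>M. coeff_of g M \<noteq> 0 \<Longrightarrow> size M \<le> e"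
    using assms unfolding sym_functions_def by blast
  then have "size M \<le> max d e" if "coeff_of (f + g) M \<noteq> 0" for M
    using that by (cases "coeff_of f M = 0") (auto simp: coeff_of_simps le_max_iff_disj)
  then have "\<exists>d. \<forall>M. coeff_of (f + g) M \<noteq> 0 \<longrightarrow> size M \<le> d" by blast
  then show ?thesis using assms by (simp add: sym_functions_def coeff_of_simps)
qed

lemma sym_scale: "f \<in> sym_functions \<Longrightarrow> c *\<^sub>s f \<in> sym_functions"
  by (auto simp: sym_functions_def coeff_of_simps)

lemma sym_sum: "(\<And>x. x \<in> A \<Longrightarrow> f x \<in> sym_functions) \<Longrightarrow> sum f A \<in> sym_functions"
  by (induction A rule: infinite_finite_induct) (auto simp: sym_zero sym_add)

lemma sym_mult:
  assumes f: "f \<in> sym_functions" and g: "g \<in> sym_functions"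
  shows "f * g \<in> sym_functions"
proof -
  obtain d e where de: "\<And>M. coeff_of f M \<noteq> 0 \<Longrightarrow> size M \<le> d" "\<And>M. coeff_of g M \<noteq> 0 \<Longrightarrow> size M \<le> e"
    using assms unfolding sym_functions_def by blast
  have "size M \<le> d + e" if "coeff_of (f * g) M \<noteq> 0" for M
  proof -
    have "\<exists>q\<in>{(A, B). A + B = M}. (case q of (A, B) \<Rightarrow> coeff_of f A * coeff_of g B) \<noteq> 0"
      using that unfolding coeff_of_times by (meson sum.neutral)
    then obtain A B where "A + B = M" "coeff_of f A * coeff_of g B \<noteq> 0" by auto
    then show ?thesis using de[of A] de[of B] by auto
  qed
  moreover have "coeff_of (f * g) (image_mset p M) = coeff_of (f * g) M" if p: "bij p" for p M
  proof -
    have inv: "image_mset (pinv p) (image_mset p A) = A" "image_mset p (image_mset (pinv p) A) = A" for A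
      using p surj_iff[of p] by (simp_all add: multiset.map_comp bij_is_inj bij_is_surj)
    have sum_eq: "image_mset (pinv p) A + image_mset (pinv p) B = M \<longleftrightarrow> A + B = image_mset p M" for A B
      by (metis inv image_mset_union)
    have "bij (pinv p)" using p by (rule bij_imp_bij_inv)
    then show ?thesis unfolding coeff_of_times
      by (intro sum.reindex_bij_witness[where
            i = "\<lambda>(A, B). (image_mset p A, image_mset p B)" and
            j = "\<lambda>(A, B). (image_mset (pinv p) A, image_mset (pinv p) B)"])
         (auto simp: inv sum_eq sym_coeff[OF f] sym_coeff[OF g])
  qed
  ultimately show ?thesis by (auto simp: sym_functions_def)
qed

lemma sym_prod: "(\<And>x. x \<in> A \<Longrightarrow> f x \<in> sym_functions) \<Longrightarrow> prod f A \<in> sym_functions"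
  by (induction A rule: infinite_finite_induct) (auto simp: sym_one sym_mult)

lemma sym_prod_list: "(\<And>x. x \<in> set xs \<Longrightarrow> x \<in> sym_functions) \<Longrightarrow> prod_list xs \<in> sym_functions"
  by (induction xs) (auto simp: sym_one sym_mult)

section \<open>The Jacobi--Trudi identity\<close>

text \<open>During the induction on the number of variables a shape is the function of its row lengths,
  with a bound \<open>l\<close> on the number of nonzero rows.\<close>

definition shape :: "nat \<Rightarrow> (nat \<Rightarrow> nat) set" where
  "shape l = {f. (\<forall>i. f (Suc i) \<le> f i) \<and> (\<forall>i\<ge>l. f i = 0)}"

definition boxes :: "(nat \<Rightarrow> nat) \<Rightarrow> (nat \<times> nat) set" where
  "boxes f = {(i, j). j < f i}"

definition tabs :: "nat \<Rightarrow> (nat \<Rightarrow> nat) \<Rightarrow> (nat \<times> nat \<Rightarrow> nat) set" where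
  "tabs k f = {T. (\<forall>i j. Suc j < f i \<longrightarrow> T (i, j) \<le> T (i, Suc j)) \<and>
     (\<forall>i j. j < f (Suc i) \<longrightarrow> T (i, j) < T (Suc i, j)) \<and>
     (\<forall>i j. j < f i \<longrightarrow> T (i, j) < k) \<and> (\<forall>i j. \<not> j < f i \<longrightarrow> T (i, j) = 0)}"

definition content :: "(nat \<Rightarrow> nat) \<Rightarrow> (nat \<times> nat \<Rightarrow> nat) \<Rightarrow> nat multiset" where
  "content f T = image_mset T (mset_set (boxes f))"

definition schur_fin :: "nat \<Rightarrow> (nat \<Rightarrow> nat) \<Rightarrow> series" where
  "schur_fin k f = (\<Sum>T\<in>tabs k f. xmon (content f T))"

definition interlacing :: "(nat \<Rightarrow> nat) \<Rightarrow> (nat \<Rightarrow> nat) set" where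
  "interlacing f = {g. \<forall>i. f (Suc i) \<le> g i \<and> g i \<le> f i}"

section \<open>Interlacing shapes and the branching rule\<close>

lemma boxes_Sigma: "f \<in> shape l \<Longrightarrow> boxes f = Sigma {..<l} (\<lambda>i. {..<f i})"
  by (auto simp: boxes_def shape_def) (metis leI less_nat_zero_code)

lemma finite_boxes: "f \<in> shape l \<Longrightarrow> finite (boxes f)"
  by (simp add: boxes_Sigma)

lemma card_boxes: "f \<in> shape l \<Longrightarrow> card (boxes f) = sum f {..<l}"
  by (simp add: boxes_Sigma)

lemma finite_tabs:
  assumes "f \<in> shape l"
  shows "finite (tabs k f)"
proof (rule finite_subset)
  show "tabs k f \<subseteq> {T. \<forall>x. (x \<in> boxes f \<longrightarrow> T x \<in> {..<k}) \<and> (x \<notin> boxes f \<longrightarrow> T x = 0)}"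
    by (auto simp: tabs_def boxes_def)
  show "finite \<dots>"
    by (rule finite_set_of_finite_funs) (use finite_boxes[OF assms] in auto)
qed

lemma interlacing_shape: "f \<in> shape l \<Longrightarrow> g \<in> interlacing f \<Longrightarrow> g \<in> shape l"
  by (auto simp: interlacing_def shape_def) (meson le_trans, metis le_zero_eq)

text \<open>Presents the interlacing shapes as an extensional dependent product, one interval per
  row; in this form a product of row sums expands over them by \<open>prod_sum_PiE\<close>.\<close>

lemma interlacing_bij:
  assumes "f \<in> shape l"
  shows "bij_betw (\<lambda>g i. if i < l then g i else 0) (PiE {..<l} (\<lambda>i. {f (Suc i)..f i})) (interlacing f)"
proof (rule bij_betwI[where g = "\<lambda>g. restrict g {..<l}"])
  have z: "f i = 0" if "i \<ge> l" for i using assms that by (auto simp: shape_def)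
  show "(\<lambda>g i. if i < l then g i else 0) \<in> PiE {..<l} (\<lambda>i. {f (Suc i)..f i}) \<rightarrow> interlacing f"
    using z by (fastforce simp: interlacing_def PiE_def Pi_def)
  show "(\<lambda>g. restrict g {..<l}) \<in> interlacing f \<rightarrow> PiE {..<l} (\<lambda>i. {f (Suc i)..f i})"
    by (auto simp: interlacing_def)
  show "restrict (\<lambda>i. if i < l then g i else 0) {..<l} = g"
    if "g \<in> PiE {..<l} (\<lambda>i. {f (Suc i)..f i})" for g
    using that by (auto simp: fun_eq_iff PiE_def extensional_def)
  show "(\<lambda>i. if i < l then restrict g {..<l} i else 0) = g" if "g \<in> interlacing f" for g
    using that z by (auto simp: fun_eq_iff interlacing_def) (metis le_zero_eq leI)
qed

lemma finite_interlacing: "f \<in> shape l \<Longrightarrow> finite (interlacing f)"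
  using bij_betw_finite[OF interlacing_bij] by (auto intro: finite_PiE)

lemma tabs_row_mono:
  assumes "T \<in> tabs k f" "j \<le> j'" "j' < f i"
  shows "T (i, j) \<le> T (i, j')"
  using assms(2,3)
proof (induction j' rule: dec_induct)
  case (step m)
  then have "T (i, m) \<le> T (i, Suc m)" using assms(1) by (auto simp: tabs_def)
  then show ?case using step by simp
qed simp

text \<open>Rows increase weakly, so the entries below \<open>k\<close> form an initial segment of
  row \<open>i\<close>, and this is its length. The alternative \<open>j \<ge> f i\<close> makes the
  least element exist when the whole row is below \<open>k\<close>.\<close>

definition small_part :: "nat \<Rightarrow> (nat \<Rightarrow> nat) \<Rightarrow> (nat \<times> nat \<Rightarrow> nat) \<Rightarrow> nat \<Rightarrow> nat" where
  "small_part k f T i = (LEAST j. j \<ge> f i \<or> T (i, j) \<ge> k)"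

lemma small_part_le: "small_part k f T i \<le> f i"
  unfolding small_part_def by (rule Least_le) simp

lemma small_part_iff:
  assumes "T \<in> tabs k' f" "j < f i"
  shows "T (i, j) < k \<longleftrightarrow> j < small_part k f T i"
proof
  assume "j < small_part k f T i"
  then show "T (i, j) < k" using not_less_Least unfolding small_part_def by fastforce
next
  assume lt: "T (i, j) < k"
  show "j < small_part k f T i"
  proof (rule ccontr)
    assume *: "\<not> j < small_part k f T i"
    have "small_part k f T i \<ge> f i \<or> T (i, small_part k f T i) \<ge> k"
      unfolding small_part_def by (rule LeastI[where k = "f i"]) simp
    then have "T (i, small_part k f T i) \<ge> k" using * assms(2) by auto
    then show False using tabs_row_mono[OF assms(1) _ assms(2), of "small_part k f T i"] * lt by auto
  qed
qed

lemma content_extend: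
  assumes f: "f \<in> shape l" and g: "g \<in> interlacing f"
    and agree: "\<And>i j. j < g i \<Longrightarrow> T (i, j) = T' (i, j)"
    and new: "\<And>i j. j < f i \<Longrightarrow> \<not> j < g i \<Longrightarrow> T (i, j) = k"
  shows "content f T = replicate_mset (\<Sum>i<l. f i - g i) k + content g T'"
proof -
  have gs: "g \<in> shape l" using f g by (rule interlacing_shape)
  have le: "g i \<le> f i" for i using g by (simp add: interlacing_def)
  have sub: "boxes g \<subseteq> boxes f" using le by (auto simp: boxes_def intro: less_le_trans)
  have "card (boxes f - boxes g) = sum f {..<l} - sum g {..<l}"
    using f gs sub by (simp add: card_Diff_subset finite_boxes card_boxes)
  also have "\<dots> = (\<Sum>i<l. f i - g i)" using le by (simp add: sum_subtractf_nat)
  finally have card: "card (boxes f - boxes g) = (\<Sum>i<l. f i - g i)" .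
  have "mset_set (boxes f) = mset_set (boxes f - boxes g) + mset_set (boxes g)"
    using mset_set_Union[of "boxes f - boxes g" "boxes g"] sub finite_boxes[OF f] finite_boxes[OF gs]
    by (simp add: Un_absorb2 Int_commute)
  moreover have "image_mset T (mset_set (boxes g)) = content g T'"
    unfolding content_def using finite_boxes[OF gs] agree
    by (intro image_mset_cong) (auto simp: boxes_def)
  moreover have "image_mset T (mset_set (boxes f - boxes g)) = image_mset (\<lambda>_. k) (mset_set (boxes f - boxes g))"
    using finite_boxes[OF f] new by (intro image_mset_cong) (auto simp: boxes_def)
  ultimately show ?thesis using card by (simp add: content_def image_mset_const_eq)
qed

text \<open>Deleting the cells that carry the largest letter \<open>k\<close> leaves a tableau in
  the letters below \<open>k\<close>. No two deleted cells lie in one column, and this is exactly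
  the interlacing of the two shapes. The maps \<open>up\<close> and \<open>down\<close> fill in and
  delete.\<close>

lemma schur_fin_branching:
  assumes f: "f \<in> shape l"
  shows "schur_fin (Suc k) f
    = (\<Sum>g\<in>interlacing f. xmon (replicate_mset (\<Sum>i<l. f i - g i) k) * schur_fin k g)"
proof -
  define up where "up g T = (\<lambda>(i, j). if j < g i then T (i, j) else if j < f i then k else 0)"
    for g :: "nat \<Rightarrow> nat" and T :: "nat \<times> nat \<Rightarrow> nat"
  define down where "down T = (\<lambda>(i, j). if j < small_part k f T i then T (i, j) else 0)"
    for T :: "nat \<times> nat \<Rightarrow> nat"
  have fS: "f (Suc i) \<le> f i" for i using f by (simp add: shape_def)
  have le: "g i \<le> f i" if "g \<in> interlacing f" for g i using that by (simp add: interlacing_def)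
  have up: "up g T \<in> tabs (Suc k) f" if g: "g \<in> interlacing f" and T: "T \<in> tabs k g" for g T
  proof -
    have "f (Suc i) \<le> g i" "g i \<le> f i" for i using g by (auto simp: interlacing_def)
    note b = this
    have T1: "Suc j < g i \<Longrightarrow> T (i, j) \<le> T (i, Suc j)" "j < g (Suc i) \<Longrightarrow> T (i, j) < T (Suc i, j)"
      "j < g i \<Longrightarrow> T (i, j) < k" for i j using T by (auto simp: tabs_def)
    have "j < f (Suc i) \<Longrightarrow> j < g i" for i j :: nat using b(1)[of i] by simp
    moreover have "j < g i \<Longrightarrow> j < f i" for i j :: nat using b(2)[of i] by simp
    ultimately show ?thesis using T1
      by (auto simp: up_def tabs_def less_imp_le less_Suc_eq dest: Suc_lessD)
  qed
  have sp: "small_part k f (up g T) = g" if g: "g \<in> interlacing f" and T: "T \<in> tabs k g" for g T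
  proof
    fix i
    have Tk: "j < g i \<Longrightarrow> T (i, j) < k" for j using T by (auto simp: tabs_def)
    show "small_part k f (up g T) i = g i"
      unfolding small_part_def
    proof (rule Least_equality)
      show "f i \<le> g i \<or> k \<le> up g T (i, g i)" by (auto simp: up_def)
      show "g i \<le> j" if "f i \<le> j \<or> k \<le> up g T (i, j)" for j
        using that Tk[of j] le[OF g, of i] by (auto simp: up_def split: if_splits)
    qed
  qed
  have inter: "small_part k f T \<in> interlacing f" if T: "T \<in> tabs (Suc k) f" for T
  proof -
    \<comment> \<open>An entry with a cell beneath it is smaller than the entry there, which is at
      most \<open>k\<close>; so it belongs to the small part.\<close>
    have "f (Suc i) \<le> small_part k f T i" for i
    proof (rule ccontr)
      assume *: "\<not> f (Suc i) \<le> small_part k f T i"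
      let ?j = "small_part k f T i"
      have "T (i, ?j) < T (Suc i, ?j)" "T (Suc i, ?j) < Suc k" using T * by (auto simp: tabs_def)
      then have "T (i, ?j) < k" by simp
      moreover have "?j < f i" using * fS[of i] by simp
      ultimately show False using small_part_iff[OF T, of ?j i k] by simp
    qed
    then show ?thesis by (simp add: interlacing_def small_part_le)
  qed
  have down: "down T \<in> tabs k (small_part k f T)" if T: "T \<in> tabs (Suc k) f" for T
  proof -
    have i: "f (Suc i) \<le> small_part k f T i" "small_part k f T i \<le> f i" for i
      using inter[OF T] by (auto simp: interlacing_def)
    have a: "j < small_part k f T i \<Longrightarrow> j < f i" for i j :: nat using i(2)[of i] by simp
    moreover have "j < small_part k f T (Suc i) \<Longrightarrow> j < small_part k f T i" for i j :: nat
      using i(1)[of i] i(2)[of "Suc i"] by simp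
    moreover have "j < small_part k f T i \<Longrightarrow> T (i, j) < k" for i j
      using small_part_iff[OF T a] by blast
    ultimately show ?thesis using T
      by (auto simp: down_def tabs_def dest: Suc_lessD)
  qed
  have ud: "up (small_part k f T) (down T) = T" if T: "T \<in> tabs (Suc k) f" for T
  proof
    fix c :: "nat \<times> nat"
    obtain i j where c: "c = (i, j)" by (cases c)
    have "T (i, j) < Suc k" if "j < f i" using T that by (auto simp: tabs_def)
    moreover have "T (i, j) = 0" if "\<not> j < f i" using T that by (auto simp: tabs_def)
    ultimately show "up (small_part k f T) (down T) c = T c"
      using small_part_iff[OF T, of j i k] small_part_le[of k f T i] c by (auto simp: up_def down_def)
  qed
  have du: "down (up g T) = T" if g: "g \<in> interlacing f" and T: "T \<in> tabs k g" for g T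
    unfolding down_def sp[OF that] using T by (auto simp: fun_eq_iff up_def tabs_def)
  have cont: "xmon (content f (up g T))
      = xmon (replicate_mset (\<Sum>i<l. f i - g i) k) * xmon (content g T)"
    if g: "g \<in> interlacing f" for g T
    by (subst content_extend[OF f g, of _ T k]) (auto simp: up_def xmon_add)
  have "schur_fin (Suc k) f = (\<Sum>(g, T)\<in>Sigma (interlacing f) (tabs k). xmon (content f (up g T)))"
    unfolding schur_fin_def
    by (rule sum.reindex_bij_witness[where i = "\<lambda>(g, T). up g T" and j = "\<lambda>T. (small_part k f T, down T)"])
       (auto simp: ud sp du inter down up)
  also have "\<dots> = (\<Sum>g\<in>interlacing f. \<Sum>T\<in>tabs k g. xmon (content f (up g T)))"
    by (rule sum.Sigma[symmetric])
       (use f in \<open>auto intro: finite_interlacing finite_tabs interlacing_shape\<close>)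
  also have "\<dots> = (\<Sum>g\<in>interlacing f. xmon (replicate_mset (\<Sum>i<l. f i - g i) k) * schur_fin k g)"
    by (simp add: cont schur_fin_def sum_distrib_left)
  finally show ?thesis .
qed

section \<open>The determinant in finitely many variables\<close>

lift_definition h_fin :: "nat \<Rightarrow> int \<Rightarrow> series" is
  "\<lambda>k r M. if set_mset M \<subseteq> {..<k} \<and> int (size M) = r then 1 else 0" .

lift_definition hz :: "int \<Rightarrow> series" is "\<lambda>r M. if int (size M) = r then 1 else 0" .

text \<open>The degrees in the Jacobi--Trudi matrix can be negative, hence the integer index; no
  size equals a negative integer.\<close>

lemma h_fin_neg: "r < 0 \<Longrightarrow> h_fin k r = 0"
  by (rule series_eqI) (auto simp: h_fin.rep_eq coeff_of_simps)

lemma h_fin_0: "h_fin 0 r = (if r = 0 then 1 else 0)"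
  by (rule series_eqI) (auto simp: h_fin.rep_eq coeff_of_simps coeff_of_one)

text \<open>A monomial either avoids the variable \<open>k\<close>, or one factor of index
  \<open>k\<close> can be split off.\<close>

lemma h_fin_rec: "h_fin (Suc k) r = h_fin k r + xmon {#k#} * h_fin (Suc k) (r - 1)"
proof (rule series_eqI)
  fix M
  show "coeff_of (h_fin (Suc k) r) M = coeff_of (h_fin k r + xmon {#k#} * h_fin (Suc k) (r - 1)) M"
  proof (cases "k \<in># M")
    case True
    then obtain N where "M = add_mset k N" by (meson multi_member_split)
    then show ?thesis by (auto simp: h_fin.rep_eq coeff_of_simps coeff_of_xmon_mult)
  next
    case False
    then have "set_mset M \<subseteq> {..<Suc k} \<longleftrightarrow> set_mset M \<subseteq> {..<k}"
      by (auto simp: subset_iff less_Suc_eq)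
    then show ?thesis using False by (auto simp: h_fin.rep_eq coeff_of_simps coeff_of_xmon_mult)
  qed
qed

text \<open>With \<open>d = Suc (f i - f (Suc i))\<close> the degree left over is that of the next
  row of the matrix in the same column, so a single row operation cancels the remainder.\<close>

lemma h_fin_iterate:
  "h_fin (Suc k) r = (\<Sum>t<d. xmon {#k#} ^ t * h_fin k (r - int t)) + xmon {#k#} ^ d * h_fin (Suc k) (r - int d)"
proof (induction d)
  case (Suc d)
  show ?case
    by (subst Suc, subst h_fin_rec[of k "r - int d"]) (simp add: algebra_simps)
qed simp

lemma sum_bidiagonal:
  fixes u :: "nat \<Rightarrow> 'a :: comm_ring_1"
  assumes "i < l"
  shows "(\<Sum>a\<in>{0..<l}. (if i = a then 1 else if a = Suc i then c else 0) * u a)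
    = u i + (if Suc i < l then c * u (Suc i) else 0)"
proof -
  have "(\<Sum>a\<in>{0..<l}. (if i = a then 1 else if a = Suc i then c else 0) * u a)
      = (\<Sum>a\<in>{0..<l}. (if i = a then u a else 0) + (if Suc i = a then c * u a else 0))"
    by (rule sum.cong) auto
  also have "\<dots> = u i + (if Suc i < l then c * u (Suc i) else 0)"
    using assms by (simp add: sum.distrib sum.delta')
  finally show ?thesis .
qed

lemma sum_scale_swap:
  fixes c :: "'a \<Rightarrow> 'c :: comm_ring_1"
  shows "(\<Sum>p\<in>P. c p * (\<Sum>g\<in>G. X g p)) = (\<Sum>g\<in>G. \<Sum>p\<in>P. c p * X g p)"
  unfolding sum_distrib_left by (rule sum.swap)

lemma det_mat_leibniz:
  "det (mat l l (\<lambda>(i, j). F i j)) = (\<Sum>p | p permutes {0..<l}. signof p * (\<Prod>i=0..<l. F i (p i)))"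
proof -
  have "mat l l (\<lambda>(i, j). F i j) $$ (i, p i) = F i (p i)" if "p permutes {0..<l}" "i < l" for p i
    using that permutes_in_image[OF that(1), of i] by simp
  then show ?thesis by (simp add: det_def)
qed

text \<open>Induction on the number of variables. Subtracting from row \<open>i\<close> a multiple
  of row \<open>i + 1\<close> (the unitriangular matrix \<open>E\<close>) leaves in each entry a sum
  over the interval from \<open>f (Suc i)\<close> to \<open>f i\<close> of entries in one variable
  less. By multilinearity in the rows the determinant becomes a sum over one choice per row, that is
  over interlacing shapes, as in \<open>schur_fin_branching\<close>.\<close>

theorem schur_fin_det:
  assumes "f \<in> shape l"
  shows "schur_fin k f = det (mat l l (\<lambda>(i, j). h_fin k (int (f i) - int i + int j)))"
  using assms
proof (induction k arbitrary: f)
  case 0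
  show ?case
  proof (cases "f = (\<lambda>_. 0)")
    case True
    then have "mat l l (\<lambda>(i, j). h_fin 0 (int (f i) - int i + int j)) = 1\<^sub>m l"
      by (intro eq_matI) (auto simp: h_fin_0)
    moreover have "tabs 0 f = {\<lambda>_. 0}" using True by (auto simp: tabs_def)
    ultimately show ?thesis using True by (simp add: schur_fin_def content_def boxes_def xmon_empty)
  next
    case False
    then obtain i where "f i \<noteq> 0" by auto
    then have tabs: "tabs 0 f = {}" by (auto simp: tabs_def)
    have "f i \<le> f 0" for i
      using 0 by (induction i) (auto simp: shape_def intro: le_trans)
    from this[of i] have f0: "f 0 > 0" using \<open>f i \<noteq> 0\<close> by simp
    then have l: "l > 0" using 0 by (auto simp: shape_def intro: ccontr)
    \<comment> \<open>Row 0 has only positive degrees, and without variables only degree 0 is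
      nonzero.\<close>
    have "(\<Prod>i = 0..<l. mat l l (\<lambda>(i, j). h_fin 0 (int (f i) - int i + int j)) $$ (i, p i)) = 0"
      if "p permutes {0..<l}" for p
    proof (rule prod_zero)
      have "p 0 < l" using that l permutes_in_image[OF that, of 0] by simp
      then show "\<exists>i\<in>{0..<l}. mat l l (\<lambda>(i, j). h_fin 0 (int (f i) - int i + int j)) $$ (i, p i) = 0"
        using l f0 by (intro bexI[of _ 0]) (auto simp: h_fin_0)
    qed simp
    then show ?thesis using tabs by (simp add: schur_fin_def det_def)
  qed
next
  case (Suc k)
  let ?x = "xmon {#k#}"
  let ?G = "PiE {..<l} (\<lambda>i. {f (Suc i)..f i})"
  have mono: "f (Suc i) \<le> f i" for i using Suc.prems by (simp add: shape_def)
  have fl: "f l = 0" using Suc.prems by (simp add: shape_def)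
  define U where "U = mat l l (\<lambda>(i, j). h_fin (Suc k) (int (f i) - int i + int j))"
  define E where "E = mat l l (\<lambda>(i, j). if i = j then 1
    else if j = Suc i then - (?x ^ Suc (f i - f (Suc i))) else 0)"
  define N where "N = mat l l (\<lambda>(i, j). \<Sum>g\<in>{f (Suc i)..f i}. ?x ^ (f i - g) * h_fin k (int g - int i + int j))"
  have EU: "E * U = N"
  proof (rule eq_matI)
    fix i j assume "i < dim_row N" "j < dim_col N"
    then have ij: "i < l" "j < l" by (auto simp: N_def)
    let ?d = "Suc (f i - f (Suc i))"
    let ?r = "int (f i) - int i + int j"
    have rd: "?r - int ?d = int (f (Suc i)) - int (Suc i) + int j" using mono[of i] by simp
    have "(E * U) $$ (i, j) = U $$ (i, j) +
        (if Suc i < l then - (?x ^ ?d) * U $$ (Suc i, j) else 0)"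
      using ij sum_bidiagonal[of i l "- (?x ^ ?d)" "\<lambda>a. U $$ (a, j)"]
      by (simp add: scalar_prod_def E_def U_def)
    also have "\<dots> = h_fin (Suc k) ?r - ?x ^ ?d * h_fin (Suc k) (?r - int ?d)"
    proof (cases "Suc i < l")
      \<comment> \<open>The last row has no row below it to subtract, but its remainder has degree
        \<open>j - l < 0\<close> and vanishes anyway.\<close>
      case False
      then have "Suc i = l" using ij by simp
      then have "?r - int ?d < 0" using rd fl ij by simp
      then show ?thesis using False ij by (simp add: U_def h_fin_neg)
    next
      case True
      then have "U $$ (Suc i, j) = h_fin (Suc k) (?r - int ?d)"
        unfolding rd using ij True by (simp add: U_def)
      then show ?thesis using True ij by (simp add: U_def)
    qed
    also have "\<dots> = (\<Sum>t<?d. ?x ^ t * h_fin k (?r - int t))"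
      by (subst h_fin_iterate[where d = ?d]) simp
    also have "\<dots> = (\<Sum>g\<in>{f (Suc i)..f i}. ?x ^ (f i - g) * h_fin k (int g - int i + int j))"
      by (rule sum.reindex_bij_witness[where i = "\<lambda>g. f i - g" and j = "\<lambda>t. f i - t"])
         (use mono[of i] in \<open>auto simp: of_nat_diff algebra_simps\<close>)
    finally show "(E * U) $$ (i, j) = N $$ (i, j)" using ij by (simp add: N_def)
  qed (auto simp: N_def E_def U_def)
  have "det E = 1"
  proof -
    have "det E = prod_list (diag_mat E)"
      by (rule det_upper_triangular[of _ l]) (auto simp: E_def)
    also have "diag_mat E = replicate l 1" by (rule nth_equalityI) (auto simp: diag_mat_def E_def)
    finally show ?thesis by simp
  qed
  then have "det U = det N"
    using det_mult[of E l U] EU by (simp add: E_def U_def)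
  also have "\<dots> = (\<Sum>p | p permutes {0..<l}. signof p *
      (\<Prod>i=0..<l. \<Sum>g\<in>{f (Suc i)..f i}. ?x ^ (f i - g) * h_fin k (int g - int i + int (p i))))"
    unfolding N_def by (rule det_mat_leibniz)
  also have "\<dots> = (\<Sum>p | p permutes {0..<l}. signof p *
      (\<Sum>g\<in>?G. \<Prod>i=0..<l. ?x ^ (f i - g i) * h_fin k (int (g i) - int i + int (p i))))"
    by (simp add: prod_sum_PiE atLeast0LessThan)
  also have "\<dots> = (\<Sum>g\<in>?G. \<Sum>p | p permutes {0..<l}. signof p *
      (\<Prod>i=0..<l. ?x ^ (f i - g i) * h_fin k (int (g i) - int i + int (p i))))"
    by (rule sum_scale_swap)
  also have "\<dots> = (\<Sum>g\<in>?G. ?x ^ (\<Sum>i<l. f i - g i) * (\<Sum>p | p permutes {0..<l}. signof p *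
      (\<Prod>i=0..<l. h_fin k (int (g i) - int i + int (p i)))))"
    by (intro sum.cong refl)
       (simp add: prod.distrib power_sum atLeast0LessThan sum_distrib_left mult.left_commute)
  also have "\<dots> = (\<Sum>g\<in>?G. ?x ^ (\<Sum>i<l. f i - g i) *
      det (mat l l (\<lambda>(i, j). h_fin k (int (g i) - int i + int j))))"
    by (simp only: det_mat_leibniz)
  also have "\<dots> = (\<Sum>g\<in>interlacing f. ?x ^ (\<Sum>i<l. f i - g i) *
      det (mat l l (\<lambda>(i, j). h_fin k (int (g i) - int i + int j))))"
  proof -
    have "mat l l (\<lambda>(i, j). h_fin k (int (if i < l then g i else 0) - int i + int j))
        = mat l l (\<lambda>(i, j). h_fin k (int (g i) - int i + int j))" for g
      by (intro eq_matI) auto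
    then show ?thesis
      by (subst sum.reindex_bij_betw[OF interlacing_bij[OF Suc.prems], symmetric]) simp
  qed
  also have "\<dots> = (\<Sum>g\<in>interlacing f. ?x ^ (\<Sum>i<l. f i - g i) * schur_fin k g)"
    using Suc.IH interlacing_shape[OF Suc.prems] by (intro sum.cong) auto
  also have "\<dots> = schur_fin (Suc k) f"
    by (simp add: schur_fin_branching[OF Suc.prems] xmon_replicate)
  finally show ?case by (simp add: U_def)
qed

section \<open>From finitely many variables to series\<close>

definition shape_of :: "nat list \<Rightarrow> nat \<Rightarrow> nat" where
  "shape_of \<mu> i = (if i < length \<mu> then \<mu> ! i else 0)"

lemma shape_of_shape: "sorted_wrt (\<ge>) \<mu> \<Longrightarrow> shape_of \<mu> \<in> shape (length \<mu>)"
  by (auto simp: shape_of_def shape_def sorted_wrt_iff_nth_less)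

lemma cells_boxes: "cells \<mu> = boxes (shape_of \<mu>)"
  by (auto simp: cells_def boxes_def shape_of_def split: if_splits)

lemma coeff_schur_fin:
  assumes "f \<in> shape l"
  shows "coeff_of (schur_fin k f) M = of_nat (card {T \<in> tabs k f. content f T = M})"
proof -
  have "coeff_of (schur_fin k f) M = (\<Sum>T\<in>tabs k f. if content f T = M then 1 else 0)"
    unfolding schur_fin_def coeff_of_sum xmon.rep_eq by (rule sum.cong) auto
  also have "\<dots> = of_nat (card {T \<in> tabs k f. content f T = M})"
    using finite_tabs[OF assms] by (simp add: sum.If_cases Int_def)
  finally show ?thesis .
qed

text \<open>All entries of a tableau of content \<open>M\<close> occur in \<open>M\<close>, so
  \<open>k\<close> variables already see every tableau that contributes to this coefficient.\<close>

lemma coeff_schur_schur_fin: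
  assumes "sorted_wrt (\<ge>) \<mu>" "set_mset M \<subseteq> {..<k}"
  shows "coeff_of (schur \<mu>) M = coeff_of (schur_fin k (shape_of \<mu>)) M"
proof -
  let ?f = "shape_of \<mu>"
  have sh: "?f \<in> shape (length \<mu>)" using assms(1) by (rule shape_of_shape)
  have "T (i, j) < k" if "content ?f T = M" "j < ?f i" for T i j
  proof -
    have "T (i, j) \<in> T ` boxes ?f" using that(2) by (auto simp: boxes_def)
    then have "T (i, j) \<in> set_mset (content ?f T)"
      using finite_boxes[OF sh] by (auto simp: content_def)
    then show ?thesis using that(1) assms(2) by auto
  qed
  then have "{T. semistandard \<mu> T \<and> image_mset T (mset_set (cells \<mu>)) = M}
      = {T \<in> tabs k ?f. content ?f T = M}"
    by (auto simp: semistandard_def tabs_def cells_boxes content_def boxes_def)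
  then show ?thesis by (simp add: schur.rep_eq coeff_schur_fin[OF sh])
qed

lemma coeff_prod_h_fin:
  assumes "finite I" "set_mset M \<subseteq> {..<k}"
  shows "coeff_of (\<Prod>i\<in>I. hz (c i)) M = coeff_of (\<Prod>i\<in>I. h_fin k (c i)) M"
  using assms
proof (induction I arbitrary: M rule: finite_induct)
  case (insert i I)
  show ?case
    using insert.hyps insert.prems
    by (auto simp: coeff_of_times hz.rep_eq h_fin.rep_eq insert.IH intro!: sum.cong)
qed simp

theorem jacobi_trudi:
  assumes "sorted_wrt (\<ge>) \<mu>"
  shows "schur \<mu> = (\<Sum>w | w permutes {..<length \<mu>}. of_int (sign w) *\<^sub>s
    (\<Prod>i<length \<mu>. hz (int (\<mu> ! i) - int i + int (w i))))"
proof (rule series_eqI)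
  fix M :: "nat multiset"
  let ?l = "length \<mu>"
  obtain k where k: "set_mset M \<subseteq> {..<k}"
    using finite_nat_iff_bounded[of "set_mset M"] by auto
  have "coeff_of (schur \<mu>) M = coeff_of (schur_fin k (shape_of \<mu>)) M"
    using assms k by (rule coeff_schur_schur_fin)
  also have "schur_fin k (shape_of \<mu>) = (\<Sum>w | w permutes {..<?l}. of_int (sign w) *\<^sub>s
      (\<Prod>i<?l. h_fin k (int (\<mu> ! i) - int i + int (w i))))"
    unfolding schur_fin_det[OF shape_of_shape[OF assms]] det_mat_leibniz
    by (simp add: sign_mult_series shape_of_def atLeast0LessThan)
  finally show "coeff_of (schur \<mu>) M = coeff_of (\<Sum>w | w permutes {..<?l}. of_int (sign w) *\<^sub>s
      (\<Prod>i<?l. hz (int (\<mu> ! i) - int i + int (w i)))) M"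
    using k by (simp add: coeff_of_sum coeff_of_simps coeff_prod_h_fin)
qed

section \<open>Products of complete homogeneous functions\<close>

text \<open>The multiset is read as a composition: its letters name the factors and its
  multiplicities are their degrees. The type of letters is free, so that a matrix, as a multiset of
  pairs, also names a product, with one factor per entry.\<close>

definition hm :: "'a multiset \<Rightarrow> series" where
  "hm N = (\<Prod>i\<in>set_mset N. hz (int (count N i)))"

text \<open>A multiset of pairs stands for a matrix of natural numbers; its first and second projections
  are the row and column sums.\<close>

definition margins :: "'a multiset \<Rightarrow> 'b multiset \<Rightarrow> ('a \<times> 'b) multiset set" where
  "margins N M = {P. image_mset fst P = N \<and> image_mset snd P = M}"

text \<open>Row sums are prescribed on an index set instead of by a multiset, so that rows can be
  added one at a time and rows with sum 0 can be indexed too.\<close>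

definition matrices :: "('a \<Rightarrow> nat) \<Rightarrow> 'a set \<Rightarrow> 'b multiset \<Rightarrow> ('a \<times> 'b) multiset set" where
  "matrices c I M = {P. image_mset snd P = M \<and> fst ` set_mset P \<subseteq> I \<and>
     (\<forall>i\<in>I. count (image_mset fst P) i = c i)}"

lemma hz_0: "hz 0 = 1"
  by (rule series_eqI) (auto simp: hz.rep_eq coeff_of_one)

lemma hz_neg: "r < 0 \<Longrightarrow> hz r = 0"
  by (rule series_eqI) (auto simp: hz.rep_eq coeff_of_simps)

lemma hz_sym: "hz r \<in> sym_functions"
  by (auto simp: sym_functions_def hz.rep_eq intro!: exI[of _ "nat r"])

lemma hm_sym: "hm N \<in> sym_functions"
  by (simp add: hm_def sym_prod hz_sym)

lemma hm_superset:
  assumes "finite I" "set_mset N \<subseteq> I"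
  shows "hm N = (\<Prod>i\<in>I. hz (int (count N i)))"
  unfolding hm_def
  by (rule prod.mono_neutral_left) (use assms in \<open>auto simp: hz_0 not_in_iff\<close>)

lemma hm_empty: "hm {#} = 1"
  by (simp add: hm_def)

lemma hm_add_disjoint:
  assumes "set_mset N \<inter> set_mset N' = {}"
  shows "hm (N + N') = hm N * hm N'"
proof -
  have z: "i \<in># N \<Longrightarrow> count N' i = 0" "i \<in># N' \<Longrightarrow> count N i = 0" for i
    using assms by (metis IntI empty_iff not_in_iff)+
  have "hm (N + N') = (\<Prod>i\<in>set_mset N. hz (int (count (N + N') i))) *
      (\<Prod>i\<in>set_mset N'. hz (int (count (N + N') i)))"
    unfolding hm_def using assms by (simp add: prod.union_disjoint)
  also have "\<dots> = hm N * hm N'"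
    unfolding hm_def using assms
    by (intro arg_cong2[where f = "(*)"] prod.cong) (auto simp: z)
  finally show ?thesis .
qed

lemma count_image_mset_inj_on:
  assumes "inj_on g (set_mset N)" "x \<in># N"
  shows "count (image_mset g N) (g x) = count N x"
proof -
  have "{y. y \<in># N \<and> g x = g y} = {x}" using assms by (auto dest: inj_onD)
  then show ?thesis by (simp add: count_image_mset')
qed

lemma hm_image_inj:
  assumes "inj_on g (set_mset N)"
  shows "hm (image_mset g N) = hm N"
  unfolding hm_def using assms by (simp add: prod.reindex count_image_mset_inj_on)

lemma size_sum_count: "finite I \<Longrightarrow> set_mset N \<subseteq> I \<Longrightarrow> size N = (\<Sum>i\<in>I. count N i)"
  unfolding size_multiset_overloaded_eq by (rule sum.mono_neutral_left) (auto simp: not_in_iff)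

lemma finite_matrices:
  assumes "finite I"
  shows "finite (matrices c I M)"
proof (rule finite_subset)
  show "matrices c I M \<subseteq> multisets_of_size (I \<times> set_mset M) (size M)"
    by (force simp: matrices_def multisets_of_size_def)
qed (use assms in auto)

lemma margins_matrices: "margins N M = matrices (count N) (set_mset N) M"
proof -
  have "image_mset fst P = N \<longleftrightarrow>
      fst ` set_mset P \<subseteq> set_mset N \<and> (\<forall>i\<in>set_mset N. count (image_mset fst P) i = count N i)"
    for P :: "('a \<times> 'b) multiset"
  proof
    assume "image_mset fst P = N"
    then show "fst ` set_mset P \<subseteq> set_mset N \<and> (\<forall>i\<in>set_mset N. count (image_mset fst P) i = count N i)"
      by (metis order_refl set_image_mset)
  next
    assume *: "fst ` set_mset P \<subseteq> set_mset N \<and> (\<forall>i\<in>set_mset N. count (image_mset fst P) i = count N i)"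
    show "image_mset fst P = N"
    proof (rule multiset_eqI)
      fix i
      show "count (image_mset fst P) i = count N i"
      proof (cases "i \<in># N")
        case False
        then have "i \<notin># image_mset fst P" using * by auto
        with False show ?thesis by (simp only: not_in_iff)
      qed (use * in simp)
    qed
  qed
  then show ?thesis unfolding margins_def matrices_def by blast
qed

lemma finite_margins: "finite (margins N M)"
  by (simp add: margins_matrices finite_matrices)

lemma sum_matrices_empty:
  "(\<Sum>P\<in>matrices c {} M. F P) = (if M = {#} then F {#} else 0)"
proof -
  have "matrices c {} M = (if M = {#} then {{#}} else {})"
    by (auto simp: matrices_def)
  then show ?thesis by simp
qed

text \<open>A matrix is its row \<open>i\<close> together with the other rows: row \<open>i\<close>
  uses up the part \<open>A\<close> of the column content and leaves \<open>B\<close> to the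
  rest.\<close>

lemma sum_matrices_insert:
  fixes c :: "'a \<Rightarrow> nat" and M :: "'b multiset"
  assumes I: "finite I" "i \<notin> I"
  shows "(\<Sum>P\<in>matrices c (insert i I) M. F P)
    = (\<Sum>(A, B) | A + B = M \<and> size A = c i. \<Sum>Q\<in>matrices c I B. F (image_mset (Pair i) A + Q))"
proof -
  let ?S = "{(A, B). A + B = M \<and> size A = c i}"
  have fin: "finite ?S" by (rule finite_subset[OF _ finite_mset_splittings[of M]]) auto
  define on where "on P = filter_mset (\<lambda>p. fst p = i) P" for P :: "('a \<times> 'b) multiset"
  define off where "off P = filter_mset (\<lambda>p. fst p \<noteq> i) P" for P :: "('a \<times> 'b) multiset"
  have P: "on P + off P = P" for P unfolding on_def off_def by (metis multiset_partition)
  have on: "image_mset (Pair i) (image_mset snd (on P)) = on P" for P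
    unfolding on_def by (induction P) auto
  have cnt_on: "size (on P) = count (image_mset fst P) i" for P
    unfolding on_def by (induction P) auto
  have cnt_off: "count (image_mset fst (off P)) j = count (image_mset fst P) j" if "j \<noteq> i" for P j
  proof -
    have "j \<notin># image_mset fst (on P)" using that by (auto simp: on_def)
    then have "count (image_mset fst (on P)) j = 0" by (simp only: not_in_iff)
    then show ?thesis by (metis P add_0 count_union image_mset_union)
  qed
  have off_on: "on (image_mset (Pair i) A + Q) = image_mset (Pair i) A"
    "off (image_mset (Pair i) A + Q) = Q" if "Q \<in> matrices c I B" for A B Q
  proof -
    have "fst p \<noteq> i" if "p \<in># Q" for p
      using \<open>Q \<in> matrices c I B\<close> I(2) that by (auto simp: matrices_def)
    then have "filter_mset (\<lambda>p. fst p = i) Q = {#}" "filter_mset (\<lambda>p. fst p \<noteq> i) Q = Q"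
      using filter_mset_cong[OF refl, of Q "\<lambda>p. fst p = i" "\<lambda>_. False"]
        filter_mset_cong[OF refl, of Q "\<lambda>p. fst p \<noteq> i" "\<lambda>_. True"] by auto
    moreover have "filter_mset (\<lambda>p. fst p = i) (image_mset (Pair i) A) = image_mset (Pair i) A"
      "filter_mset (\<lambda>p. fst p \<noteq> i) (image_mset (Pair i) A) = {#}"
      by (induction A) auto
    ultimately show "on (image_mset (Pair i) A + Q) = image_mset (Pair i) A"
      "off (image_mset (Pair i) A + Q) = Q"
      unfolding on_def off_def by auto
  qed
  have to: "off P \<in> matrices c I (image_mset snd (off P))" "size (on P) = c i"
    "image_mset snd (on P) + image_mset snd (off P) = M"
    if "P \<in> matrices c (insert i I) M" for P
  proof -
    show "size (on P) = c i" using that by (simp add: cnt_on matrices_def)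
    show "image_mset snd (on P) + image_mset snd (off P) = M"
      using that by (simp add: P matrices_def flip: image_mset_union)
    show "off P \<in> matrices c I (image_mset snd (off P))"
    proof -
      have "count (image_mset fst (off P)) j = c j" if "j \<in> I" for j
      proof -
        have "j \<noteq> i" using that I(2) by blast
        then show ?thesis using \<open>P \<in> matrices c (insert i I) M\<close> that by (simp add: cnt_off matrices_def)
      qed
      moreover have "fst ` set_mset (off P) \<subseteq> I" using that by (auto simp: matrices_def off_def)
      ultimately show ?thesis by (simp add: matrices_def)
    qed
  qed
  have mem: "image_mset (Pair i) A + Q \<in> matrices c (insert i I) (A + B)"
    if "Q \<in> matrices c I B" "size A = c i" for A B Q
  proof -
    have "i \<notin># image_mset fst Q" using that(1) I(2) by (auto simp: matrices_def)
    then have "count (image_mset fst Q) i = 0" by (simp only: not_in_iff)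
    moreover have "count (image_mset fst (image_mset (Pair i) A)) j = (if j = i then c i else 0)" for j
      using that(2) by (simp add: multiset.map_comp o_def image_mset_const_eq)
    ultimately show ?thesis using that I(2)
      by (auto simp: matrices_def multiset.map_comp o_def)
  qed
  have onP: "image_mset (Pair i) (image_mset snd (on P)) + off P = P" for P
    by (simp only: on P)
  have sndP: "image_mset snd (image_mset (Pair i) A) = A" for A :: "'b multiset"
    by (simp add: multiset.map_comp o_def)
  have sndQ: "image_mset snd Q = B" if "Q \<in> matrices c I B" for Q B
    using that by (simp add: matrices_def)
  have "(\<Sum>P\<in>matrices c (insert i I) M. F P)
      = (\<Sum>((A, B), Q)\<in>Sigma ?S (\<lambda>(A, B). matrices c I B). F (image_mset (Pair i) A + Q))"
    by (rule sum.reindex_bij_witness[where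
          i = "\<lambda>((A, B), Q). image_mset (Pair i) A + Q" and
          j = "\<lambda>P. ((image_mset snd (on P), image_mset snd (off P)), off P)"])
       (auto simp: onP sndP to off_on intro: mem dest: sndQ)
  also have "\<dots> = (\<Sum>(A, B)\<in>?S. \<Sum>Q\<in>matrices c I B. F (image_mset (Pair i) A + Q))"
    using fin I(1) by (subst sum.Sigma[symmetric]) (auto simp: finite_matrices case_prod_unfold)
  finally show ?thesis .
qed

text \<open>Every monomial of the right degree has coefficient 1 in a complete function, so only the
  ways of distributing \<open>M\<close> over the factors are counted, and these are the rows of a
  matrix.\<close>

lemma coeff_prod_hz:
  assumes "finite I"
  shows "coeff_of (\<Prod>i\<in>I. hz (int (c i))) M = of_nat (card (matrices c I M))"
  using assms
proof (induction I arbitrary: M rule: finite_induct)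
  case empty
  show ?case using sum_matrices_empty[where c = c and M = M and F = "\<lambda>_. 1 :: nat"] by (simp add: coeff_of_one)
next
  case (insert i I)
  have "coeff_of (\<Prod>j\<in>insert i I. hz (int (c j))) M
      = (\<Sum>(A, B) | A + B = M. if size A = c i then of_nat (card (matrices c I B)) else 0)"
    using insert by (auto simp: coeff_of_times hz.rep_eq intro!: sum.cong)
  also have "\<dots> = (\<Sum>(A, B) | A + B = M \<and> size A = c i. of_nat (card (matrices c I B)))"
    by (rule sum.mono_neutral_cong_right) (auto simp: finite_mset_splittings split: if_splits)
  also have "\<dots> = of_nat (card (matrices c (insert i I) M))"
    using sum_matrices_insert[OF insert.hyps(1,2), where c = c and M = M and F = "\<lambda>_. 1 :: rat"] by simp
  finally show ?case .
qed

lemma coeff_hm: "coeff_of (hm N) M = of_nat (card (margins N M))"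
  unfolding hm_def margins_matrices by (rule coeff_prod_hz) simp

lemma card_margins_swap: "card (margins N M) = card (margins M N)"
proof (rule bij_betw_same_card)
  show "bij_betw (image_mset prod.swap) (margins N M) (margins M N)"
    by (rule bij_betwI[where g = "image_mset prod.swap"])
       (auto simp: margins_def multiset.map_comp o_def)
qed

text \<open>Transposition of matrices. This symmetry makes it possible to evaluate functionals of
  coefficients on \<open>hm\<close>, as in \<open>schur_coord_hm\<close>.\<close>

lemma coeff_hm_commute: "coeff_of (hm N) M = coeff_of (hm M) N"
  unfolding coeff_hm by (subst card_margins_swap) (rule refl)

lemma coeff_hm_size: "coeff_of (hm N) M \<noteq> 0 \<Longrightarrow> size N = size M"
proof -
  assume "coeff_of (hm N) M \<noteq> 0"
  then have "margins N M \<noteq> {}" by (auto simp: coeff_hm)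
  then show ?thesis by (auto simp: margins_def)
qed

section \<open>Coordinates with respect to the Schur functions\<close>

definition jt_index :: "nat list \<Rightarrow> (nat \<Rightarrow> nat) \<Rightarrow> nat \<Rightarrow> int" where
  "jt_index \<mu> w i = int (shape_of \<mu> i) - int i + int (w i)"

text \<open>These are the terms of the determinant without a vanishing factor; each of them is
  \<open>hm\<close> of the content recorded by \<open>jt_content\<close>.\<close>

definition jt_perms :: "nat list \<Rightarrow> (nat \<Rightarrow> nat) set" where
  "jt_perms \<mu> = {w. w permutes {..<length \<mu>} \<and> (\<forall>i<length \<mu>. 0 \<le> jt_index \<mu> w i)}"

definition jt_content :: "nat list \<Rightarrow> (nat \<Rightarrow> nat) \<Rightarrow> nat multiset" where
  "jt_content \<mu> w = (\<Sum>i<length \<mu>. replicate_mset (nat (jt_index \<mu> w i)) i)"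

text \<open>Comparing these partial sums for all \<open>k\<close> is the dominance order on
  contents.\<close>

definition psum :: "nat multiset \<Rightarrow> nat \<Rightarrow> nat" where
  "psum N k = (\<Sum>i<k. count N i)"

lemma finite_jt_perms: "finite (jt_perms \<mu>)"
  by (rule finite_subset[OF _ finite_permutations[of "{..<length \<mu>}"]]) (auto simp: jt_perms_def)

lemma id_jt_perms: "id \<in> jt_perms \<mu>"
  by (simp add: jt_perms_def permutes_id jt_index_def)

lemma count_jt_content:
  assumes "w \<in> jt_perms \<mu>"
  shows "int (count (jt_content \<mu> w) i) = jt_index \<mu> w i"
proof (cases "i < length \<mu>")
  case True
  then show ?thesis using assms
    by (simp add: jt_content_def count_sum jt_perms_def sum.delta')
next
  case False
  then have "w i = i" using assms by (auto simp: jt_perms_def permutes_def)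
  then show ?thesis using False
    by (auto simp: jt_content_def count_sum jt_index_def shape_of_def)
qed

lemma set_jt_content: "set_mset (jt_content \<mu> w) \<subseteq> {..<length \<mu>}"
  by (auto simp: jt_content_def set_mset_sum split: if_splits)

lemma hm_jt_content:
  assumes "w \<in> jt_perms \<mu>"
  shows "hm (jt_content \<mu> w) = (\<Prod>i<length \<mu>. hz (jt_index \<mu> w i))"
  by (simp add: hm_superset[OF _ set_jt_content] count_jt_content[OF assms])

theorem jacobi_trudi_hm:
  assumes "sorted_wrt (\<ge>) \<mu>"
  shows "schur \<mu> = (\<Sum>w\<in>jt_perms \<mu>. of_int (sign w) *\<^sub>s hm (jt_content \<mu> w))"
proof -
  have "schur \<mu> = (\<Sum>w | w permutes {..<length \<mu>}. of_int (sign w) *\<^sub>s (\<Prod>i<length \<mu>. hz (jt_index \<mu> w i)))"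
    unfolding jacobi_trudi[OF assms] by (simp add: jt_index_def shape_of_def)
  also have "\<dots> = (\<Sum>w\<in>jt_perms \<mu>. of_int (sign w) *\<^sub>s hm (jt_content \<mu> w))"
  proof (rule sum.mono_neutral_cong_right)
    show "\<forall>w\<in>{w. w permutes {..<length \<mu>}} - jt_perms \<mu>.
        of_int (sign w) *\<^sub>s (\<Prod>i<length \<mu>. hz (jt_index \<mu> w i)) = 0"
    proof
      fix w assume "w \<in> {w. w permutes {..<length \<mu>}} - jt_perms \<mu>"
      then obtain i where "i < length \<mu>" "jt_index \<mu> w i < 0"
        by (auto simp: jt_perms_def not_le)
      then have "(\<Prod>i<length \<mu>. hz (jt_index \<mu> w i)) = 0"
        by (intro prod_zero bexI[of _ i]) (auto simp: hz_neg)
      then show "of_int (sign w) *\<^sub>s (\<Prod>i<length \<mu>. hz (jt_index \<mu> w i)) = 0" by simp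
    qed
  qed (auto simp: finite_permutations hm_jt_content jt_perms_def)
  finally show ?thesis .
qed

lemma sum_permutation_ge:
  assumes "w permutes (S :: nat set)"
  shows "\<Sum>{..<k} \<le> sum w {..<k}"
  using card_sum_le_nat_sum[of "w ` {..<k}"] permutes_inj_on[OF assms, of "{..<k}"]
  by (simp add: card_image sum.reindex lessThan_atLeast0)

lemma psum_jt_content:
  assumes "w \<in> jt_perms \<mu>"
  shows "psum (jt_content \<mu> w) k + \<Sum>{..<k} = sum (shape_of \<mu>) {..<k} + sum w {..<k}"
proof -
  have "int (psum (jt_content \<mu> w) k + \<Sum>{..<k}) = int (sum (shape_of \<mu>) {..<k} + sum w {..<k})"
    unfolding psum_def of_nat_add of_nat_sum count_jt_content[OF assms] jt_index_def
    by (simp add: sum.distrib sum_subtractf)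
  then show ?thesis by (simp only: of_nat_eq_iff)
qed

text \<open>The first \<open>k\<close> values of a permutation are distinct, so they sum to at least
  0 + ... + (k - 1). Contents in the determinant thus lie above the shape in dominance, while
  contents of tableaux lie below it (\<open>coeff_schur_dominated\<close>).\<close>

lemma jt_content_dominates:
  assumes "w \<in> jt_perms \<mu>"
  shows "sum (shape_of \<mu>) {..<k} \<le> psum (jt_content \<mu> w) k"
  using psum_jt_content[OF assms, of k] sum_permutation_ge[of w "{..<length \<mu>}" k] assms
  by (simp add: jt_perms_def)

lemma jt_content_dominates_strict:
  assumes "w \<in> jt_perms \<mu>" "w \<noteq> id"
  shows "\<exists>k. sum (shape_of \<mu>) {..<k} < psum (jt_content \<mu> w) k"
proof (rule ccontr)
  assume "\<not> ?thesis"
  then have eq: "sum w {..<k} = \<Sum>{..<k}" for k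
    using psum_jt_content[OF assms(1), of k] jt_content_dominates[OF assms(1), of k]
    by (simp add: not_less) (metis add_left_cancel le_antisym)
  have "w k = k" for k using eq[of "Suc k"] eq[of k] by simp
  then show False using assms(2) by auto
qed

lemma psum_large:
  assumes "set_mset N \<subseteq> {..<k}"
  shows "psum N k = size N"
  unfolding psum_def by (rule size_sum_count[symmetric]) (use assms in auto)

lemma size_jt_content:
  assumes "w \<in> jt_perms \<mu>"
  shows "size (jt_content \<mu> w) = sum_list \<mu>"
proof -
  let ?l = "length \<mu>"
  have w: "w permutes {..<?l}" using assms by (simp add: jt_perms_def)
  have "sum w {..<?l} = \<Sum>{..<?l}"
    using sum.permute[OF w, of id] by (simp add: o_def)
  then have "psum (jt_content \<mu> w) ?l = sum (shape_of \<mu>) {..<?l}"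
    using psum_jt_content[OF assms, of ?l] by simp
  also have "\<dots> = sum_list \<mu>" by (simp add: shape_of_def sum_list_sum_nth lessThan_atLeast0)
  finally show ?thesis by (simp add: psum_large[OF set_jt_content])
qed

section \<open>Dominance for the contents of tableaux\<close>

lemma tab_ge_row:
  assumes "sorted_wrt (\<ge>) \<mu>" "semistandard \<mu> T" "(i, j) \<in> cells \<mu>"
  shows "i \<le> T (i, j)"
  using assms(3)
proof (induction i)
  case (Suc i)
  have "(i, j) \<in> cells \<mu>"
    using shape_of_shape[OF assms(1)] Suc.prems
    by (auto simp: cells_boxes boxes_def shape_def intro: less_le_trans)
  moreover have "T (i, j) < T (i + 1, j)" using assms(2) Suc.prems by (auto simp: semistandard_def)
  ultimately show ?case using Suc.IH by simp
qed simp

lemma finite_cells: "finite (cells \<mu>)"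
proof (rule finite_subset)
  show "cells \<mu> \<subseteq> Sigma {..<length \<mu>} (\<lambda>i. {..<\<mu> ! i})" by (auto simp: cells_def)
qed auto

lemma card_cells_rows: "card {c \<in> cells \<mu>. fst c < k} = sum (shape_of \<mu>) {..<k}"
proof -
  have "{c \<in> cells \<mu>. fst c < k} = Sigma {..<k} (\<lambda>i. {..<shape_of \<mu> i})"
    by (auto simp: cells_boxes boxes_def)
  then show ?thesis by simp
qed

lemma count_image_mset_set:
  "finite A \<Longrightarrow> count (image_mset T (mset_set A)) k = card {c \<in> A. T c = k}"
  by (simp add: count_image_mset' eq_commute)

lemma psum_image:
  assumes "finite A"
  shows "psum (image_mset T (mset_set A)) k = card {c \<in> A. T c < k}"
proof (induction k)
  case (Suc k)
  have "{c \<in> A. T c < Suc k} = {c \<in> A. T c < k} \<union> {c \<in> A. T c = k}" by auto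
  then show ?case using Suc assms
    by (simp add: psum_def card_Un_disjoint disjoint_iff count_image_mset_set)
qed (simp add: psum_def)

text \<open>Columns increase strictly, so an entry in row \<open>i\<close> is at least
  \<open>i\<close>; the letters below \<open>k\<close> are confined to the first \<open>k\<close>
  rows.\<close>

lemma coeff_schur_dominated:
  assumes "sorted_wrt (\<ge>) \<mu>" "coeff_of (schur \<mu>) M \<noteq> 0"
  shows "psum M k \<le> sum (shape_of \<mu>) {..<k}"
proof -
  obtain T where T: "semistandard \<mu> T" and M: "M = image_mset T (mset_set (cells \<mu>))"
    using assms(2) by (auto simp: schur.rep_eq dest!: card_gt_0_iff[THEN iffD1, rotated])
  have "i < k" if "(i, j) \<in> cells \<mu>" "T (i, j) < k" for i j
    using tab_ge_row[OF assms(1) T that(1)] that(2) by simp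
  then have "{c \<in> cells \<mu>. T c < k} \<subseteq> {c \<in> cells \<mu>. fst c < k}" by auto
  then have "card {c \<in> cells \<mu>. T c < k} \<le> card {c \<in> cells \<mu>. fst c < k}"
    using finite_cells by (intro card_mono) auto
  then show ?thesis unfolding M psum_image[OF finite_cells] card_cells_rows .
qed

text \<open>For this content the letters below \<open>k\<close> are as many as the cells of the
  first \<open>k\<close> rows, which contain them. So they fill these rows for every
  \<open>k\<close>, and row \<open>i\<close> consists of the letter \<open>i\<close>.\<close>

lemma coeff_schur_diagonal:
  assumes "sorted_wrt (\<ge>) \<mu>"
  shows "coeff_of (schur \<mu>) (jt_content \<mu> id) = 1"
proof -
  define T0 where "T0 = (\<lambda>c. if c \<in> cells \<mu> then fst c else 0 :: nat)"
  have ps: "psum (jt_content \<mu> id) k = sum (shape_of \<mu>) {..<k}" for k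
    using psum_jt_content[OF id_jt_perms, of \<mu> k] by simp
  have "{T. semistandard \<mu> T \<and> image_mset T (mset_set (cells \<mu>)) = jt_content \<mu> id} = {T0}"
  proof (intro equalityI subsetI)
    fix T assume "T \<in> {T. semistandard \<mu> T \<and> image_mset T (mset_set (cells \<mu>)) = jt_content \<mu> id}"
    then have T: "semistandard \<mu> T" and c: "image_mset T (mset_set (cells \<mu>)) = jt_content \<mu> id"
      by auto
    have ge: "fst x \<le> T x" if "x \<in> cells \<mu>" for x
      using tab_ge_row[OF assms T, of "fst x" "snd x"] that by simp
    have "T x \<le> fst x" if x: "x \<in> cells \<mu>" for x
    proof -
      let ?k = "Suc (fst x)"
      have "card {c \<in> cells \<mu>. T c < ?k} = card {c \<in> cells \<mu>. fst c < ?k}"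
        using psum_image[OF finite_cells, of T \<mu> ?k] by (simp only: c ps card_cells_rows)
      moreover have "{c \<in> cells \<mu>. T c < ?k} \<subseteq> {c \<in> cells \<mu>. fst c < ?k}"
        using ge by (auto intro: le_less_trans)
      ultimately have "{c \<in> cells \<mu>. T c < ?k} = {c \<in> cells \<mu>. fst c < ?k}"
        using finite_cells by (intro card_subset_eq) auto
      then have "x \<in> {c \<in> cells \<mu>. T c < ?k}" using x by blast
      then show ?thesis by simp
    qed
    note le = this
    have z: "T x = 0" if "x \<notin> cells \<mu>" for x using T that unfolding semistandard_def by blast
    have "T x = T0 x" for x
      using ge[of x] le[of x] z[of x] by (cases "x \<in> cells \<mu>") (simp_all add: T0_def)
    then show "T \<in> {T0}" by auto
  next
    have "semistandard \<mu> T0"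
      unfolding semistandard_def
    proof (intro conjI allI impI)
      fix i j
      show "T0 (i, j) \<le> T0 (i, j + 1)" if "(i, j + 1) \<in> cells \<mu>" using that by (auto simp: T0_def)
      show "T0 (i, j) < T0 (i + 1, j)" if "(i + 1, j) \<in> cells \<mu>" using that by (auto simp: T0_def)
    qed (simp add: T0_def)
    moreover have "image_mset T0 (mset_set (cells \<mu>)) = jt_content \<mu> id"
    proof (rule multiset_eqI)
      fix i
      have "{x \<in> cells \<mu>. T0 x = i} = {i} \<times> {..<shape_of \<mu> i}"
        by (auto simp: T0_def cells_boxes boxes_def)
      then have "count (image_mset T0 (mset_set (cells \<mu>))) i = shape_of \<mu> i"
        by (simp add: count_image_mset_set finite_cells)
      then show "count (image_mset T0 (mset_set (cells \<mu>))) i = count (jt_content \<mu> id) i"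
        using count_jt_content[OF id_jt_perms, of \<mu> i] by (simp add: jt_index_def)
    qed
    ultimately show "T \<in> {T. semistandard \<mu> T \<and> image_mset T (mset_set (cells \<mu>)) = jt_content \<mu> id}"
      if "T \<in> {T0}" for T using that by simp
  qed
  then show ?thesis by (simp add: schur.rep_eq)
qed

text \<open>The Jacobi--Trudi expansion of \<open>schur \<mu>\<close> with \<open>hm N\<close>
  replaced by the coefficient at \<open>N\<close>. As complete and monomial functions are dual, this
  is the scalar product with \<open>schur \<mu>\<close>, available before any basis is
  known.\<close>

definition schur_coord :: "nat list \<Rightarrow> series \<Rightarrow> rat" where
  "schur_coord \<mu> g = (\<Sum>w\<in>jt_perms \<mu>. of_int (sign w) * coeff_of g (jt_content \<mu> w))"

lemma schur_coord_add: "schur_coord \<mu> (f + g) = schur_coord \<mu> f + schur_coord \<mu> g"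
  by (simp add: schur_coord_def coeff_of_simps algebra_simps sum.distrib)

lemma schur_coord_scale: "schur_coord \<mu> (c *\<^sub>s g) = c * schur_coord \<mu> g"
  by (simp add: schur_coord_def coeff_of_simps sum_distrib_left mult.left_commute)

lemma schur_coord_zero: "schur_coord \<mu> 0 = 0"
  by (simp add: schur_coord_def coeff_of_simps)

lemma schur_coord_sum: "schur_coord \<mu> (sum g A) = (\<Sum>x\<in>A. schur_coord \<mu> (g x))"
  by (induction A rule: infinite_finite_induct) (auto simp: schur_coord_zero schur_coord_add)

text \<open>Both sides are signed counts of matrices, related by transposition. These values are the
  Kostka numbers.\<close>

lemma schur_coord_hm:
  assumes "sorted_wrt (\<ge>) \<mu>"
  shows "schur_coord \<mu> (hm M) = coeff_of (schur \<mu>) M"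
  unfolding jacobi_trudi_hm[OF assms]
  by (simp add: schur_coord_def coeff_of_sum coeff_of_simps coeff_hm_commute[of M])

lemma schur_coord_schur_commute:
  assumes "sorted_wrt (\<ge>) \<mu>" "sorted_wrt (\<ge>) lam"
  shows "schur_coord \<mu> (schur lam) = schur_coord lam (schur \<mu>)"
proof -
  have "schur_coord \<mu> (schur lam) = (\<Sum>w\<in>jt_perms lam. of_int (sign w) * schur_coord \<mu> (hm (jt_content lam w)))"
    by (subst jacobi_trudi_hm[OF assms(2)]) (simp add: schur_coord_sum schur_coord_scale)
  also have "\<dots> = schur_coord lam (schur \<mu>)"
    by (simp add: schur_coord_hm[OF assms(1)] schur_coord_def[of lam])
  finally show ?thesis .
qed

lemma shape_of_inj:
  assumes "0 \<notin> set \<mu>" "0 \<notin> set lam" "shape_of \<mu> = shape_of lam"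
  shows "\<mu> = lam"
proof (rule nth_equalityI)
  have nz: "i < length \<mu> \<longleftrightarrow> shape_of \<mu> i \<noteq> 0" if "0 \<notin> set \<mu>" for \<mu> i
    using that by (auto simp: shape_of_def) (metis gr0I nth_mem)
  show len: "length \<mu> = length lam"
    using nz[OF assms(1)] nz[OF assms(2)] assms(3) by (metis linorder_neqE_nat nat_neq_iff)
  show "\<mu> ! i = lam ! i" if "i < length \<mu>" for i
    using fun_cong[OF assms(3), of i] that len by (simp add: shape_of_def)
qed

text \<open>A nonzero value puts a determinant content of \<mu> into the support of
  \<open>schur lam\<close>, so \<open>lam\<close> dominates \<mu>. As the pairing is symmetric,
  \<mu> also dominates \<open>lam\<close>, and the shapes agree. On the diagonal strict dominance
  removes every term except that of \<open>id\<close>.\<close>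

theorem schur_coord_schur:
  assumes "\<mu> \<turnstile> m" "lam \<turnstile> n"
  shows "schur_coord \<mu> (schur lam) = (if \<mu> = lam then 1 else 0)"
proof -
  have s: "sorted_wrt (\<ge>) \<mu>" "sorted_wrt (\<ge>) lam" "0 \<notin> set \<mu>" "0 \<notin> set lam"
    using assms by (auto simp: partition_of_def)
  have le: "sum (shape_of \<mu>) {..<k} \<le> sum (shape_of lam) {..<k}"
    if "schur_coord \<mu> (schur lam) \<noteq> 0" "sorted_wrt (\<ge>) lam" for \<mu> lam k
  proof -
    obtain w where "w \<in> jt_perms \<mu>" "coeff_of (schur lam) (jt_content \<mu> w) \<noteq> 0"
      using \<open>schur_coord \<mu> (schur lam) \<noteq> 0\<close> unfolding schur_coord_def
      by (metis (no_types, lifting) mult_zero_right sum.neutral)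
    then show ?thesis
      using jt_content_dominates[of w \<mu> k] coeff_schur_dominated[OF that(2)] by (meson le_trans)
  qed
  show ?thesis
  proof (cases "\<mu> = lam")
    case True
    have "schur_coord lam (schur lam)
        = (\<Sum>w\<in>{id}. of_int (sign w) * coeff_of (schur lam) (jt_content lam w))"
      unfolding schur_coord_def
    proof (rule sum.mono_neutral_right)
      show "\<forall>w\<in>jt_perms lam - {id}. of_int (sign w) * coeff_of (schur lam) (jt_content lam w) = 0"
        using jt_content_dominates_strict[of _ lam] coeff_schur_dominated[OF s(2)]
        by (metis DiffD1 DiffD2 leD mult_zero_right singletonI)
    qed (auto simp: finite_jt_perms id_jt_perms)
    then show ?thesis using True by (simp add: coeff_schur_diagonal[OF s(2)])
  next
    case False
    have "shape_of \<mu> = shape_of lam" if "schur_coord \<mu> (schur lam) \<noteq> 0"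
    proof
      fix i
      have "sum (shape_of \<mu>) {..<k} = sum (shape_of lam) {..<k}" for k
        using le[of \<mu> lam k] le[of lam \<mu> k] that s schur_coord_schur_commute[OF s(1,2)] by simp
      from this[of "Suc i"] this[of i] show "shape_of \<mu> i = shape_of lam i" by simp
    qed
    then show ?thesis using False shape_of_inj s by fastforce
  qed
qed

section \<open>The Schur basis and the scalar product\<close>

lemma finite_partitions: "finite {\<mu>. \<mu> \<turnstile> n}"
proof (rule finite_subset)
  have "length \<mu> \<le> sum_list \<mu>" if "0 \<notin> set \<mu>" for \<mu> :: "nat list"
    using that by (induction \<mu>) auto
  then show "{\<mu>. \<mu> \<turnstile> n} \<subseteq> {\<mu>. set \<mu> \<subseteq> {..n} \<and> length \<mu> \<le> n}"
    by (auto simp: partition_of_def dest: member_le_sum_list)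
qed (simp add: finite_lists_length_le)

section \<open>A symmetric function is determined by its Schur coordinates\<close>

lemma extend_inj_to_bij:
  fixes f :: "'a \<Rightarrow> 'a"
  assumes "finite A" "inj_on f A"
  obtains p where "bij p" "\<And>x. x \<in> A \<Longrightarrow> p x = f x"
proof -
  let ?F = "A \<union> f ` A"
  have "card (?F - A) = card (?F - f ` A)"
    using assms by (simp add: card_Diff_subset card_image)
  then obtain h where h: "bij_betw h (?F - A) (?F - f ` A)"
    using assms(1) by (metis finite_Diff finite_UnI finite_imageI finite_same_card_bij)
  let ?p = "\<lambda>x. if x \<in> A then f x else if x \<in> ?F then h x else x"
  have "bij_betw ?p A (f ` A)"
    using assms(2) by (auto simp: bij_betw_def inj_on_def)
  moreover have "bij_betw ?p (?F - A) (?F - f ` A)"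
    using h by (rule bij_betw_cong[THEN iffD1, rotated]) auto
  ultimately have "bij_betw ?p (A \<union> (?F - A)) (f ` A \<union> (?F - f ` A))"
    by (rule bij_betw_combine) auto
  moreover have "A \<union> (?F - A) = ?F" "f ` A \<union> (?F - f ` A) = ?F" by auto
  ultimately have "bij_betw ?p ?F ?F" by (simp only:)
  then have "?p permutes ?F" by (rule bij_imp_permutes) auto
  then show ?thesis by (intro that[of ?p]) (auto dest: permutes_bij)
qed

text \<open>The letters are renamed by decreasing multiplicity. Symmetry is invariance under
  bijections of all numbers, hence the extension of the renaming by
  \<open>extend_inj_to_bij\<close>.\<close>

lemma relabel_to_partition:
  fixes M :: "nat multiset"
  obtains lam p where "lam \<turnstile> size M" "bij p" "image_mset p M = jt_content lam id"
proof -
  define xs where "xs = rev (sort_key (count M) (sorted_list_of_set (set_mset M)))"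
  define lam where "lam = map (count M) xs"
  have dist: "distinct xs" and set: "set xs = set_mset M" by (simp_all add: xs_def)
  have "sorted (rev lam)" by (simp add: lam_def xs_def rev_map)
  then have "sorted_wrt (\<ge>) lam" by (simp add: sorted_wrt_rev)
  moreover have "0 \<notin> set lam" using set by (auto simp: lam_def count_eq_zero_iff dest!: sym[of 0])
  moreover have "sum_list lam = size M"
    using dist set by (simp add: lam_def sum_list_distinct_conv_sum_set size_multiset_overloaded_eq)
  ultimately have lam: "lam \<turnstile> size M" by (simp add: partition_of_def)
  define f where "f x = (THE i. i < length xs \<and> xs ! i = x)" for x
  have f: "f (xs ! i) = i" if "i < length xs" for i
    unfolding f_def using that dist by (intro the_equality) (auto simp: nth_eq_iff_index_eq)
  have "inj_on f (set_mset M)"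
    unfolding set[symmetric] by (rule inj_onI) (metis f in_set_conv_nth)
  then obtain p where p: "bij p" and pf: "\<And>x. x \<in> set_mset M \<Longrightarrow> p x = f x"
    by (rule extend_inj_to_bij[rotated]) auto
  have pinv: "p (xs ! i) = i" if "i < length xs" for i
    using f[OF that] pf nth_mem[OF that] set by simp
  have inj: "inj_on p (set_mset M)" using p by (meson bij_is_inj inj_on_subset subset_UNIV)
  have "image_mset p M = jt_content lam id"
  proof (rule multiset_eqI)
    fix i
    show "count (image_mset p M) i = count (jt_content lam id) i"
    proof (cases "i < length xs")
      case True
      then have "xs ! i \<in># M" using set nth_mem by blast
      then have "count (image_mset p M) (p (xs ! i)) = count M (xs ! i)"
        by (rule count_image_mset_inj_on[OF inj])
      moreover have "int (count (jt_content lam id) i) = int (count M (xs ! i))"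
        using True by (simp add: count_jt_content[OF id_jt_perms] jt_index_def shape_of_def lam_def)
      ultimately show ?thesis using pinv[OF True] by simp
    next
      case False
      have "i \<notin># image_mset p M"
      proof
        assume "i \<in># image_mset p M"
        then obtain x where "x \<in> set xs" "p x = i" using set by auto
        then obtain j where "j < length xs" "p (xs ! j) = i" by (metis in_set_conv_nth)
        then show False using pinv False by simp
      qed
      moreover have "i \<notin># jt_content lam id"
        using set_jt_content[of lam id] False by (auto simp: lam_def)
      ultimately show ?thesis by (simp only: not_in_iff)
    qed
  qed
  then show ?thesis using that lam p by blast
qed

text \<open>A numerical measure that, unlike the partial sums \<open>psum\<close>, is invariant
  under relabelling and yet grows strictly from the identity term of the determinant to every other
  term.\<close>

definition sum_squares :: "nat multiset \<Rightarrow> nat" where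
  "sum_squares N = (\<Sum>i\<in>set_mset N. (count N i)\<^sup>2)"

lemma sum_squares_superset:
  "finite I \<Longrightarrow> set_mset N \<subseteq> I \<Longrightarrow> sum_squares N = (\<Sum>i\<in>I. (count N i)\<^sup>2)"
  unfolding sum_squares_def by (rule sum.mono_neutral_left) (auto simp: not_in_iff)

lemma sum_squares_le: "sum_squares N \<le> (size N)\<^sup>2"
proof -
  have "sum_squares N \<le> (\<Sum>i\<in>set_mset N. count N i * size N)"
    unfolding sum_squares_def power2_eq_square by (intro sum_mono mult_left_mono) (auto simp: count_le_size)
  also have "\<dots> = (size N)\<^sup>2"
    by (simp add: size_multiset_overloaded_eq power2_eq_square flip: sum_distrib_right)
  finally show ?thesis .
qed

lemma sum_squares_relabel:
  assumes "bij p"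
  shows "sum_squares (image_mset p N) = sum_squares N"
proof -
  have inj: "inj_on p (set_mset N)" using assms by (meson bij_is_inj inj_on_subset subset_UNIV)
  then show ?thesis by (simp add: sum_squares_def sum.reindex count_image_mset_inj_on)
qed

lemma abel_summation:
  fixes a d :: "nat \<Rightarrow> 'a :: comm_ring_1"
  shows "(\<Sum>i<l. a i * d i) = a l * sum d {..<l} + (\<Sum>i<l. (a i - a (Suc i)) * sum d {..<Suc i})"
  by (induction l) (auto simp: algebra_simps)

text \<open>With \<open>a\<close> the row lengths and \<open>d i = w i - i\<close>, the squares grow
  by \<open>2 * a i * d i + (d i)^2\<close>. Summation by parts writes the mixed sum through
  decreases of \<open>a\<close> and partial sums of \<open>d\<close>, all nonnegative, and the sum
  of the \<open>(d i)^2\<close> is positive.\<close>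

lemma sum_squares_jt_content:
  assumes mu: "sorted_wrt (\<ge>) \<mu>" and w: "w \<in> jt_perms \<mu>" "w \<noteq> id"
  shows "sum_squares (jt_content \<mu> id) < sum_squares (jt_content \<mu> w)"
proof -
  let ?l = "length \<mu>"
  define a where "a i = int (shape_of \<mu> i)" for i
  define d where "d i = int (w i) - int i" for i
  have wp: "w permutes {..<?l}" using w by (simp add: jt_perms_def)
  have sq: "int (sum_squares (jt_content \<mu> v)) = (\<Sum>i<?l. (jt_index \<mu> v i)\<^sup>2)" if "v \<in> jt_perms \<mu>" for v
    by (simp add: sum_squares_superset[OF _ set_jt_content] count_jt_content[OF that])
  have D: "sum d {..<k} \<ge> 0" for k
  proof -
    have "int (\<Sum>{..<k}) \<le> int (sum w {..<k})"
      by (simp only: of_nat_le_iff sum_permutation_ge[OF wp])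
    then show ?thesis by (simp add: d_def sum_subtractf)
  qed
  have "a l \<ge> a (Suc l)" for l
    using shape_of_shape[OF mu] by (simp add: a_def shape_def)
  then have "0 \<le> (a i - a (Suc i)) * sum d {..<Suc i}" for i
    using D[of "Suc i"] by (intro mult_nonneg_nonneg) (simp_all del: sum.lessThan_Suc)
  moreover have "0 \<le> a ?l * sum d {..<?l}" using D by (simp add: a_def)
  ultimately have ad: "0 \<le> (\<Sum>i<?l. a i * d i)"
    by (subst abel_summation) (meson add_nonneg_nonneg sum_nonneg)
  obtain i where i: "w i \<noteq> i" using w(2) by (auto simp: fun_eq_iff)
  then have "i < ?l" using wp by (auto simp: permutes_def)
  then have dd: "0 < (\<Sum>i<?l. (d i)\<^sup>2)"
    by (intro sum_pos2[of _ i]) (use i in \<open>auto simp: d_def\<close>)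
  have "(\<Sum>i<?l. (jt_index \<mu> w i)\<^sup>2) = (\<Sum>i<?l. (jt_index \<mu> id i)\<^sup>2 + 2 * (a i * d i) + (d i)\<^sup>2)"
    by (rule sum.cong) (auto simp: jt_index_def a_def d_def power2_eq_square algebra_simps)
  also have "\<dots> = (\<Sum>i<?l. (jt_index \<mu> id i)\<^sup>2) + 2 * (\<Sum>i<?l. a i * d i) + (\<Sum>i<?l. (d i)\<^sup>2)"
    by (simp add: sum.distrib sum_distrib_left)
  finally have "int (sum_squares (jt_content \<mu> id)) < int (sum_squares (jt_content \<mu> w))"
    using ad dd by (simp add: sq w(1) id_jt_perms)
  then show ?thesis by simp
qed

text \<open>Among the contents of fixed size in the support of \<open>g\<close>, choose one with the largest sum of squares:
  after sorting, only the identity contributes to the corresponding Schur coordinate.\<close>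

lemma schur_coord_separates:
  assumes g: "g \<in> sym_functions" and zero: "\<And>\<mu> n. \<mu> \<turnstile> n \<Longrightarrow> schur_coord \<mu> g = 0"
  shows "g = 0"
proof (rule series_eqI, rule ccontr)
  fix M assume "coeff_of g M \<noteq> coeff_of 0 M"
  then have M: "coeff_of g M \<noteq> 0" by (simp add: coeff_of_simps)
  let ?P = "\<lambda>N. coeff_of g N \<noteq> 0 \<and> size N = size M"
  have "\<forall>N. ?P N \<longrightarrow> sum_squares N < Suc ((size M)\<^sup>2)"
    using sum_squares_le by (metis le_imp_less_Suc)
  then obtain N where N: "?P N" and max: "\<And>N'. ?P N' \<Longrightarrow> sum_squares N' \<le> sum_squares N"
    using ex_has_greatest_nat[of ?P M sum_squares "Suc ((size M)\<^sup>2)"] M by auto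
  obtain lam p where lam: "lam \<turnstile> size N" and p: "bij p" "image_mset p N = jt_content lam id"
    by (rule relabel_to_partition)
  have s: "sorted_wrt (\<ge>) lam" "sum_list lam = size N" using lam by (auto simp: partition_of_def)
  have id: "coeff_of g (jt_content lam id) \<noteq> 0" "sum_squares (jt_content lam id) = sum_squares N"
    using sym_coeff[OF g p(1), of N] sum_squares_relabel[OF p(1), of N] p(2) N by simp_all
  have "schur_coord lam g = (\<Sum>w\<in>{id}. of_int (sign w) * coeff_of g (jt_content lam w))"
    unfolding schur_coord_def
  proof (rule sum.mono_neutral_right)
    show "\<forall>w\<in>jt_perms lam - {id}. of_int (sign w) * coeff_of g (jt_content lam w) = 0"
    proof
      fix w assume "w \<in> jt_perms lam - {id}"
      then have "sum_squares N < sum_squares (jt_content lam w)" "size (jt_content lam w) = size M"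
        using sum_squares_jt_content[OF s(1)] id(2) size_jt_content s(2) N by auto
      then show "of_int (sign w) * coeff_of g (jt_content lam w) = 0"
        using max[of "jt_content lam w"] by auto
    qed
  qed (auto simp: finite_jt_perms id_jt_perms)
  then show False using zero[OF lam] id(1) by simp
qed

section \<open>The Schur basis and the scalar product\<close>

definition partitions :: "nat list set" where
  "partitions = {\<mu>. \<exists>n. \<mu> \<turnstile> n}"

definition partitions_upto :: "nat \<Rightarrow> nat list set" where
  "partitions_upto d = {\<mu>. \<exists>n\<le>d. \<mu> \<turnstile> n}"

lemma partition_sum_list: "\<mu> \<in> partitions \<Longrightarrow> \<mu> \<turnstile> sum_list \<mu>"
  by (auto simp: partitions_def partition_of_def)

lemma finite_partitions_upto: "finite (partitions_upto d)"
proof -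
  have "partitions_upto d = (\<Union>n\<le>d. {\<mu>. \<mu> \<turnstile> n})" by (auto simp: partitions_upto_def)
  then show ?thesis by (simp add: finite_partitions)
qed

lemma partitions_upto_iff: "\<mu> \<in> partitions_upto d \<longleftrightarrow> \<mu> \<in> partitions \<and> sum_list \<mu> \<le> d"
  by (auto simp: partitions_upto_def partitions_def partition_of_def)

lemma schur_coord_schur':
  "\<mu> \<in> partitions \<Longrightarrow> lam \<in> partitions \<Longrightarrow> schur_coord \<mu> (schur lam) = (if \<mu> = lam then 1 else 0)"
  using schur_coord_schur by (auto simp: partitions_def)

text \<open>Symmetry is invisible in the definition by tableaux; it is inherited from the entries of
  the Jacobi--Trudi determinant.\<close>

lemma schur_sym: "\<mu> \<in> partitions \<Longrightarrow> schur \<mu> \<in> sym_functions"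
  by (subst jacobi_trudi_hm)
     (auto simp: partitions_def partition_of_def intro!: sym_sum sym_scale hm_sym)

definition degree_le :: "series \<Rightarrow> nat \<Rightarrow> bool" where
  "degree_le g d \<longleftrightarrow> (\<forall>M. coeff_of g M \<noteq> 0 \<longrightarrow> size M \<le> d)"

lemma sym_degree_le: "g \<in> sym_functions \<Longrightarrow> \<exists>d. degree_le g d"
  by (auto simp: sym_functions_def degree_le_def)

lemma degree_le_mono: "degree_le g d \<Longrightarrow> d \<le> d' \<Longrightarrow> degree_le g d'"
  by (auto simp: degree_le_def intro: le_trans)

lemma schur_coord_degree:
  assumes "degree_le g d" "schur_coord \<mu> g \<noteq> 0"
  shows "sum_list \<mu> \<le> d"
proof -
  obtain w where "w \<in> jt_perms \<mu>" "coeff_of g (jt_content \<mu> w) \<noteq> 0"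
    using assms(2) unfolding schur_coord_def by (metis (no_types, lifting) mult_zero_right sum.neutral)
  then show ?thesis using assms(1) size_jt_content by (metis degree_le_def)
qed

text \<open>The difference of the two sides is symmetric and all its coordinates vanish.\<close>

lemma schur_expansion:
  assumes g: "g \<in> sym_functions" and d: "degree_le g d"
  shows "g = (\<Sum>\<mu>\<in>partitions_upto d. schur_coord \<mu> g *\<^sub>s schur \<mu>)"
proof -
  let ?s = "\<Sum>\<mu>\<in>partitions_upto d. schur_coord \<mu> g *\<^sub>s schur \<mu>"
  have s: "?s \<in> sym_functions"
    by (intro sym_sum sym_scale schur_sym) (simp add: partitions_upto_iff)
  have "g + (- 1) *\<^sub>s ?s = 0"
  proof (rule schur_coord_separates)
    show "g + (- 1) *\<^sub>s ?s \<in> sym_functions" using g s by (intro sym_add sym_scale)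
    fix \<mu> n assume "\<mu> \<turnstile> n"
    then have mu: "\<mu> \<in> partitions" by (auto simp: partitions_def)
    have "schur_coord \<mu> ?s = (\<Sum>\<nu>\<in>partitions_upto d. if \<mu> = \<nu> then schur_coord \<nu> g else 0)"
      unfolding schur_coord_sum schur_coord_scale
      by (rule sum.cong) (auto simp: schur_coord_schur'[OF mu] partitions_upto_iff)
    also have "\<dots> = schur_coord \<mu> g"
      using schur_coord_degree[OF d, of \<mu>] mu
      by (auto simp: finite_partitions_upto partitions_upto_iff)
    finally show "schur_coord \<mu> (g + (- 1) *\<^sub>s ?s) = 0"
      unfolding schur_coord_add schur_coord_scale by simp
  qed
  then show ?thesis by (simp add: scale_minus_one)
qed

text \<open>Linear functionals dual to a family give its independence and its coordinates together.
  This is applied to the Schur functions and again to the irreducible characters.\<close>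

lemma (in vector_space) dual_family:
  assumes add: "\<And>i x y. i \<in> I \<Longrightarrow> coord i (x + y) = coord i x + coord i y"
    and scale: "\<And>i c x. i \<in> I \<Longrightarrow> coord i (scale c x) = c * coord i x"
    and dual: "\<And>i j. i \<in> I \<Longrightarrow> j \<in> I \<Longrightarrow> coord i (b j) = (if i = j then 1 else 0)"
  shows inj_on_dual_family: "inj_on b I"
    and independent_dual_family: "independent (b ` I)"
    and representation_dual_family:
      "i \<in> I \<Longrightarrow> v \<in> span (b ` I) \<Longrightarrow> representation (b ` I) v (b i) = coord i v"
proof -
  show inj: "inj_on b I"
  proof (rule inj_onI)
    fix i j assume "i \<in> I" "j \<in> I" "b i = b j"
    then show "i = j" using dual[of i i] dual[of i j] by (auto split: if_splits)
  qed
  have zero: "coord i 0 = 0" if "i \<in> I" for i using scale[OF that, of 0 0] by simp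
  have lin: "coord i (\<Sum>x\<in>S. scale (u x) x) = (\<Sum>x\<in>S. u x * coord i x)" if "i \<in> I" for i u S
    by (induction S rule: infinite_finite_induct) (auto simp: zero that add scale)
  have at: "coord i (\<Sum>x\<in>S. scale (u x) x) = (if b i \<in> S then u (b i) else 0)"
    if "finite S" and S: "S \<subseteq> b ` I" and "i \<in> I" for S u i
  proof -
    have "coord i (\<Sum>x\<in>S. scale (u x) x) = (\<Sum>x\<in>S. if x = b i then u x else 0)"
      unfolding lin[OF that(3)]
    proof (rule sum.cong)
      fix x assume "x \<in> S"
      then obtain j where "j \<in> I" "x = b j" using S by auto
      then show "u x * coord i x = (if x = b i then u x else 0)"
        using dual[OF that(3)] inj that(3) by (auto dest: inj_onD)
    qed simp
    then show ?thesis using that(1) by simp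
  qed
  show ind: "independent (b ` I)"
  proof (subst independent_explicit_module, intro allI impI)
    fix S u x
    assume S: "finite S" "S \<subseteq> b ` I" "(\<Sum>x\<in>S. scale (u x) x) = 0" "x \<in> S"
    then obtain i where "i \<in> I" "x = b i" by auto
    then show "u x = 0" using at[OF S(1,2), of i u] S(3,4) zero by simp
  qed
  show "representation (b ` I) v (b i) = coord i v" if "i \<in> I" "v \<in> span (b ` I)"
  proof -
    let ?r = "representation (b ` I) v"
    have "{x. ?r x \<noteq> 0} \<subseteq> b ` I" using representation_ne_zero[of "b ` I" v] by blast
    then have "coord i (\<Sum>x | ?r x \<noteq> 0. scale (?r x) x) = (if ?r (b i) \<noteq> 0 then ?r (b i) else 0)"
      using at[OF finite_representation _ that(1), of "b ` I" v ?r] by simp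
    then show ?thesis using sum_nonzero_representation_eq[OF ind that(2)] by simp
  qed
qed

lemma schur_family:
  shows inj_schur: "inj_on schur partitions"
    and representation_schur: "\<mu> \<in> partitions \<Longrightarrow> f \<in> series.span (schur ` partitions) \<Longrightarrow>
      series.representation (schur ` partitions) f (schur \<mu>) = schur_coord \<mu> f"
  using series.dual_family[of partitions schur_coord schur]
  by (auto simp: schur_coord_add schur_coord_scale schur_coord_schur')

lemma sym_in_span: "f \<in> sym_functions \<Longrightarrow> f \<in> series.span (schur ` partitions)"
proof -
  assume f: "f \<in> sym_functions"
  then obtain d where d: "degree_le f d" using sym_degree_le by blast
  show ?thesis
    by (subst schur_expansion[OF f d])
       (intro series.span_sum series.span_scale series.span_base, auto simp: partitions_upto_iff)
qed

text \<open>The definition sums over the support of the first argument only. A range depending just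
  on a degree bound makes symmetry and bilinearity visible.\<close>

lemma scalar_product_eq:
  assumes f: "f \<in> sym_functions" and g: "g \<in> sym_functions" and d: "degree_le f d"
  shows "scalar_product f g = (\<Sum>\<mu>\<in>partitions_upto d. schur_coord \<mu> f * schur_coord \<mu> g)"
proof -
  let ?R = "series.representation (schur ` partitions)"
  let ?S = "{\<mu> \<in> partitions. schur_coord \<mu> f \<noteq> 0}"
  have rep: "?R h (schur \<mu>) = schur_coord \<mu> h" if "\<mu> \<in> partitions" "h \<in> sym_functions" for \<mu> h
    using that sym_in_span by (intro representation_schur) auto
  have "{b. ?R f b \<noteq> 0} = schur ` ?S"
    using rep[OF _ f] series.representation_ne_zero[of "schur ` partitions" f] by fastforce
  then have "scalar_product f g = (\<Sum>b\<in>schur ` ?S. ?R f b * ?R g b)"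
    unfolding scalar_product_def partitions_def[symmetric] by (simp add: Let_def)
  also have "\<dots> = (\<Sum>\<mu>\<in>?S. ?R f (schur \<mu>) * ?R g (schur \<mu>))"
    by (subst sum.reindex) (auto intro: inj_on_subset[OF inj_schur])
  also have "\<dots> = (\<Sum>\<mu>\<in>?S. schur_coord \<mu> f * schur_coord \<mu> g)"
    by (rule sum.cong) (auto simp: rep f g)
  also have "\<dots> = (\<Sum>\<mu>\<in>partitions_upto d. schur_coord \<mu> f * schur_coord \<mu> g)"
    by (rule sum.mono_neutral_left)
       (use schur_coord_degree[OF d] in \<open>auto simp: finite_partitions_upto partitions_upto_iff\<close>)
  finally show ?thesis .
qed

lemma scalar_product_commute:
  assumes f: "f \<in> sym_functions" and g: "g \<in> sym_functions"
  shows "scalar_product f g = scalar_product g f"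
proof -
  obtain d d' where "degree_le f d" "degree_le g d'" using assms sym_degree_le by blast
  then have "degree_le f (max d d')" "degree_le g (max d d')" by (auto intro: degree_le_mono)
  then show ?thesis using assms by (simp add: scalar_product_eq mult.commute)
qed

lemma scalar_product_schur:
  assumes "\<mu> \<in> partitions" "f \<in> sym_functions"
  shows "scalar_product (schur \<mu>) f = schur_coord \<mu> f"
proof -
  obtain d where d: "degree_le (schur \<mu>) d" using assms schur_sym sym_degree_le by blast
  have "schur_coord \<mu> (schur \<mu>) \<noteq> 0" using assms by (simp add: schur_coord_schur')
  then have "sum_list \<mu> \<le> d" by (rule schur_coord_degree[OF d])
  then have mem: "\<mu> \<in> partitions_upto d" using assms by (simp add: partitions_upto_iff)
  have "scalar_product (schur \<mu>) f = (\<Sum>\<nu>\<in>partitions_upto d. if \<nu> = \<mu> then schur_coord \<nu> f else 0)"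
    unfolding scalar_product_eq[OF schur_sym[OF assms(1)] assms(2) d]
    by (rule sum.cong) (use assms in \<open>auto simp: schur_coord_schur' partitions_upto_iff\<close>)
  then show ?thesis using mem by (simp add: finite_partitions_upto)
qed

lemma scalar_product_sum_left:
  assumes "\<And>x. x \<in> A \<Longrightarrow> f x \<in> sym_functions" "g \<in> sym_functions"
  shows "scalar_product (\<Sum>x\<in>A. c x *\<^sub>s f x) g = (\<Sum>x\<in>A. c x * scalar_product (f x) g)"
proof -
  obtain d where d: "degree_le g d" using assms sym_degree_le by blast
  have s: "(\<Sum>x\<in>A. c x *\<^sub>s f x) \<in> sym_functions" using assms by (intro sym_sum sym_scale)
  have "scalar_product (\<Sum>x\<in>A. c x *\<^sub>s f x) g
      = (\<Sum>\<mu>\<in>partitions_upto d. \<Sum>x\<in>A. c x * (schur_coord \<mu> g * schur_coord \<mu> (f x)))"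
    by (simp add: scalar_product_commute[OF s assms(2)] scalar_product_eq[OF assms(2) s d]
        schur_coord_sum schur_coord_scale sum_distrib_left mult.left_commute)
  also have "\<dots> = (\<Sum>x\<in>A. c x * (\<Sum>\<mu>\<in>partitions_upto d. schur_coord \<mu> g * schur_coord \<mu> (f x)))"
    by (subst sum.swap) (simp add: sum_distrib_left)
  also have "\<dots> = (\<Sum>x\<in>A. c x * scalar_product (f x) g)"
    by (rule sum.cong) (auto simp: scalar_product_commute[OF assms] scalar_product_eq[OF assms(2) assms(1) d])
  finally show ?thesis .
qed

text \<open>Complete functions are dual to monomial functions. Through this a coefficient of a
  skewed function becomes a scalar product, to which the adjoint applies.\<close>

lemma scalar_product_hm:
  assumes g: "g \<in> sym_functions"
  shows "scalar_product (hm N) g = coeff_of g N"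
proof -
  obtain d where d: "degree_le g d" using assms sym_degree_le by blast
  have "scalar_product (hm N) g = (\<Sum>\<mu>\<in>partitions_upto d. schur_coord \<mu> g * schur_coord \<mu> (hm N))"
    by (simp add: scalar_product_commute[OF hm_sym g] scalar_product_eq[OF g hm_sym d])
  also have "\<dots> = coeff_of (\<Sum>\<mu>\<in>partitions_upto d. schur_coord \<mu> g *\<^sub>s schur \<mu>) N"
    unfolding coeff_of_sum
    by (rule sum.cong) (auto simp: coeff_of_simps schur_coord_hm partitions_upto_def partition_of_def)
  finally show ?thesis using schur_expansion[OF g d] by simp
qed

lemma scalar_product_separates:
  assumes "k \<in> sym_functions" "k' \<in> sym_functions"
    and "\<And>f. f \<in> sym_functions \<Longrightarrow> scalar_product f k = scalar_product f k'"
  shows "k = k'"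
proof -
  have "k + (- 1) *\<^sub>s k' = 0"
  proof (rule schur_coord_separates)
    show "k + (- 1) *\<^sub>s k' \<in> sym_functions" using assms by (intro sym_add sym_scale)
    fix \<mu> n assume "\<mu> \<turnstile> n"
    then have "\<mu> \<in> partitions" by (auto simp: partitions_def)
    then have "schur_coord \<mu> k = schur_coord \<mu> k'"
      using assms scalar_product_schur schur_sym by metis
    then show "schur_coord \<mu> (k + (- 1) *\<^sub>s k') = 0"
      unfolding schur_coord_add schur_coord_scale by simp
  qed
  then show ?thesis by (simp add: scale_minus_one)
qed

section \<open>The adjoint of multiplication by a Schur function\<close>

lemma degree_lower_bound_mult:
  assumes "\<And>M. coeff_of g M \<noteq> 0 \<Longrightarrow> m \<le> size M" "coeff_of (f * g) M \<noteq> 0"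
  shows "m \<le> size M"
proof -
  have "\<exists>q\<in>{(A, B). A + B = M}. (case q of (A, B) \<Rightarrow> coeff_of f A * coeff_of g B) \<noteq> 0"
    using assms(2) unfolding coeff_of_times by (meson sum.neutral)
  then obtain A B where "A + B = M" "coeff_of g B \<noteq> 0" by auto
  then show ?thesis using assms(1)[of B] by auto
qed

lemma schur_homogeneous:
  assumes "\<mu> \<in> partitions" "coeff_of (schur \<mu>) M \<noteq> 0"
  shows "size M = sum_list \<mu>"
proof -
  have s: "sorted_wrt (\<ge>) \<mu>" using assms(1) by (auto simp: partitions_def partition_of_def)
  obtain w where "w \<in> jt_perms \<mu>" "coeff_of (hm (jt_content \<mu> w)) M \<noteq> 0"
    using assms(2) unfolding jacobi_trudi_hm[OF s] coeff_of_sum coeff_of_simps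
    by (metis (no_types, lifting) mult_zero_right sum.neutral)
  then show ?thesis using coeff_hm_size size_jt_content by metis
qed

text \<open>The adjoint relation dictates the coordinate of the result at each \<nu>. Only finitely
  many are nonzero: every monomial of \<open>schur \<gamma> * schur \<nu>\<close> has degree at
  least that of \<nu>, while \<open>g\<close> has bounded degree. The resulting \<open>k\<close> is
  the only solution, which settles the definite description.\<close>

theorem schur_perp_adjoint:
  assumes \<gamma>: "\<gamma> \<in> partitions" and g: "g \<in> sym_functions"
  shows schur_perp_sym: "schur_perp \<gamma> g \<in> sym_functions"
    and scalar_product_schur_perp:
      "\<And>f. f \<in> sym_functions \<Longrightarrow> scalar_product (schur \<gamma> * f) g = scalar_product f (schur_perp \<gamma> g)"
proof -
  obtain d where d: "degree_le g d" using g sym_degree_le by blast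
  define k where "k = (\<Sum>\<nu>\<in>partitions_upto d. scalar_product (schur \<gamma> * schur \<nu>) g *\<^sub>s schur \<nu>)"
  have part: "\<nu> \<in> partitions" if "\<nu> \<in> partitions_upto d" for \<nu> using that by (simp add: partitions_upto_iff)
  have k: "k \<in> sym_functions"
    unfolding k_def by (intro sym_sum sym_scale schur_sym part)
  have vanish: "scalar_product (schur \<gamma> * schur \<nu>) g = 0" if \<nu>: "\<nu> \<in> partitions" "d < sum_list \<nu>" for \<nu>
  proof -
    have s: "schur \<gamma> * schur \<nu> \<in> sym_functions" using \<gamma> \<nu> by (intro sym_mult schur_sym)
    have "schur_coord \<mu> (schur \<gamma> * schur \<nu>) = 0" if "\<mu> \<in> partitions_upto d" for \<mu>
    proof (rule ccontr)
      assume "schur_coord \<mu> (schur \<gamma> * schur \<nu>) \<noteq> 0"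
      then obtain w where w: "w \<in> jt_perms \<mu>" "coeff_of (schur \<gamma> * schur \<nu>) (jt_content \<mu> w) \<noteq> 0"
        unfolding schur_coord_def by (metis (no_types, lifting) mult_zero_right sum.neutral)
      have "sum_list \<nu> \<le> size (jt_content \<mu> w)"
        using w(2) by (rule degree_lower_bound_mult[rotated]) (simp add: schur_homogeneous[OF \<nu>(1)])
      then show False using size_jt_content[OF w(1)] that \<nu>(2) by (simp add: partitions_upto_iff)
    qed
    then show ?thesis
      by (simp add: scalar_product_commute[OF s g] scalar_product_eq[OF g s d])
  qed
  have adj: "scalar_product (schur \<gamma> * f) g = scalar_product f k" if f: "f \<in> sym_functions" for f
  proof -
    obtain e where e: "degree_le f e" using f sym_degree_le by blast
    then have e': "degree_le f (max d e)" by (auto intro: degree_le_mono)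
    have "schur \<gamma> * f = (\<Sum>\<nu>\<in>partitions_upto (max d e). schur_coord \<nu> f *\<^sub>s (schur \<gamma> * schur \<nu>))"
      by (subst schur_expansion[OF f e']) (simp add: sum_distrib_left scale_mult_right)
    then have "scalar_product (schur \<gamma> * f) g
        = (\<Sum>\<nu>\<in>partitions_upto (max d e). schur_coord \<nu> f * scalar_product (schur \<gamma> * schur \<nu>) g)"
      using \<gamma> g by (simp only:, subst scalar_product_sum_left)
        (auto intro!: sym_mult schur_sym simp: partitions_upto_iff)
    also have "\<dots> = (\<Sum>\<nu>\<in>partitions_upto d. scalar_product (schur \<gamma> * schur \<nu>) g * schur_coord \<nu> f)"
      by (rule sum.mono_neutral_cong_right)
         (auto simp: finite_partitions_upto partitions_upto_iff intro: vanish)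
    also have "\<dots> = scalar_product k f"
      unfolding k_def using f
      by (subst scalar_product_sum_left) (auto simp: schur_sym part scalar_product_schur)
    finally show ?thesis using scalar_product_commute[OF k f] by simp
  qed
  have "schur_perp \<gamma> g = k"
    unfolding schur_perp_def
    by (rule the_equality) (use k adj in \<open>auto intro!: scalar_product_separates\<close>)
  then show "schur_perp \<gamma> g \<in> sym_functions"
    "\<And>f. f \<in> sym_functions \<Longrightarrow> scalar_product (schur \<gamma> * f) g = scalar_product f (schur_perp \<gamma> g)"
    using k adj by auto
qed

lemma foldr_schur_perp:
  assumes "set \<nu>s \<subseteq> partitions" "g \<in> sym_functions"
  shows foldr_schur_perp_sym: "foldr schur_perp \<nu>s g \<in> sym_functions"
    and scalar_product_foldr_schur_perp: "\<And>f. f \<in> sym_functions \<Longrightarrow>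
      scalar_product f (foldr schur_perp \<nu>s g) = scalar_product (prod_list (map schur \<nu>s) * f) g"
proof -
  have "foldr schur_perp \<nu>s g \<in> sym_functions \<and> (\<forall>f\<in>sym_functions.
      scalar_product f (foldr schur_perp \<nu>s g) = scalar_product (prod_list (map schur \<nu>s) * f) g)"
    using assms(1)
  proof (induction \<nu>s)
    case (Cons \<nu> \<nu>s)
    then have IH: "foldr schur_perp \<nu>s g \<in> sym_functions" "\<nu> \<in> partitions"
      "\<And>f. f \<in> sym_functions \<Longrightarrow>
        scalar_product f (foldr schur_perp \<nu>s g) = scalar_product (prod_list (map schur \<nu>s) * f) g"
      by auto
    have "scalar_product f (schur_perp \<nu> (foldr schur_perp \<nu>s g))
        = scalar_product (prod_list (map schur \<nu>s) * (schur \<nu> * f)) g" if "f \<in> sym_functions" for f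
      using that IH by (simp add: scalar_product_schur_perp[symmetric] sym_mult schur_sym)
    then show ?case using IH by (auto simp: schur_perp_sym mult.assoc mult.left_commute)
  qed (simp add: assms(2))
  then show "foldr schur_perp \<nu>s g \<in> sym_functions"
    "\<And>f. f \<in> sym_functions \<Longrightarrow>
      scalar_product f (foldr schur_perp \<nu>s g) = scalar_product (prod_list (map schur \<nu>s) * f) g"
    by auto
qed

section \<open>The operators of monomials\<close>

definition homogeneous :: "series \<Rightarrow> nat \<Rightarrow> bool" where
  "homogeneous g d \<longleftrightarrow> (\<forall>M. coeff_of g M \<noteq> 0 \<longrightarrow> size M = d)"

lemma homogeneous_mult:
  assumes "homogeneous f a" "homogeneous g b"
  shows "homogeneous (f * g) (a + b)"
  unfolding homogeneous_def
proof (intro allI impI)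
  fix M assume "coeff_of (f * g) M \<noteq> 0"
  then have "\<exists>q\<in>{(A, B). A + B = M}. (case q of (A, B) \<Rightarrow> coeff_of f A * coeff_of g B) \<noteq> 0"
    unfolding coeff_of_times by (meson sum.neutral)
  then obtain A B where "A + B = M" "coeff_of f A \<noteq> 0" "coeff_of g B \<noteq> 0" by auto
  then show "size M = a + b" using assms by (auto simp: homogeneous_def)
qed

lemma homogeneous_sum: "(\<And>x. x \<in> A \<Longrightarrow> homogeneous (f x) d) \<Longrightarrow> homogeneous (sum f A) d"
  unfolding homogeneous_def coeff_of_sum by (metis (no_types, lifting) sum.neutral)

lemma homogeneous_hm: "homogeneous (hm N) (size N)"
  by (auto simp: homogeneous_def dest: coeff_hm_size)

lemma schur_coord_homogeneous:
  assumes "homogeneous g d" "schur_coord \<mu> g \<noteq> 0"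
  shows "sum_list \<mu> = d"
proof -
  obtain w where "w \<in> jt_perms \<mu>" "coeff_of g (jt_content \<mu> w) \<noteq> 0"
    using assms(2) unfolding schur_coord_def by (metis (no_types, lifting) mult_zero_right sum.neutral)
  then show ?thesis using assms(1) size_jt_content by (metis homogeneous_def)
qed

text \<open>The coefficient at \<open>M\<close>, in the second set of variables, of a product of
  graded Cauchy kernels, one per list entry. The recursion on the list fits the operators;
  \<open>row_sum_matrices\<close> passes to matrices.\<close>

fun row_sum :: "nat list \<Rightarrow> nat multiset \<Rightarrow> series" where
  "row_sum [] M = (if M = {#} then 1 else 0)"
| "row_sum (a # \<alpha>) M = (\<Sum>(A, B) | A + B = M \<and> size A = a. hm A * row_sum \<alpha> B)"

lemma row_sum_size: "row_sum \<alpha> M \<noteq> 0 \<Longrightarrow> size M = sum_list \<alpha>"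
proof (induction \<alpha> arbitrary: M)
  case (Cons a \<alpha>)
  then have "\<exists>q\<in>{(A, B). A + B = M \<and> size A = a}. (case q of (A, B) \<Rightarrow> hm A * row_sum \<alpha> B) \<noteq> 0"
    by (metis (no_types, lifting) row_sum.simps(2) sum.neutral)
  then obtain A B where "A + B = M" "size A = a" "row_sum \<alpha> B \<noteq> 0" by fastforce
  then show ?case using Cons.IH by auto
qed (auto split: if_splits)

lemma homogeneous_row_sum: "homogeneous (row_sum \<alpha> M) (size M)"
proof (induction \<alpha> arbitrary: M)
  case (Cons a \<alpha>)
  have "homogeneous (hm A * row_sum \<alpha> B) (size M)" if "A + B = M" for A B
    using homogeneous_mult[OF homogeneous_hm Cons.IH, of A B] that by auto
  then show ?case by (auto intro!: homogeneous_sum)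
qed (auto simp: homogeneous_def coeff_of_one coeff_of_simps)

lemma row_sum_sym: "row_sum \<alpha> M \<in> sym_functions"
  by (induction \<alpha> arbitrary: M)
     (auto simp: sym_one sym_zero intro!: sym_sum sym_mult hm_sym)

text \<open>This is the Schur expansion of \<open>hm A\<close>, whose coordinates are
  \<open>coeff_of (schur \<nu>) A\<close> by \<open>schur_coord_hm\<close>; by homogeneity only
  partitions of the size of \<open>A\<close> occur.\<close>

lemma sum_schur_coeff:
  "(\<Sum>\<nu> | \<nu> \<turnstile> a. coeff_of (schur \<nu>) A *\<^sub>s schur \<nu>) = (if size A = a then hm A else 0)"
proof -
  have part: "\<nu> \<in> partitions" if "\<nu> \<turnstile> a" for \<nu> a using that by (auto simp: partitions_def)
  have deg: "degree_le (hm A) (size A)"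
    by (auto simp: degree_le_def dest: coeff_hm_size)
  have zero: "coeff_of (schur \<nu>) A = 0" if "\<nu> \<in> partitions" "sum_list \<nu> \<noteq> size A" for \<nu>
    using schur_homogeneous[OF that(1), of A] that(2) by auto
  show ?thesis
  proof (cases "size A = a")
    case True
    have "hm A = (\<Sum>\<nu>\<in>partitions_upto a. schur_coord \<nu> (hm A) *\<^sub>s schur \<nu>)"
      using True by (intro schur_expansion hm_sym) (auto intro: degree_le_mono[OF deg])
    also have "\<dots> = (\<Sum>\<nu>\<in>partitions_upto a. coeff_of (schur \<nu>) A *\<^sub>s schur \<nu>)"
      by (rule sum.cong) (auto simp: schur_coord_hm partitions_upto_def partition_of_def)
    also have "\<dots> = (\<Sum>\<nu> | \<nu> \<turnstile> a. coeff_of (schur \<nu>) A *\<^sub>s schur \<nu>)"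
    proof (rule sum.mono_neutral_right)
      show "\<forall>\<nu>\<in>partitions_upto a - {\<nu>. \<nu> \<turnstile> a}. coeff_of (schur \<nu>) A *\<^sub>s schur \<nu> = 0"
        using zero True by (metis (no_types, lifting) DiffE mem_Collect_eq partition_sum_list
            partitions_upto_iff series.scale_zero_left)
    qed (simp add: finite_partitions_upto, auto simp: partitions_upto_def)
    finally show ?thesis using True by simp
  next
    case False
    then show ?thesis using zero part
      by (auto intro!: sum.neutral simp: partition_of_def)
  qed
qed

lemma sum_partition_lists_Cons:
  "(\<Sum>\<nu>s | list_all2 (\<turnstile>) \<nu>s (a # \<alpha>). F \<nu>s) = (\<Sum>\<nu> | \<nu> \<turnstile> a. \<Sum>\<nu>s | list_all2 (\<turnstile>) \<nu>s \<alpha>. F (\<nu> # \<nu>s))"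
proof -
  have "(\<Sum>\<nu>s | list_all2 (\<turnstile>) \<nu>s (a # \<alpha>). F \<nu>s)
      = (\<Sum>(\<nu>, \<nu>s)\<in>{\<nu>. \<nu> \<turnstile> a} \<times> {\<nu>s. list_all2 (\<turnstile>) \<nu>s \<alpha>}. F (\<nu> # \<nu>s))"
    by (rule sum.reindex_bij_witness[where i = "\<lambda>(\<nu>, \<nu>s). \<nu> # \<nu>s" and j = "\<lambda>\<nu>s. (hd \<nu>s, tl \<nu>s)"])
       (auto simp: list_all2_Cons2)
  then show ?thesis by (simp add: sum.cartesian_product)
qed

text \<open>A graded piece of the Cauchy kernel, expanded in Schur functions and in monomials.\<close>

lemma schur_kernel:
  "(\<Sum>\<nu>s | list_all2 (\<turnstile>) \<nu>s \<alpha>. coeff_of (prod_list (map schur \<nu>s)) M *\<^sub>s prod_list (map schur \<nu>s))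
    = row_sum \<alpha> M"
proof (induction \<alpha> arbitrary: M)
  case Nil
  then show ?case by (simp add: coeff_of_one)
next
  case (Cons a \<alpha>)
  let ?L = "{\<nu>s. list_all2 (\<turnstile>) \<nu>s \<alpha>}" and ?S = "{(A, B). A + B = M}"
  let ?p = "\<lambda>\<nu>s. prod_list (map schur \<nu>s)"
  have "(\<Sum>\<nu>s | list_all2 (\<turnstile>) \<nu>s (a # \<alpha>). coeff_of (?p \<nu>s) M *\<^sub>s ?p \<nu>s)
      = (\<Sum>\<nu> | \<nu> \<turnstile> a. \<Sum>\<nu>s\<in>?L. \<Sum>q\<in>?S. (coeff_of (schur \<nu>) (fst q) *\<^sub>s schur \<nu>) * (coeff_of (?p \<nu>s) (snd q) *\<^sub>s ?p \<nu>s))"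
    unfolding sum_partition_lists_Cons
    by (intro sum.cong refl)
       (auto simp: coeff_of_times case_prod_unfold series.scale_sum_left scale_mult_left scale_mult_right mult.commute)
  also have "\<dots> = (\<Sum>\<nu> | \<nu> \<turnstile> a. \<Sum>q\<in>?S. \<Sum>\<nu>s\<in>?L. (coeff_of (schur \<nu>) (fst q) *\<^sub>s schur \<nu>) * (coeff_of (?p \<nu>s) (snd q) *\<^sub>s ?p \<nu>s))"
    by (intro sum.cong refl sum.swap)
  also have "\<dots> = (\<Sum>q\<in>?S. \<Sum>\<nu> | \<nu> \<turnstile> a. \<Sum>\<nu>s\<in>?L. (coeff_of (schur \<nu>) (fst q) *\<^sub>s schur \<nu>) * (coeff_of (?p \<nu>s) (snd q) *\<^sub>s ?p \<nu>s))"
    by (rule sum.swap)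
  also have "\<dots> = (\<Sum>q\<in>?S. (\<Sum>\<nu> | \<nu> \<turnstile> a. coeff_of (schur \<nu>) (fst q) *\<^sub>s schur \<nu>) *
      (\<Sum>\<nu>s\<in>?L. coeff_of (?p \<nu>s) (snd q) *\<^sub>s ?p \<nu>s))"
    by (simp only: sum_product)
  also have "\<dots> = (\<Sum>(A, B)\<in>?S. (if size A = a then hm A else 0) * row_sum \<alpha> B)"
    by (simp add: sum_schur_coeff Cons.IH case_prod_unfold)
  also have "\<dots> = row_sum (a # \<alpha>) M"
    unfolding row_sum.simps
    by (rule sum.mono_neutral_cong_right) (auto simp: finite_mset_splittings split: if_splits)
  finally show ?case .
qed

text \<open>Content \<open>A\<close> comes from the multiplication and \<open>B\<close> from the
  skewed function. The coefficient at \<open>B\<close> is a scalar product with \<open>hm B\<close>;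
  the adjoint carries the Schur functions to the other side, where their sum with weights at
  \<open>A\<close> is \<open>schur_kernel\<close>.\<close>

lemma coeff_h_monomial_op:
  assumes f: "f \<in> sym_functions"
  shows "coeff_of (h_monomial_op \<alpha> f) M = (\<Sum>(A, B) | A + B = M. scalar_product (row_sum \<alpha> A * hm B) f)"
proof -
  let ?L = "{\<nu>s. list_all2 (\<turnstile>) \<nu>s \<alpha>}" and ?p = "\<lambda>\<nu>s. prod_list (map schur \<nu>s)"
  have part: "set \<nu>s \<subseteq> partitions" if "\<nu>s \<in> ?L" for \<nu>s
    using that unfolding partitions_def by (auto simp: list_all2_conv_all_nth in_set_conv_nth) blast
  have psym: "?p \<nu>s \<in> sym_functions" if "\<nu>s \<in> ?L" for \<nu>s
    using part[OF that] by (intro sym_prod_list) (auto intro: schur_sym)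
  have perp: "coeff_of (foldr schur_perp \<nu>s f) B = scalar_product (?p \<nu>s * hm B) f" if "\<nu>s \<in> ?L" for \<nu>s B
    using scalar_product_hm[OF foldr_schur_perp_sym[OF part[OF that] f]]
      scalar_product_foldr_schur_perp[OF part[OF that] f hm_sym] by metis
  have "coeff_of (h_monomial_op \<alpha> f) M
      = (\<Sum>\<nu>s\<in>?L. \<Sum>(A, B) | A + B = M. coeff_of (?p \<nu>s) A * scalar_product (?p \<nu>s * hm B) f)"
    unfolding h_monomial_op_def coeff_of_sum coeff_of_times
    by (intro sum.cong refl) (auto simp: perp)
  also have "\<dots> = (\<Sum>(A, B) | A + B = M. \<Sum>\<nu>s\<in>?L. coeff_of (?p \<nu>s) A * scalar_product (?p \<nu>s * hm B) f)"
    unfolding case_prod_unfold by (rule sum.swap)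
  also have "\<dots> = (\<Sum>(A, B) | A + B = M. scalar_product (\<Sum>\<nu>s\<in>?L. coeff_of (?p \<nu>s) A *\<^sub>s (?p \<nu>s * hm B)) f)"
    unfolding case_prod_unfold
    by (intro sum.cong refl scalar_product_sum_left[symmetric] sym_mult psym hm_sym f)
  also have "\<dots> = (\<Sum>(A, B) | A + B = M. scalar_product (row_sum \<alpha> A * hm B) f)"
    by (simp add: schur_kernel[symmetric] sum_distrib_right scale_mult_left)
  finally show ?thesis .
qed

text \<open>Homogeneity fixes both sizes: that of \<open>A\<close> is the sum of \<alpha>, and the
  two together make up \<open>n\<close>. So \<open>B\<close> behaves like one further row of a
  matrix, with sum \<open>n - sum_list \<alpha>\<close>.\<close>

lemma coeff_h_monomial_op_schur:
  assumes "\<mu> \<turnstile> n"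
  shows "coeff_of (h_monomial_op \<alpha> (schur \<mu>)) M =
    (\<Sum>(A, B) | A + B = M \<and> size B + sum_list \<alpha> = n. schur_coord \<mu> (row_sum \<alpha> A * hm B))"
proof -
  have mu: "\<mu> \<in> partitions" "sum_list \<mu> = n" using assms by (auto simp: partitions_def partition_of_def)
  have sp: "scalar_product (row_sum \<alpha> A * hm B) (schur \<mu>) = schur_coord \<mu> (row_sum \<alpha> A * hm B)" for A B
    using scalar_product_commute[OF _ schur_sym[OF mu(1)]] scalar_product_schur[OF mu(1)]
    by (simp add: sym_mult row_sum_sym hm_sym)
  have "size B + sum_list \<alpha> = n" if nz: "schur_coord \<mu> (row_sum \<alpha> A * hm B) \<noteq> 0" for A B
  proof -
    have "sum_list \<mu> = size A + size B"
      using schur_coord_homogeneous[OF homogeneous_mult[OF homogeneous_row_sum homogeneous_hm] nz] .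
    moreover have "row_sum \<alpha> A \<noteq> 0" using nz by (auto simp: schur_coord_zero)
    ultimately show ?thesis using row_sum_size mu(2) by fastforce
  qed
  then show ?thesis
    unfolding coeff_h_monomial_op[OF schur_sym[OF mu(1)]] sp
    by (intro sum.mono_neutral_right) (auto simp: finite_mset_splittings)
qed

text \<open>Pairing the letters with the row index makes different rows disjoint, so the product of
  the \<open>hm\<close> of the rows is \<open>hm\<close> of the matrix.\<close>

lemma row_sum_matrices:
  "distinct xs \<Longrightarrow> row_sum (map c xs) M = (\<Sum>P\<in>matrices c (set xs) M. hm P)"
proof (induction xs arbitrary: M)
  case Nil
  then show ?case by (simp add: sum_matrices_empty hm_empty)
next
  case (Cons i xs)
  have hm: "hm (image_mset (Pair i) A + Q) = hm A * hm Q" if "Q \<in> matrices c (set xs) B" for A B Q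
  proof -
    have "set_mset (image_mset (Pair i) A) \<inter> set_mset Q = {}"
      using that Cons.prems by (auto simp: matrices_def)
    then show ?thesis by (simp add: hm_add_disjoint hm_image_inj inj_on_def)
  qed
  have "(\<Sum>P\<in>matrices c (set (i # xs)) M. hm P)
      = (\<Sum>(A, B) | A + B = M \<and> size A = c i. \<Sum>Q\<in>matrices c (set xs) B. hm A * hm Q)"
    using Cons.prems by (auto simp: sum_matrices_insert hm intro!: sum.cong)
  then show ?case using Cons by (simp add: sum_distrib_left)
qed

section \<open>Permutation characters of Young subgroups\<close>

abbreviation perms :: "nat \<Rightarrow> (nat \<Rightarrow> nat) set" where
  "perms n \<equiv> {p. p permutes {..<n}}"

definition words :: "nat \<Rightarrow> 'a multiset \<Rightarrow> (nat \<Rightarrow> 'a) set" where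
  "words n N = {w \<in> {..<n} \<rightarrow>\<^sub>E UNIV. image_mset w (mset_set {..<n}) = N}"

text \<open>A Young subgroup. A permutation fixes the word \<open>w\<close> exactly if it lies here,
  so \<open>eta\<close> counts fixed points of the action on words.\<close>

definition stab :: "nat \<Rightarrow> (nat \<Rightarrow> 'a) \<Rightarrow> (nat \<Rightarrow> nat) set" where
  "stab n w = {p. p permutes {..<n} \<and> (\<forall>x<n. w (p x) = w x)}"

definition eta :: "nat \<Rightarrow> 'a multiset \<Rightarrow> (nat \<Rightarrow> nat) \<Rightarrow> rat" where
  "eta n N p = of_nat (card {w \<in> words n N. p \<in> stab n w})"

definition class_ip :: "nat \<Rightarrow> ((nat \<Rightarrow> nat) \<Rightarrow> rat) \<Rightarrow> ((nat \<Rightarrow> nat) \<Rightarrow> rat) \<Rightarrow> rat" where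
  "class_ip n f g = (\<Sum>p\<in>perms n. f p * g p) / fact n"

lemma finite_perms: "finite (perms n)"
  by (simp add: finite_permutations)

lemma finite_words: "finite (words n N)"
proof (rule finite_subset)
  show "words n N \<subseteq> {..<n} \<rightarrow>\<^sub>E set_mset N"
    by (auto simp: words_def PiE_def extensional_def Pi_def)
qed (auto intro: finite_PiE)

lemma stab_subset: "stab n w \<subseteq> perms n"
  by (auto simp: stab_def)

lemma finite_stab: "finite (stab n w)"
  using finite_subset[OF stab_subset finite_perms] .

lemma id_stab: "id \<in> stab n w"
  by (simp add: stab_def permutes_id)

lemma card_stab_pos: "card (stab n w) > 0"
  using finite_stab id_stab card_gt_0_iff by blast

lemma size_word: "w \<in> words n N \<Longrightarrow> size N = n"
  unfolding words_def using size_image_mset[of w "mset_set {..<n}"] by simp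

lemma words_nonempty:
  assumes "size N = n"
  shows "words n N \<noteq> {}"
proof -
  obtain xs where xs: "mset xs = N" using ex_mset by blast
  then have len: "length xs = n" using assms by auto
  have "image_mset (restrict (nth xs) {..<n}) (mset_set {..<n}) = image_mset (nth xs) (mset_set {..<n})"
    by (rule image_mset_cong) auto
  also have "\<dots> = mset (map (nth xs) [0..<n])"
    by (simp add: atLeast0LessThan[symmetric] mset_upt del: map_nth)
  also have "\<dots> = N" using xs len map_nth[of xs] by simp
  finally have "restrict (nth xs) {..<n} \<in> words n N" by (simp add: words_def)
  then show ?thesis by blast
qed

lemma words_permute:
  assumes "w0 \<in> words n N" "p permutes {..<n}"
  shows "restrict (w0 \<circ> p) {..<n} \<in> words n N"
proof -
  have "image_mset (restrict (w0 \<circ> p) {..<n}) (mset_set {..<n}) = image_mset (w0 \<circ> p) (mset_set {..<n})"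
    by (rule image_mset_cong) auto
  also have "\<dots> = image_mset w0 (image_mset p (mset_set {..<n}))" by (simp add: multiset.map_comp)
  also have "image_mset p (mset_set {..<n}) = mset_set {..<n}"
    using assms(2) by (simp add: image_mset_mset_set permutes_inj_on permutes_image)
  also have "image_mset w0 (mset_set {..<n}) = N" using assms(1) by (simp add: words_def)
  finally have "image_mset (restrict (w0 \<circ> p) {..<n}) (mset_set {..<n}) = N" .
  moreover have "restrict (w0 \<circ> p) {..<n} \<in> {..<n} \<rightarrow>\<^sub>E UNIV" by simp
  ultimately show ?thesis unfolding words_def by blast
qed

lemma words_transitive:
  assumes "w0 \<in> words n N" "w \<in> words n N"
  obtains p where "p permutes {..<n}" "restrict (w0 \<circ> p) {..<n} = w"
proof -
  have "image_mset w (mset_set {..<n}) = image_mset w0 (mset_set {..<n})"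
    using assms by (simp add: words_def)
  then obtain p where "p permutes {..<n}" "\<forall>x\<in>{..<n}. w x = w0 (p x)"
    by (rule image_mset_eq_implies_permutes[OF finite_lessThan])
  moreover from this have "restrict (w0 \<circ> p) {..<n} = w"
    using assms(2) by (auto simp: words_def fun_eq_iff PiE_def extensional_def)
  ultimately show ?thesis using that by blast
qed

text \<open>The permutations that carry \<open>w0\<close> to \<open>w\<close> form a coset of the
  stabilizer of \<open>w0\<close>.\<close>

lemma card_word_fibre:
  assumes w0: "w0 \<in> words n N" and w: "w \<in> words n N"
  shows "card {p \<in> perms n. restrict (w0 \<circ> p) {..<n} = w} = card (stab n w0)"
proof -
  obtain t where t: "t permutes {..<n}" "restrict (w0 \<circ> t) {..<n} = w"
    using words_transitive[OF w0 w] .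
  have tw: "w x = w0 (t x)" if "x < n" for x using t(2) that by auto
  have tn: "t x < n \<longleftrightarrow> x < n" for x using permutes_in_image[OF t(1)] by simp
  let ?t' = "pinv t"
  have t': "?t' permutes {..<n}" using t(1) by (rule permutes_inv)
  have t'n: "?t' x < n \<longleftrightarrow> x < n" for x using permutes_in_image[OF t'] by simp
  have "bij_betw (\<lambda>s. s \<circ> t) (stab n w0) {p \<in> perms n. restrict (w0 \<circ> p) {..<n} = w}"
  proof (rule bij_betwI[where g = "\<lambda>p. p \<circ> ?t'"])
    show "(\<lambda>s. s \<circ> t) \<in> stab n w0 \<rightarrow> {p \<in> perms n. restrict (w0 \<circ> p) {..<n} = w}"
      using t(1) w by (auto simp: stab_def permutes_compose fun_eq_iff tw tn words_def PiE_def extensional_def)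
    show "(\<lambda>p. p \<circ> ?t') \<in> {p \<in> perms n. restrict (w0 \<circ> p) {..<n} = w} \<rightarrow> stab n w0"
    proof
      fix p assume "p \<in> {p \<in> perms n. restrict (w0 \<circ> p) {..<n} = w}"
      then have p: "p permutes {..<n}" and pw: "w0 (p x) = w x" if "x < n" for x
        using that by (auto dest: fun_cong[of _ _ x])
      have "w0 (p (?t' x)) = w0 x" if "x < n" for x
        using pw[of "?t' x"] tw[of "?t' x"] that t'n permutes_inverses(1)[OF t(1), of x] by simp
      then show "p \<circ> ?t' \<in> stab n w0"
        using \<open>p \<in> _\<close> t' by (auto simp: stab_def permutes_compose)
    qed
  qed (simp_all add: comp_assoc permutes_inv_o[OF t(1)])
  then show ?thesis by (simp add: bij_betw_same_card)
qed

lemma sum_over_words: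
  fixes F :: "(nat \<Rightarrow> 'a) \<Rightarrow> rat"
  assumes w0: "w0 \<in> words n N"
  shows "(\<Sum>p\<in>perms n. F (restrict (w0 \<circ> p) {..<n})) = of_nat (card (stab n w0)) * (\<Sum>w\<in>words n N. F w)"
proof -
  have "(\<Sum>p\<in>perms n. F (restrict (w0 \<circ> p) {..<n}))
      = (\<Sum>w\<in>words n N. \<Sum>p\<in>{p \<in> perms n. restrict (w0 \<circ> p) {..<n} = w}. F (restrict (w0 \<circ> p) {..<n}))"
    by (rule sum.group[symmetric]) (use w0 in \<open>auto simp: finite_words finite_perms words_permute\<close>)
  also have "\<dots> = (\<Sum>w\<in>words n N. of_nat (card (stab n w0)) * F w)"
    by (intro sum.cong refl) (simp add: card_word_fibre[OF w0, symmetric])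
  finally show ?thesis by (simp add: sum_distrib_left)
qed

lemma permutes_conj:
  assumes "p permutes A" "t permutes A"
  shows "t \<circ> p \<circ> pinv t permutes A"
  by (intro permutes_compose permutes_inv assms)

text \<open>The formula for an induced character, free of division: \<open>eta n N\<close> is
  induced from the trivial character of the Young subgroup.\<close>

lemma eta_conjugates:
  assumes w0: "w0 \<in> words n N" and p: "p permutes {..<n}"
  shows "of_nat (card (stab n w0)) * eta n N p
    = of_nat (card {t \<in> perms n. t \<circ> p \<circ> pinv t \<in> stab n w0})"
proof -
  have "of_nat (card (stab n w0)) * eta n N p
      = of_nat (card (stab n w0)) * (\<Sum>w\<in>words n N. if p \<in> stab n w then 1 else 0)"
    by (simp add: eta_def sum.If_cases finite_words Int_def)
  also have "\<dots> = (\<Sum>t\<in>perms n. if p \<in> stab n (restrict (w0 \<circ> t) {..<n}) then 1 else 0)"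
    by (rule sum_over_words[OF w0, symmetric])
  also have "\<dots> = (\<Sum>t\<in>perms n. if t \<circ> p \<circ> pinv t \<in> stab n w0 then 1 else 0)"
  proof (rule sum.cong)
    fix t assume "t \<in> perms n"
    then have t: "t permutes {..<n}" by simp
    have pn: "p x < n \<longleftrightarrow> x < n" for x using permutes_in_image[OF p] by simp
    have "(\<forall>x<n. w0 (t (p x)) = w0 (t x)) \<longleftrightarrow> (\<forall>x<n. w0 (t (p (pinv t x))) = w0 x)"
    proof (intro iffI allI impI)
      fix x assume *: "\<forall>x<n. w0 (t (p x)) = w0 (t x)" "x < n"
      have "pinv t x < n" using *(2) permutes_in_image[OF permutes_inv[OF t]] by simp
      then show "w0 (t (p (pinv t x))) = w0 x" using * permutes_inverses(1)[OF t] by simp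
    next
      fix x assume *: "\<forall>x<n. w0 (t (p (pinv t x))) = w0 x" "x < n"
      have "t x < n" using *(2) permutes_in_image[OF t] by simp
      then have "w0 (t (p (pinv t (t x)))) = w0 (t x)" using *(1) by blast
      then show "w0 (t (p x)) = w0 (t x)" using permutes_inverses(2)[OF t] by simp
    qed
    then show "(if p \<in> stab n (restrict (w0 \<circ> t) {..<n}) then 1 else 0 :: rat)
        = (if t \<circ> p \<circ> pinv t \<in> stab n w0 then 1 else 0)"
      using p pn permutes_conj[OF p t] by (simp add: stab_def)
  qed simp
  also have "\<dots> = of_nat (card {t \<in> perms n. t \<circ> p \<circ> pinv t \<in> stab n w0})"
    by (simp add: sum.If_cases finite_perms Int_def)
  finally show ?thesis .
qed

lemma sum_conj:
  fixes F :: "(nat \<Rightarrow> nat) \<Rightarrow> rat"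
  assumes t: "t permutes {..<n}"
  shows "(\<Sum>p\<in>perms n. F (t \<circ> p \<circ> pinv t)) = (\<Sum>p\<in>perms n. F p)"
proof -
  let ?t' = "pinv t"
  have t': "?t' permutes {..<n}" using t by (rule permutes_inv)
  have "t \<circ> ?t' = id" "?t' \<circ> t = id" using permutes_inv_o[OF t] by auto
  then have "t \<circ> (?t' \<circ> p \<circ> t) \<circ> ?t' = p" "?t' \<circ> (t \<circ> p \<circ> ?t') \<circ> t = p" for p
    by (metis comp_assoc comp_id id_comp)+
  then show ?thesis
    using t t' by (intro sum.reindex_bij_witness[where i = "\<lambda>p. ?t' \<circ> p \<circ> t" and j = "\<lambda>p. t \<circ> p \<circ> ?t'"])
      (auto intro: permutes_compose)
qed

text \<open>Frobenius reciprocity: pairing a class function with the induced character averages the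
  function over the Young subgroup.\<close>

lemma sum_class_eta:
  assumes w0: "w0 \<in> words n N"
    and cls: "\<And>p t. p permutes {..<n} \<Longrightarrow> t permutes {..<n} \<Longrightarrow> f (t \<circ> p \<circ> pinv t) = f p"
  shows "of_nat (card (stab n w0)) * (\<Sum>p\<in>perms n. f p * eta n N p) = fact n * (\<Sum>p\<in>stab n w0. f p)"
proof -
  have "of_nat (card (stab n w0)) * (\<Sum>p\<in>perms n. f p * eta n N p)
      = (\<Sum>p\<in>perms n. f p * of_nat (card {t \<in> perms n. t \<circ> p \<circ> pinv t \<in> stab n w0}))"
    using eta_conjugates[OF w0] by (simp add: sum_distrib_left mult.left_commute)
  also have "\<dots> = (\<Sum>p\<in>perms n. \<Sum>t\<in>perms n. if t \<circ> p \<circ> pinv t \<in> stab n w0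
      then f (t \<circ> p \<circ> pinv t) else 0)"
    by (intro sum.cong refl) (simp add: sum.If_cases finite_perms Int_def cls mult.commute)
  also have "\<dots> = (\<Sum>t\<in>perms n. \<Sum>p\<in>perms n. if t \<circ> p \<circ> pinv t \<in> stab n w0
      then f (t \<circ> p \<circ> pinv t) else 0)"
    by (rule sum.swap)
  also have "\<dots> = (\<Sum>t\<in>perms n. \<Sum>p\<in>perms n. if p \<in> stab n w0 then f p else 0)"
    by (rule sum.cong[OF refl], rule sum_conj[where F = "\<lambda>p. if p \<in> stab n w0 then f p else 0"]) simp
  also have "\<dots> = fact n * (\<Sum>p\<in>stab n w0. f p)"
    using stab_subset[of n w0]
    by (simp add: sum.inter_restrict[symmetric] finite_perms card_permutations Int_absorb1)
  finally show ?thesis .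
qed

text \<open>Burnside's count for the action on words of a fixed content, which is
  transitive.\<close>

lemma sum_eta:
  assumes "size N = n"
  shows "(\<Sum>p\<in>perms n. eta n N p) = fact n"
proof -
  obtain w0 where w0: "w0 \<in> words n N" using words_nonempty[OF assms] by blast
  then show ?thesis using sum_class_eta[OF w0, of "\<lambda>_. 1"] card_stab_pos[of n w0] by simp
qed

text \<open>A pair of words is a word of pairs. It is fixed if and only if both words are, and its
  content is a matrix with the two contents as margins.\<close>

lemma eta_mult: "eta n N p * eta n M p = (\<Sum>P\<in>margins N M. eta n P p)"
proof -
  let ?A = "{w \<in> words n N. p \<in> stab n w}" and ?B = "{w \<in> words n M. p \<in> stab n w}"
  let ?C = "\<lambda>P. {w \<in> words n P. p \<in> stab n w}"
  let ?pair = "\<lambda>(w, w'). restrict (\<lambda>x. (w x, w' x)) {..<n}"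
  let ?unpair = "\<lambda>w. (restrict (fst \<circ> w) {..<n}, restrict (snd \<circ> w) {..<n})"
  have restr: "image_mset (restrict w {..<n}) (mset_set {..<n}) = image_mset w (mset_set {..<n})"
    for w :: "nat \<Rightarrow> 'c"
    by (rule image_mset_cong) auto
  have pn: "p x < n \<longleftrightarrow> x < n" if "p permutes {..<n}" for x using permutes_in_image[OF that] by simp
  have "bij_betw ?pair (?A \<times> ?B) (\<Union>P\<in>margins N M. ?C P)"
  proof (rule bij_betwI[where g = ?unpair])
    show "?pair \<in> ?A \<times> ?B \<rightarrow> (\<Union>P\<in>margins N M. ?C P)"
    proof clarify
      fix w w' assume w: "w \<in> words n N" "p \<in> stab n w" and w': "w' \<in> words n M" "p \<in> stab n w'"
      let ?P = "image_mset (\<lambda>x. (w x, w' x)) (mset_set {..<n})"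
      have "?P \<in> margins N M"
        using w(1) w'(1) by (simp add: margins_def words_def multiset.map_comp o_def)
      moreover have "restrict (\<lambda>x. (w x, w' x)) {..<n} \<in> words n ?P"
        unfolding words_def by (simp add: restr)
      moreover have "p \<in> stab n (restrict (\<lambda>x. (w x, w' x)) {..<n})"
        using w(2) w'(2) by (auto simp: stab_def pn)
      ultimately show "restrict (\<lambda>x. (w x, w' x)) {..<n} \<in> (\<Union>P\<in>margins N M. ?C P)" by blast
    qed
    show "?unpair \<in> (\<Union>P\<in>margins N M. ?C P) \<rightarrow> ?A \<times> ?B"
      unfolding words_def stab_def margins_def
      by (auto simp: restr multiset.map_comp[symmetric] pn simp del: multiset.map_comp)
    show "?unpair (?pair x) = x" if "x \<in> ?A \<times> ?B" for x
      using that by (auto simp: words_def PiE_def extensional_def fun_eq_iff)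
    show "?pair (?unpair x) = x" if "x \<in> (\<Union>P\<in>margins N M. ?C P)" for x
      using that by (auto simp: words_def PiE_def extensional_def fun_eq_iff)
  qed
  then have "card (?A \<times> ?B) = card (\<Union>P\<in>margins N M. ?C P)" by (rule bij_betw_same_card)
  also have "\<dots> = (\<Sum>P\<in>margins N M. card (?C P))"
    by (rule card_UN_disjoint) (auto simp: finite_margins finite_words, auto simp: words_def)
  finally have "card ?A * card ?B = (\<Sum>P\<in>margins N M. card (?C P))" by (simp add: card_cartesian_product)
  then have "rat_of_nat (card ?A * card ?B) = of_nat (\<Sum>P\<in>margins N M. card (?C P))" by (simp only:)
  then show ?thesis unfolding eta_def of_nat_mult of_nat_sum .
qed

section \<open>Inner products and the characteristic\<close>

lemma class_ip_sum_left:
  "class_ip n (\<lambda>p. \<Sum>x\<in>A. c x * f x p) g = (\<Sum>x\<in>A. c x * class_ip n (f x) g)"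
proof -
  have "(\<Sum>p\<in>perms n. (\<Sum>x\<in>A. c x * f x p) * g p) = (\<Sum>p\<in>perms n. \<Sum>x\<in>A. c x * (f x p * g p))"
    by (simp add: sum_distrib_right mult.assoc)
  also have "\<dots> = (\<Sum>x\<in>A. c x * (\<Sum>p\<in>perms n. f x p * g p))"
    by (subst sum.swap) (simp add: sum_distrib_left)
  finally show ?thesis by (simp add: class_ip_def sum_divide_distrib[where A = A])
qed

lemma class_ip_commute: "class_ip n f g = class_ip n g f"
  by (simp add: class_ip_def mult.commute)

lemma class_ip_eta_eta:
  assumes "size N = n"
  shows "class_ip n (eta n N) (eta n M) = of_nat (card (margins N M))"
proof -
  have "size P = n" if "P \<in> margins N M" for P
    using that assms by (auto simp: margins_def)
  then have "(\<Sum>p\<in>perms n. \<Sum>P\<in>margins N M. eta n P p) = (\<Sum>P\<in>margins N M. fact n)"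
    by (subst sum.swap) (simp add: sum_eta)
  then show ?thesis by (simp add: class_ip_def eta_mult)
qed

text \<open>The Frobenius characteristic, described by its monomial coefficients instead of power sums.\<close>

definition charac :: "nat \<Rightarrow> ((nat \<Rightarrow> nat) \<Rightarrow> rat) \<Rightarrow> series" where
  "charac n f = series_of (\<lambda>M. class_ip n f (eta n M))"

lemma coeff_charac: "coeff_of (charac n f) M = class_ip n f (eta n M)"
  by (simp add: charac_def series_of_inverse)

definition phi :: "nat \<Rightarrow> nat list \<Rightarrow> (nat \<Rightarrow> nat) \<Rightarrow> rat" where
  "phi n lam p = (\<Sum>w\<in>jt_perms lam. of_int (sign w) * eta n (jt_content lam w) p)"

text \<open>Both are the same signed sum of inner products with \<open>eta\<close>. With
  \<open>charac_phi\<close>, orthonormality of the \<open>phi\<close> becomes the duality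
  \<open>schur_coord_schur\<close>.\<close>

lemma class_ip_phi:
  "class_ip n (phi n lam) f = schur_coord lam (charac n f)"
  unfolding phi_def class_ip_sum_left schur_coord_def coeff_charac
  by (simp add: class_ip_commute[of n f])

lemma charac_eta:
  assumes "size N = n"
  shows "charac n (eta n N) = hm N"
  by (rule series_eqI) (simp add: coeff_charac class_ip_eta_eta[OF assms] coeff_hm)

theorem charac_phi:
  assumes "lam \<turnstile> n"
  shows "charac n (phi n lam) = schur lam"
proof (rule series_eqI)
  fix M
  have s: "sorted_wrt (\<ge>) lam" and n: "sum_list lam = n" using assms by (auto simp: partition_of_def)
  have "coeff_of (charac n (phi n lam)) M
      = (\<Sum>w\<in>jt_perms lam. of_int (sign w) * class_ip n (eta n (jt_content lam w)) (eta n M))"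
    unfolding coeff_charac phi_def by (rule class_ip_sum_left)
  also have "\<dots> = coeff_of (schur lam) M"
    unfolding jacobi_trudi_hm[OF s] coeff_of_sum coeff_of_simps
    by (rule sum.cong) (auto simp: class_ip_eta_eta size_jt_content n coeff_hm)
  finally show "coeff_of (charac n (phi n lam)) M = coeff_of (schur lam) M" .
qed

lemma class_ip_phi_phi:
  assumes "lam \<turnstile> n" "\<mu> \<turnstile> n"
  shows "class_ip n (phi n lam) (phi n \<mu>) = (if lam = \<mu> then 1 else 0)"
  unfolding class_ip_phi charac_phi[OF assms(2)] by (rule schur_coord_schur[OF assms])

text \<open>Moving the factor \<open>eta n N\<close> to the other argument of the inner product
  brings it next to \<open>eta n M\<close>, where \<open>eta_mult\<close> applies.\<close>

lemma coeff_charac_eta_phi: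
  assumes "size N = n"
  shows "coeff_of (charac n (\<lambda>p. eta n N p * phi n \<mu> p)) M = schur_coord \<mu> (\<Sum>P\<in>margins N M. hm P)"
proof -
  have "size P = n" if "P \<in> margins N M" for P
    using that assms by (auto simp: margins_def)
  have "coeff_of (charac n (\<lambda>p. eta n N p * phi n \<mu> p)) M
      = class_ip n (\<lambda>p. \<Sum>P\<in>margins N M. 1 * eta n P p) (phi n \<mu>)"
    unfolding coeff_charac class_ip_def
    by (simp add: eta_mult[symmetric] mult.commute mult.left_commute)
  also have "\<dots> = (\<Sum>P\<in>margins N M. 1 * class_ip n (eta n P) (phi n \<mu>))"
    by (rule class_ip_sum_left)
  also have "\<dots> = (\<Sum>P\<in>margins N M. schur_coord \<mu> (hm P))"
    using \<open>\<And>P. P \<in> margins N M \<Longrightarrow> size P = n\<close>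
    by (simp add: class_ip_commute[of n "eta n _"] class_ip_phi charac_eta)
  finally show ?thesis by (simp add: schur_coord_sum)
qed

lemma coeff_charac_phi_phi:
  assumes "lam \<turnstile> n"
  shows "coeff_of (charac n (\<lambda>p. phi n lam p * phi n \<mu> p)) M
    = (\<Sum>w\<in>jt_perms lam. of_int (sign w) * schur_coord \<mu> (\<Sum>P\<in>margins (jt_content lam w) M. hm P))"
proof -
  have "sum_list lam = n" using assms by (simp add: partition_of_def)
  have "(\<lambda>p. phi n lam p * phi n \<mu> p)
      = (\<lambda>p. \<Sum>w\<in>jt_perms lam. of_int (sign w) * (eta n (jt_content lam w) p * phi n \<mu> p))"
    by (simp add: fun_eq_iff phi_def[of n lam] sum_distrib_right mult.assoc)
  then have "coeff_of (charac n (\<lambda>p. phi n lam p * phi n \<mu> p)) M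
      = (\<Sum>w\<in>jt_perms lam. of_int (sign w) * coeff_of (charac n (\<lambda>p. eta n (jt_content lam w) p * phi n \<mu> p)) M)"
    unfolding coeff_charac by (simp only: class_ip_sum_left)
  then show ?thesis
    using \<open>sum_list lam = n\<close> by (simp add: coeff_charac_eta_phi size_jt_content)
qed

section \<open>Young subgroups separate class functions\<close>

definition orb :: "('a \<Rightarrow> 'a) \<Rightarrow> 'a \<Rightarrow> 'a set" where
  "orb p x = range (\<lambda>i. (p ^^ i) x)"

text \<open>Two numbers below \<open>n\<close> get the same letter exactly if they lie on one cycle
  of \<open>p\<close>. The stabilizer is therefore the Young subgroup preserving each cycle of
  \<open>p\<close> as a set.\<close>

definition orb_word :: "nat \<Rightarrow> (nat \<Rightarrow> nat) \<Rightarrow> nat \<Rightarrow> nat" where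
  "orb_word n p = restrict (\<lambda>x. Min (orb p x)) {..<n}"

context
  fixes n :: nat and p :: "nat \<Rightarrow> nat"
  assumes p: "p permutes {..<n}"
begin

lemma perm_p: "permutation p"
  using p by (rule permutes_imp_permutation[rotated]) simp

lemma orb_refl: "x \<in> orb p x"
  unfolding orb_def by (metis funpow_0 rangeI)

lemma finite_orb: "finite (orb p x)"
  unfolding orb_def support_set[OF perm_p, symmetric] by simp

lemma orb_eq: "y \<in> orb p x \<Longrightarrow> orb p y = orb p x"
  using disjoint_support'[OF perm_p, of x y] disjoint_support[OF perm_p]
  unfolding support_set[OF perm_p] orb_def[symmetric]
  by (metis disjnt_def disjoint_def rangeI disjoint_iff orb_refl)

lemma orb_step: "orb p (p x) = orb p x"
  by (rule orb_eq) (metis orb_def funpow_0 funpow_simps_right(2) comp_apply rangeI)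

lemma orb_bounded: "x < n \<Longrightarrow> orb p x \<subseteq> {..<n}"
  using permutes_in_image[OF permutes_funpow[OF p]] by (auto simp: orb_def)

lemma orb_funpow: "orb p ((p ^^ k) x) = orb p x"
  by (rule orb_eq) (simp add: orb_def)

lemma Min_orb: "Min (orb p x) \<in> orb p x"
  using finite_orb orb_refl by (metis Min_in empty_iff)

lemma orb_Min: "orb p (Min (orb p x)) = orb p x"
  using orb_eq Min_orb by blast

lemma card_orb: "card (orb p x) = least_power p x"
  unfolding orb_def support_set[OF perm_p, symmetric]
  using distinct_card[OF cycle_of_permutation[OF perm_p, of x]] by simp

lemma funpow_eq_iff: "(p ^^ (i + j)) x = (p ^^ i) x \<longleftrightarrow> card (orb p x) dvd j"
proof -
  have "bij (p ^^ i)" using permutes_funpow[OF p] by (rule permutes_bij)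
  then have "(p ^^ (i + j)) x = (p ^^ i) x \<longleftrightarrow> (p ^^ j) x = x"
    unfolding funpow_add comp_apply by (rule inj_eq[OF bij_is_inj])
  then show ?thesis by (simp add: card_orb least_power_dvd[OF perm_p])
qed

lemma self_stab: "p \<in> stab n (orb_word n p)"
  using p permutes_in_image[OF p] by (simp add: stab_def orb_word_def orb_step)

end

lemma stab_orb_word:
  assumes p: "p permutes {..<n}" and q: "q \<in> stab n (orb_word n p)" and x: "x < n"
  shows "orb q x \<subseteq> orb p x"
proof
  have qn: "q permutes {..<n}" using q by (simp add: stab_def)
  have step: "orb p (q y) = orb p y" if "y < n" for y
  proof -
    have "q y < n" using that permutes_in_image[OF qn] by simp
    then have "Min (orb p (q y)) = Min (orb p y)" using q that by (auto simp: stab_def orb_word_def)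
    then show ?thesis using orb_Min[OF p] by metis
  qed
  have "orb p ((q ^^ i) x) = orb p x" for i
  proof (induction i)
    case (Suc i)
    have "(q ^^ i) x < n" using x permutes_in_image[OF permutes_funpow[OF qn]] by simp
    then show ?case using Suc step by simp
  qed simp
  then show "y \<in> orb p x" if "y \<in> orb q x" for y
    using that orb_refl[OF p] by (auto simp: orb_def[of q])
qed

text \<open>On each cycle start from its least element \<open>r\<close> and send the
  \<open>i\<close>-th iterate of \<open>r\<close> under \<open>p\<close> to the one under
  \<open>q\<close>. Equal cycle lengths make this well defined and injective.\<close>

lemma same_orbits_conjugate:
  fixes n :: nat
  assumes p: "p permutes {..<n}" and q: "q permutes {..<n}"
    and orb: "\<And>x. x < n \<Longrightarrow> orb q x = orb p x"
  obtains t where "t permutes {..<n}" "t \<circ> p \<circ> pinv t = q"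
proof -
  define r where "r x = Min (orb p x)" for x :: nat
  define k where "k x = (SOME k. (p ^^ k) (r x) = x)" for x
  define t where "t x = (if x < n then (q ^^ k x) (r x) else x)" for x
  have rn: "r x < n" if "x < n" for x
    using that orb_bounded[OF p that] Min_orb[OF p, of x] by (auto simp: r_def)
  have orb_r: "orb p (r x) = orb p x" for x unfolding r_def by (rule orb_Min[OF p])
  have k: "(p ^^ k x) (r x) = x" for x
  proof -
    have "x \<in> orb p (r x)" unfolding orb_r by (rule orb_refl[OF p])
    then have "\<exists>k. (p ^^ k) (r x) = x" unfolding orb_def by (metis rangeE)
    then show ?thesis unfolding k_def by (rule someI_ex)
  qed
  have le: "(p ^^ i) y = (p ^^ j) y \<longleftrightarrow> (q ^^ i) y = (q ^^ j) y" if "y < n" "i \<le> j" for y i j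
    using funpow_eq_iff[OF p, of i "j - i" y] funpow_eq_iff[OF q, of i "j - i" y] orb[OF that(1)] that(2)
    by (simp add: eq_commute)
  have tr: "(p ^^ i) y = (p ^^ j) y \<longleftrightarrow> (q ^^ i) y = (q ^^ j) y" if "y < n" for y i j
    using le[OF that, of i j] le[OF that, of j i] by (metis nat_le_linear)
  \<comment> \<open>The choice of \<open>k\<close> does not matter: exponents that reach the same
    point under \<open>p\<close> do so under \<open>q\<close>.\<close>
  have t: "t ((p ^^ i) (r x)) = (q ^^ i) (r x)" if x: "x < n" for x i
  proof -
    let ?y = "(p ^^ i) (r x)"
    have y: "?y < n" using rn[OF x] permutes_in_image[OF permutes_funpow[OF p]] by simp
    have "r ?y = r x" by (simp add: r_def orb_funpow[OF p] orb_Min[OF p])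
    then show ?thesis using k[of ?y] tr[OF rn[OF x], of "k ?y" i] y by (simp add: t_def)
  qed
  have tn: "t x < n" if "x < n" for x
    using that rn[OF that] permutes_in_image[OF permutes_funpow[OF q]] by (simp add: t_def)
  have tp: "t (p x) = q (t x)" for x
  proof (cases "x < n")
    case True
    have "t (p x) = t ((p ^^ Suc (k x)) (r x))" using k[of x] by simp
    also have "\<dots> = q (t x)" unfolding t[OF True] using True by (simp add: t_def)
    finally show ?thesis .
  next
    case False
    then show ?thesis using p q by (simp add: t_def permutes_def)
  qed
  have "inj_on t {..<n}"
  proof (rule inj_onI)
    fix x y assume xy: "x \<in> {..<n}" "y \<in> {..<n}" "t x = t y"
    have ot: "orb p (t z) = orb p z" if "z < n" for z
    proof -
      have "orb q (t z) = orb q (r z)" using that by (simp add: t_def orb_funpow[OF q])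
      then show ?thesis using orb[OF tn[OF that]] orb[OF rn[OF that]] orb_r by simp
    qed
    have "orb p x = orb p y" using ot[of x] ot[of y] xy by simp
    then have "r x = r y" by (simp add: r_def)
    then have "(q ^^ k x) (r x) = (q ^^ k y) (r x)" using xy by (simp add: t_def)
    then have "(p ^^ k x) (r x) = (p ^^ k y) (r x)" using tr[OF rn] xy by simp
    then show "x = y" using k[of x] k[of y] \<open>r x = r y\<close> by metis
  qed
  moreover have "t ` {..<n} \<subseteq> {..<n}" using tn by auto
  ultimately have "bij_betw t {..<n} {..<n}" by (simp add: bij_betw_def endo_inj_surj)
  then have tperm: "t permutes {..<n}" by (rule bij_imp_permutes) (simp add: t_def)
  have "t \<circ> p \<circ> pinv t = q"
    using tp permutes_inverses(1)[OF tperm] by (simp add: fun_eq_iff)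
  with tperm show ?thesis by (rule that)
qed

text \<open>By reciprocity \<open>f\<close> sums to 0 over the Young subgroup of the cycles of
  \<open>p\<close>. An element of it either has the same cycles as \<open>p\<close>, hence is
  conjugate to \<open>p\<close>, or has finer cycles and a smaller sum of cycle lengths, so that
  \<open>f\<close> vanishes there by induction. What remains is a positive multiple of
  \<open>f p\<close>.\<close>

theorem charac_separates:
  assumes cls: "\<And>p t. p permutes {..<n} \<Longrightarrow> t permutes {..<n} \<Longrightarrow> f (t \<circ> p \<circ> pinv t) = f p"
    and zero: "charac n f = 0" and p: "p permutes {..<n}"
  shows "f p = 0"
proof -
  have stab0: "(\<Sum>q\<in>stab n w. f q) = 0" if w: "w \<in> {..<n} \<rightarrow>\<^sub>E UNIV" for w :: "nat \<Rightarrow> nat"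
  proof -
    let ?N = "image_mset w (mset_set {..<n})"
    have "w \<in> words n ?N" using w by (simp add: words_def)
    from sum_class_eta[where f = f, OF this cls] have "fact n * (\<Sum>q\<in>stab n w. f q)
        = of_nat (card (stab n w)) * (class_ip n f (eta n ?N) * fact n)"
      by (simp add: class_ip_def)
    moreover have "class_ip n f (eta n ?N) = 0"
      using zero coeff_charac[of n f ?N] by (simp add: coeff_of_simps)
    ultimately show ?thesis by simp
  qed
  show ?thesis using p
  proof (induction "\<Sum>x<n. card (orb p x)" arbitrary: p rule: less_induct)
    case less
    note p = less.prems
    let ?St = "stab n (orb_word n p)" and ?same = "\<lambda>q. \<forall>x<n. orb q x = orb p x"
    have "f q = (if ?same q then f p else 0)" if q: "q \<in> ?St" for q
    proof (cases "?same q")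
      case True
      have qn: "q permutes {..<n}" using q by (simp add: stab_def)
      obtain t where "t permutes {..<n}" "t \<circ> p \<circ> pinv t = q"
        using same_orbits_conjugate[OF p qn] True by metis
      then show ?thesis using cls[OF p] True by metis
    next
      case False
      have qn: "q permutes {..<n}" using q by (simp add: stab_def)
      obtain x where x: "x < n" "orb q x \<noteq> orb p x" using False by auto
      have "card (orb q y) \<le> card (orb p y)" if "y < n" for y
        using stab_orb_word[OF p q that] finite_orb[OF p] by (simp add: card_mono)
      moreover have "card (orb q x) < card (orb p x)"
        using stab_orb_word[OF p q x(1)] finite_orb[OF p] x(2) by (simp add: psubset_card_mono psubset_eq)
      ultimately have "(\<Sum>x<n. card (orb q x)) < (\<Sum>x<n. card (orb p x))"
        using x(1) by (intro sum_strict_mono_ex1) auto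
      then have "f q = 0" using less.hyps[OF _ qn] by simp
      then show ?thesis unfolding if_not_P[OF False] .
    qed
    then have "(\<Sum>q\<in>?St. f q) = (\<Sum>q\<in>?St. if ?same q then f p else 0)" by (rule sum.cong[OF refl])
    also have "\<dots> = of_nat (card {q \<in> ?St. ?same q}) * f p"
      by (simp add: sum.If_cases finite_stab Int_def)
    finally have "of_nat (card {q \<in> ?St. ?same q}) * f p = 0"
      using stab0[of "orb_word n p"] by (simp add: orb_word_def)
    moreover have "p \<in> {q \<in> ?St. ?same q}" using self_stab[OF p] by simp
    moreover have "finite {q \<in> ?St. ?same q}"
      by (rule finite_subset[OF _ finite_stab[of n "orb_word n p"]]) auto
    ultimately have "card {q \<in> ?St. ?same q} > 0" "of_nat (card {q \<in> ?St. ?same q}) * f p = 0"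
      using card_gt_0_iff by blast+
    then show ?case by simp
  qed
qed

section \<open>The group algebra\<close>

abbreviation lk :: "perm_comb \<Rightarrow> (nat \<Rightarrow> nat) \<Rightarrow> rat" where
  "lk \<equiv> Poly_Mapping.lookup"

abbreviation perm_el :: "(nat \<Rightarrow> nat) \<Rightarrow> perm_comb" where
  "perm_el p \<equiv> Poly_Mapping.single p 1"

lemma lookup_scale_comb [simp]: "lk (scale_comb c a) p = c * lk a p"
  by (simp add: scale_comb.rep_eq)

lemma comb_mult_superset:
  assumes "finite S" "Poly_Mapping.keys a \<subseteq> S" "finite T" "Poly_Mapping.keys b \<subseteq> T"
  shows "a \<star> b = (\<Sum>p\<in>S. \<Sum>q\<in>T. Poly_Mapping.single (p \<circ> q) (lk a p * lk b q))"
proof -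
  have "a \<star> b = (\<Sum>p\<in>Poly_Mapping.keys a. \<Sum>q\<in>T. Poly_Mapping.single (p \<circ> q) (lk a p * lk b q))"
    unfolding comb_mult_def
    by (intro sum.cong refl sum.mono_neutral_left) (use assms in \<open>auto simp: in_keys_iff\<close>)
  also have "\<dots> = (\<Sum>p\<in>S. \<Sum>q\<in>T. Poly_Mapping.single (p \<circ> q) (lk a p * lk b q))"
    by (rule sum.mono_neutral_left) (use assms in \<open>auto simp: in_keys_iff\<close>)
  finally show ?thesis .
qed

lemma comb_mult_add_left: "(a + b) \<star> c = a \<star> c + b \<star> c"
proof -
  let ?S = "Poly_Mapping.keys a \<union> Poly_Mapping.keys b"
  have "Poly_Mapping.keys (a + b) \<subseteq> ?S" by (rule keys_add)
  then show ?thesis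
    by (simp add: comb_mult_superset[of ?S _ "Poly_Mapping.keys c"] lookup_add distrib_right
        single_add sum.distrib)
qed

lemma comb_mult_add_right: "a \<star> (b + c) = a \<star> b + a \<star> c"
proof -
  let ?S = "Poly_Mapping.keys b \<union> Poly_Mapping.keys c"
  have "Poly_Mapping.keys (b + c) \<subseteq> ?S" by (rule keys_add)
  then show ?thesis
    by (simp add: comb_mult_superset[of "Poly_Mapping.keys a" _ ?S] lookup_add distrib_left
        single_add sum.distrib)
qed

lemma scale_comb_single: "scale_comb c (Poly_Mapping.single p d) = Poly_Mapping.single p (c * d)"
  by (rule poly_mapping_eqI) (auto simp: lookup_single when_def)

lemma comb_mult_scale_left: "scale_comb c a \<star> b = scale_comb c (a \<star> b)"
proof -
  have "Poly_Mapping.keys (scale_comb c a) \<subseteq> Poly_Mapping.keys a" by (auto simp: in_keys_iff)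
  then show ?thesis
    by (simp add: comb_mult_superset[of "Poly_Mapping.keys a" _ "Poly_Mapping.keys b"]
        comb.scale_sum_right scale_comb_single mult.assoc)
qed

lemma comb_mult_scale_right: "a \<star> scale_comb c b = scale_comb c (a \<star> b)"
proof -
  have "Poly_Mapping.keys (scale_comb c b) \<subseteq> Poly_Mapping.keys b" by (auto simp: in_keys_iff)
  then show ?thesis
    by (simp add: comb_mult_superset[of "Poly_Mapping.keys a" _ "Poly_Mapping.keys b"]
        comb.scale_sum_right scale_comb_single mult.left_commute)
qed

lemma comb_mult_zero [simp]: "0 \<star> a = 0" "a \<star> 0 = 0"
  by (simp_all add: comb_mult_def)

lemma comb_mult_sum_left: "sum f A \<star> b = (\<Sum>x\<in>A. f x \<star> b)"
  by (induction A rule: infinite_finite_induct) (auto simp: comb_mult_add_left)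

lemma comb_mult_sum_right: "a \<star> sum f A = (\<Sum>x\<in>A. a \<star> f x)"
  by (induction A rule: infinite_finite_induct) (auto simp: comb_mult_add_right)

lemma comb_mult_single: "Poly_Mapping.single p c \<star> Poly_Mapping.single q d = Poly_Mapping.single (p \<circ> q) (c * d)"
  by (subst comb_mult_superset[of "{p}" _ "{q}"]) auto

lemma comb_expand:
  assumes "finite S" "Poly_Mapping.keys a \<subseteq> S"
  shows "a = (\<Sum>p\<in>S. scale_comb (lk a p) (perm_el p))"
proof (rule poly_mapping_eqI)
  fix q
  have "lk (\<Sum>p\<in>S. scale_comb (lk a p) (perm_el p)) q = (\<Sum>p\<in>S. if p = q then lk a p else 0)"
    unfolding lookup_sum by (rule sum.cong) (auto simp: lookup_single when_def)
  also have "\<dots> = lk a q" using assms by (auto simp: in_keys_iff)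
  finally show "lk a q = lk (\<Sum>p\<in>S. scale_comb (lk a p) (perm_el p)) q" by simp
qed

lemmas comb_expand_keys = comb_expand[OF finite_keys order_refl]

lemma comb_mult_assoc: "a \<star> b \<star> c = a \<star> (b \<star> c)"
proof -
  have 1: "perm_el p \<star> perm_el q \<star> perm_el r = perm_el p \<star> (perm_el q \<star> perm_el r)" for p q r
    by (simp add: comb_mult_single comp_assoc)
  have 2: "perm_el p \<star> perm_el q \<star> c = perm_el p \<star> (perm_el q \<star> c)" for p q
    by (subst (1 2) comb_expand_keys[of c])
       (simp add: comb_mult_sum_right comb_mult_scale_right 1)
  have 3: "perm_el p \<star> b \<star> c = perm_el p \<star> (b \<star> c)" for p
    by (subst (1 2) comb_expand_keys[of b])
       (simp add: comb_mult_sum_left comb_mult_sum_right comb_mult_scale_left comb_mult_scale_right 2)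
  show ?thesis
    by (subst (1 2) comb_expand_keys[of a]) (simp add: comb_mult_sum_left comb_mult_scale_left 3)
qed

lemma perm_el_id [simp]: "perm_el id \<star> a = a" "a \<star> perm_el id = a"
  by (subst (1 2) comb_expand_keys[of a],
      simp add: comb_mult_sum_left comb_mult_sum_right comb_mult_scale_left comb_mult_scale_right comb_mult_single)+

lemma group_algebra_keys: "a \<in> group_algebra n \<longleftrightarrow> Poly_Mapping.keys a \<subseteq> perms n"
  by (simp add: group_algebra_def)

lemma group_algebra_lookup: "a \<in> group_algebra n \<Longrightarrow> \<not> p permutes {..<n} \<Longrightarrow> lk a p = 0"
  by (auto simp: group_algebra_keys in_keys_iff)

lemma group_algebra_expand: "a \<in> group_algebra n \<Longrightarrow> a = (\<Sum>p\<in>perms n. scale_comb (lk a p) (perm_el p))"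
  by (rule comb_expand) (simp_all add: finite_perms group_algebra_keys)

lemma group_algebra_scale: "a \<in> group_algebra n \<Longrightarrow> scale_comb c a \<in> group_algebra n"
  by (auto simp: group_algebra_keys in_keys_iff)

lemma group_algebra_sum: "(\<And>x. x \<in> A \<Longrightarrow> f x \<in> group_algebra n) \<Longrightarrow> sum f A \<in> group_algebra n"
  using keys_sum[of f A] by (fastforce simp: group_algebra_keys)

lemma group_algebra_single: "p permutes {..<n} \<Longrightarrow> Poly_Mapping.single p c \<in> group_algebra n"
  by (auto simp: group_algebra_keys)

lemma group_algebra_mult: "a \<in> group_algebra n \<Longrightarrow> b \<in> group_algebra n \<Longrightarrow> a \<star> b \<in> group_algebra n"
  unfolding comb_mult_def
  by (intro group_algebra_sum group_algebra_single) (auto simp: group_algebra_keys intro: permutes_compose)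

lemma group_algebra_induct [consumes 1, case_names sum]:
  assumes "a \<in> group_algebra n"
    and "\<And>c. P (\<Sum>p\<in>perms n. scale_comb (c p) (perm_el p))"
  shows "P a"
  using assms(2)[of "lk a"] group_algebra_expand[OF assms(1)] by simp

lemma lookup_perm_el_left:
  assumes "p permutes {..<n}"
  shows "lk (perm_el p \<star> a) q = lk a (pinv p \<circ> q)"
proof -
  have "p \<circ> r = q \<longleftrightarrow> r = pinv p \<circ> q" for r
    using permutes_inv_o[OF assms] by (metis comp_assoc id_comp)
  then have "lk (perm_el p \<star> perm_el r) q = lk (perm_el r) (pinv p \<circ> q)" for r
    by (simp add: comb_mult_single lookup_single when_def)
  then show ?thesis
    by (subst (1 2) comb_expand_keys[of a])
       (simp add: comb_mult_sum_right comb_mult_scale_right lookup_sum)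
qed

lemma lookup_perm_el_right:
  assumes "p permutes {..<n}"
  shows "lk (a \<star> perm_el p) q = lk a (q \<circ> pinv p)"
proof -
  have "r \<circ> p = q \<longleftrightarrow> r = q \<circ> pinv p" for r
    using permutes_inv_o[OF assms] by (metis comp_assoc comp_id)
  then have "lk (perm_el r \<star> perm_el p) q = lk (perm_el r) (q \<circ> pinv p)" for r
    by (simp add: comb_mult_single lookup_single when_def)
  then show ?thesis
    by (subst (1 2) comb_expand_keys[of a])
       (simp add: comb_mult_sum_left comb_mult_scale_left lookup_sum)
qed

section \<open>The coefficient at the identity, inversion and conjugacy sums\<close>

lemma lookup_mult_id:
  assumes "a \<in> group_algebra n"
  shows "lk (a \<star> b) id = (\<Sum>p\<in>perms n. lk a p * lk b (pinv p))"
proof -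
  have "lk (a \<star> b) id = (\<Sum>p\<in>perms n. lk a p * lk (perm_el p \<star> b) id)"
    by (subst group_algebra_expand[OF assms]) (simp add: comb_mult_sum_left comb_mult_scale_left lookup_sum)
  then show ?thesis by (simp add: lookup_perm_el_left)
qed

lemma sum_perms_inv: "(\<Sum>p\<in>perms n. F (pinv p)) = (\<Sum>p\<in>perms n. F p)"
  by (rule sum.reindex_bij_witness[where i = pinv and j = pinv])
     (auto simp: permutes_inv permutes_inv_inv)

lemma sum_perms_compose_right:
  assumes "t permutes {..<n}"
  shows "(\<Sum>p\<in>perms n. F (p \<circ> t)) = (\<Sum>p\<in>perms n. F p)"
  by (rule sum.reindex_bij_witness[where i = "\<lambda>p. p \<circ> pinv t" and j = "\<lambda>p. p \<circ> t"])
     (use assms in \<open>auto simp: permutes_inv permutes_compose comp_assoc permutes_inv_o\<close>)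

text \<open>The coefficient at the identity is a trace form. Rotating products under it is the main
  device in the calculations with symmetrizers.\<close>

lemma lookup_mult_id_commute:
  assumes "a \<in> group_algebra n" "b \<in> group_algebra n"
  shows "lk (a \<star> b) id = lk (b \<star> a) id"
  unfolding lookup_mult_id[OF assms(1)] lookup_mult_id[OF assms(2)]
  by (subst sum_perms_inv[symmetric]) (auto intro!: sum.cong simp: permutes_inv_inv mult.commute)

text \<open>The anti-automorphism that inverts permutations. It fixes row and column symmetrizers
  and so reverses the order of their products.\<close>

definition star :: "nat \<Rightarrow> perm_comb \<Rightarrow> perm_comb" where
  "star n a = (\<Sum>p\<in>perms n. scale_comb (lk a p) (perm_el (pinv p)))"

lemma lookup_star:
  assumes "a \<in> group_algebra n" "p permutes {..<n}"
  shows "lk (star n a) p = lk a (pinv p)"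
proof -
  have "pinv q = p \<longleftrightarrow> q = pinv p" if "q \<in> perms n" for q
    using that assms(2) by (metis mem_Collect_eq permutes_inv_inv)
  then have "lk (star n a) p = (\<Sum>q\<in>perms n. if q = pinv p then lk a q else 0)"
    unfolding star_def lookup_sum by (intro sum.cong) (auto simp: lookup_single when_def)
  then show ?thesis using permutes_inv[OF assms(2)] by (simp add: finite_perms)
qed

lemma star_in: "star n a \<in> group_algebra n"
  unfolding star_def by (intro group_algebra_sum group_algebra_scale group_algebra_single) (auto intro: permutes_inv)

lemma star_sum: "star n (\<Sum>x\<in>A. scale_comb (c x) (f x)) = (\<Sum>x\<in>A. scale_comb (c x) (star n (f x)))"
proof -
  have "star n (\<Sum>x\<in>A. scale_comb (c x) (f x))
      = (\<Sum>p\<in>perms n. \<Sum>x\<in>A. scale_comb (c x * lk (f x) p) (perm_el (pinv p)))"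
    by (simp add: star_def lookup_sum comb.scale_sum_left)
  also have "\<dots> = (\<Sum>x\<in>A. scale_comb (c x) (star n (f x)))"
    by (subst sum.swap) (simp add: star_def comb.scale_sum_right)
  finally show ?thesis .
qed

lemma star_perm_el: "p permutes {..<n} \<Longrightarrow> star n (perm_el p) = perm_el (pinv p)"
proof -
  assume p: "p permutes {..<n}"
  have "star n (perm_el p) = (\<Sum>q\<in>perms n. if q = p then perm_el (pinv q) else 0)"
    unfolding star_def by (rule sum.cong) (auto simp: lookup_single when_def)
  then show ?thesis using p by (simp add: finite_perms)
qed

lemma star_mult:
  assumes a: "a \<in> group_algebra n" and b: "b \<in> group_algebra n"
  shows "star n (a \<star> b) = star n b \<star> star n a"
proof -
  have 1: "star n (perm_el p \<star> perm_el q) = star n (perm_el q) \<star> star n (perm_el p)"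
    if "p \<in> perms n" "q \<in> perms n" for p q
    using that by (simp add: comb_mult_single star_perm_el permutes_compose o_inv_distrib permutes_bij)
  have 2: "star n (perm_el p \<star> b) = star n b \<star> star n (perm_el p)" if "p \<in> perms n" for p
    using b by (induction rule: group_algebra_induct)
      (use that in \<open>simp add: comb_mult_sum_right comb_mult_scale_right star_sum comb_mult_sum_left comb_mult_scale_left 1\<close>)
  show ?thesis
    using a by (induction rule: group_algebra_induct)
      (simp add: comb_mult_sum_left comb_mult_scale_left star_sum comb_mult_sum_right comb_mult_scale_right 2)
qed

definition class_sum :: "nat \<Rightarrow> perm_comb \<Rightarrow> (nat \<Rightarrow> nat) \<Rightarrow> rat" where
  "class_sum n a p = (\<Sum>t\<in>perms n. lk a (pinv t \<circ> p \<circ> t))"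

lemma class_sum_sum: "class_sum n (\<Sum>x\<in>A. scale_comb (c x) (f x)) p = (\<Sum>x\<in>A. c x * class_sum n (f x) p)"
  unfolding class_sum_def lookup_sum lookup_scale_comb
  by (subst sum.swap) (simp add: sum_distrib_left)

lemma class_sum_conj:
  assumes s: "s permutes {..<n}"
  shows "class_sum n a (s \<circ> p \<circ> pinv s) = class_sum n a p"
proof -
  have "class_sum n a (s \<circ> p \<circ> pinv s)
      = (\<Sum>t\<in>perms n. lk a (pinv (s \<circ> t) \<circ> (s \<circ> p \<circ> pinv s) \<circ> (s \<circ> t)))"
    unfolding class_sum_def
    by (rule sum.reindex_bij_witness[where i = "\<lambda>t. s \<circ> t" and j = "\<lambda>t. pinv s \<circ> t"])
       (use s in \<open>auto simp: permutes_compose permutes_inv comp_assoc[symmetric] permutes_inv_o\<close>)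
  also have "\<dots> = class_sum n a p"
    unfolding class_sum_def
  proof (intro sum.cong refl)
    fix t assume "t \<in> perms n"
    then have "pinv (s \<circ> t) = pinv t \<circ> pinv s"
      using s by (simp add: o_inv_distrib permutes_bij)
    moreover have "pinv s \<circ> (s \<circ> f) = f" for f :: "nat \<Rightarrow> nat"
      using permutes_inv_o(2)[OF s] by (metis comp_assoc id_comp)
    ultimately show "lk a (pinv (s \<circ> t) \<circ> (s \<circ> p \<circ> pinv s) \<circ> (s \<circ> t))
        = lk a (pinv t \<circ> p \<circ> t)"
      by (simp add: comp_assoc)
  qed
  finally show ?thesis .
qed

lemma class_sum_commute:
  assumes a: "a \<in> group_algebra n"
  shows "class_sum n (a \<star> b) p = class_sum n (b \<star> a) p"
proof -
  have 1: "class_sum n (perm_el s \<star> b) p = class_sum n (b \<star> perm_el s) p" if "s \<in> perms n" for s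
  proof -
    have s: "s permutes {..<n}" using that by simp
    have "class_sum n (b \<star> perm_el s) p = (\<Sum>t\<in>perms n. lk (b \<star> perm_el s) (pinv (t \<circ> s) \<circ> p \<circ> (t \<circ> s)))"
      unfolding class_sum_def
      by (rule sum_perms_compose_right[OF s, symmetric, where F = "\<lambda>t. lk (b \<star> perm_el s) (pinv t \<circ> p \<circ> t)"])
    also have "\<dots> = class_sum n (perm_el s \<star> b) p"
      unfolding class_sum_def
    proof (intro sum.cong refl)
      fix t assume "t \<in> perms n"
      then have "pinv (t \<circ> s) = pinv s \<circ> pinv t"
        using s by (simp add: o_inv_distrib permutes_bij)
      then show "lk (b \<star> perm_el s) (pinv (t \<circ> s) \<circ> p \<circ> (t \<circ> s))
          = lk (perm_el s \<star> b) (pinv t \<circ> p \<circ> t)"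
        by (simp add: lookup_perm_el_left[OF s] lookup_perm_el_right[OF s] comp_assoc permutes_inv_o[OF s])
    qed
    finally show ?thesis by simp
  qed
  show ?thesis
    using a by (induction rule: group_algebra_induct)
      (simp add: comb_mult_sum_left comb_mult_scale_left comb_mult_sum_right comb_mult_scale_right class_sum_sum 1)
qed

lemma class_sum_inv:
  assumes a: "a \<in> group_algebra n" and p: "p permutes {..<n}"
  shows "class_sum n a (pinv p) = class_sum n (star n a) p"
  unfolding class_sum_def
proof (intro sum.cong refl)
  fix t assume "t \<in> perms n"
  then have t: "t permutes {..<n}" by simp
  then have "pinv t \<circ> p \<circ> t permutes {..<n}"
    using p by (intro permutes_compose permutes_inv) auto
  moreover have "pinv (pinv t \<circ> p \<circ> t) = pinv t \<circ> pinv p \<circ> t"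
    using t p by (simp add: o_inv_distrib permutes_bij permutes_inv bij_comp permutes_inv_inv comp_assoc bij_imp_bij_inv)
  ultimately show "lk a (pinv t \<circ> pinv p \<circ> t)
      = lk (star n a) (pinv t \<circ> p \<circ> t)"
    by (simp add: lookup_star[OF a])
qed

text \<open>A class function does not see conjugation, so the n! summands of
  \<open>class_sum\<close> pair with it equally and cancel the denominator of
  \<open>class_ip\<close>.\<close>

lemma class_ip_class_sum:
  assumes g: "\<And>p t. p permutes {..<n} \<Longrightarrow> t permutes {..<n} \<Longrightarrow> g (t \<circ> p \<circ> pinv t) = g p"
  shows "class_ip n (class_sum n a) g = (\<Sum>p\<in>perms n. lk a p * g p)"
proof -
  have inner: "(\<Sum>p\<in>perms n. lk a (pinv t \<circ> p \<circ> t) * g p) = (\<Sum>p\<in>perms n. lk a p * g p)"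
    if t: "t permutes {..<n}" for t
  proof -
    have "(\<Sum>p\<in>perms n. lk a p * g p)
        = (\<Sum>p\<in>perms n. lk a (pinv t \<circ> p \<circ> t) * g (pinv t \<circ> p \<circ> t))"
      using sum_conj[OF permutes_inv[OF t], of "\<lambda>p. lk a p * g p"] by (simp add: permutes_inv_inv[OF t])
    also have "\<dots> = (\<Sum>p\<in>perms n. lk a (pinv t \<circ> p \<circ> t) * g p)"
      using g[OF _ permutes_inv[OF t]] by (intro sum.cong refl) (simp add: permutes_inv_inv[OF t])
    finally show ?thesis by simp
  qed
  have "(\<Sum>p\<in>perms n. class_sum n a p * g p)
      = (\<Sum>t\<in>perms n. \<Sum>p\<in>perms n. lk a (pinv t \<circ> p \<circ> t) * g p)"
    unfolding class_sum_def sum_distrib_right by (rule sum.swap)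
  also have "\<dots> = fact n * (\<Sum>p\<in>perms n. lk a p * g p)"
    by (simp add: inner card_permutations)
  finally show ?thesis by (simp add: class_ip_def)
qed

text \<open>Both sides are the trace of \<open>x \<mapsto> a x b\<close> on the group algebra.\<close>

lemma sum_lookup_class_sum_inv:
  assumes a: "a \<in> group_algebra n"
  shows "(\<Sum>p\<in>perms n. lk a p * class_sum n b (pinv p))
    = (\<Sum>t\<in>perms n. lk (a \<star> perm_el t \<star> b \<star> perm_el (pinv t)) id)"
proof -
  have "lk (a \<star> perm_el t \<star> b \<star> perm_el (pinv t)) id
      = (\<Sum>p\<in>perms n. lk a p * lk b (pinv t \<circ> pinv p \<circ> t))"
    if "t permutes {..<n}" for t
    using that
    by (simp add: comb_mult_assoc lookup_mult_id[OF a] lookup_perm_el_left[OF that]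
        lookup_perm_el_right[OF permutes_inv[OF that]] permutes_inv_inv comp_assoc)
  then have "(\<Sum>t\<in>perms n. lk (a \<star> perm_el t \<star> b \<star> perm_el (pinv t)) id)
      = (\<Sum>t\<in>perms n. \<Sum>p\<in>perms n. lk a p * lk b (pinv t \<circ> pinv p \<circ> t))"
    by (intro sum.cong) auto
  also have "\<dots> = (\<Sum>p\<in>perms n. lk a p * class_sum n b (pinv p))"
    unfolding class_sum_def sum_distrib_left by (rule sum.swap)
  finally show ?thesis by simp
qed

section \<open>Young symmetrizers\<close>

definition row_sym :: "nat \<Rightarrow> (nat \<Rightarrow> 'a) \<Rightarrow> perm_comb" where
  "row_sym n w = (\<Sum>p\<in>stab n w. perm_el p)"

definition col_antisym :: "nat \<Rightarrow> (nat \<Rightarrow> 'a) \<Rightarrow> perm_comb" where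
  "col_antisym n w = (\<Sum>q\<in>stab n w. Poly_Mapping.single q (of_int (sign q)))"

lemma stab_compose: "p \<in> stab n w \<Longrightarrow> q \<in> stab n w \<Longrightarrow> p \<circ> q \<in> stab n w"
  using permutes_in_image[of q "{..<n}"] by (auto simp: stab_def permutes_compose)

lemma stab_inv: "p \<in> stab n w \<Longrightarrow> pinv p \<in> stab n w"
proof -
  assume p: "p \<in> stab n w"
  then have pn: "p permutes {..<n}" by (simp add: stab_def)
  have "w (pinv p x) = w x" if "x < n" for x
  proof -
    have "pinv p x < n" using that permutes_in_image[OF permutes_inv[OF pn]] by simp
    then have "w (p (pinv p x)) = w (pinv p x)" using p by (simp add: stab_def)
    then show ?thesis by (simp add: permutes_inverses[OF pn])
  qed
  then show ?thesis using permutes_inv[OF pn] by (simp add: stab_def)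
qed

lemma stab_permutes: "p \<in> stab n w \<Longrightarrow> p permutes {..<n}"
  by (simp add: stab_def)

lemma sum_stab_compose:
  assumes r: "r \<in> stab n w"
  shows "(\<Sum>p\<in>stab n w. F (r \<circ> p)) = (\<Sum>p\<in>stab n w. F p)"
    and "(\<Sum>p\<in>stab n w. F (p \<circ> r)) = (\<Sum>p\<in>stab n w. F p)"
proof -
  have rn: "r \<circ> pinv r = id" "pinv r \<circ> r = id"
    using permutes_inv_o[OF stab_permutes[OF r]] by auto
  show "(\<Sum>p\<in>stab n w. F (r \<circ> p)) = (\<Sum>p\<in>stab n w. F p)"
    by (rule sum.reindex_bij_witness[where i = "\<lambda>p. pinv r \<circ> p" and j = "\<lambda>p. r \<circ> p"])
       (use r rn in \<open>auto simp: comp_assoc[symmetric] intro: stab_compose stab_inv\<close>)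
  show "(\<Sum>p\<in>stab n w. F (p \<circ> r)) = (\<Sum>p\<in>stab n w. F p)"
    by (rule sum.reindex_bij_witness[where i = "\<lambda>p. p \<circ> pinv r" and j = "\<lambda>p. p \<circ> r"])
       (use r rn in \<open>auto simp: comp_assoc intro: stab_compose stab_inv\<close>)
qed

lemma sign_stab_compose: "p \<in> stab n w \<Longrightarrow> q \<in> stab n w \<Longrightarrow> sign (p \<circ> q) = sign p * sign q"
  by (intro sign_compose) (auto intro!: permutes_imp_permutation[of "{..<n}"] stab_permutes)

lemma row_sym_in: "row_sym n w \<in> group_algebra n"
  unfolding row_sym_def by (intro group_algebra_sum group_algebra_single stab_permutes)

lemma col_antisym_in: "col_antisym n w \<in> group_algebra n"
  unfolding col_antisym_def by (intro group_algebra_sum group_algebra_single stab_permutes)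

lemma lookup_row_sym: "lk (row_sym n w) p = (if p \<in> stab n w then 1 else 0)"
proof -
  have "lk (row_sym n w) p = (\<Sum>q\<in>stab n w. if q = p then 1 else 0)"
    unfolding row_sym_def lookup_sum by (rule sum.cong) (auto simp: lookup_single when_def)
  then show ?thesis by (simp add: finite_stab)
qed

lemma lookup_col_antisym: "lk (col_antisym n w) p = (if p \<in> stab n w then of_int (sign p) else 0)"
proof -
  have "lk (col_antisym n w) p = (\<Sum>q\<in>stab n w. if q = p then of_int (sign q) else 0)"
    unfolding col_antisym_def lookup_sum by (rule sum.cong) (auto simp: lookup_single when_def)
  then show ?thesis by (simp add: finite_stab)
qed

lemma row_sym_absorb:
  assumes "r \<in> stab n w"
  shows "perm_el r \<star> row_sym n w = row_sym n w" "row_sym n w \<star> perm_el r = row_sym n w"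
  unfolding row_sym_def comb_mult_sum_left comb_mult_sum_right comb_mult_single
  using sum_stab_compose[OF assms, where F = perm_el] by simp_all

lemma row_sym_square: "row_sym n w \<star> row_sym n w = scale_comb (of_nat (card (stab n w))) (row_sym n w)"
proof -
  have "row_sym n w \<star> row_sym n w = (\<Sum>p\<in>stab n w. row_sym n w)"
    by (subst row_sym_def) (simp add: comb_mult_sum_left row_sym_absorb)
  then show ?thesis by (simp add: comb.sum_constant_scale)
qed

lemma sign_square: "sign p * sign p = 1"
  by (simp add: sign_def)

lemma col_antisym_absorb:
  assumes q: "q \<in> stab n w"
  shows "perm_el q \<star> col_antisym n w = scale_comb (of_int (sign q)) (col_antisym n w)"
    and "col_antisym n w \<star> perm_el q = scale_comb (of_int (sign q)) (col_antisym n w)"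
proof -
  have s: "sign p = sign q * sign (q \<circ> p)" "sign p = sign q * sign (p \<circ> q)" if "p \<in> stab n w" for p
    unfolding sign_stab_compose[OF q that] sign_stab_compose[OF that q]
    using sign_square[of q] by (simp_all add: mult.left_commute[of "sign q" "sign p"] flip: mult.assoc)
  have "perm_el q \<star> col_antisym n w
      = (\<Sum>p\<in>stab n w. scale_comb (of_int (sign q)) (Poly_Mapping.single (q \<circ> p) (of_int (sign (q \<circ> p)))))"
    unfolding col_antisym_def comb_mult_sum_right comb_mult_single scale_comb_single
    by (rule sum.cong) (auto simp: s(1))
  also have "\<dots> = scale_comb (of_int (sign q)) (col_antisym n w)"
    using sum_stab_compose(1)[OF q, where F = "\<lambda>p. scale_comb (of_int (sign q)) (Poly_Mapping.single p (of_int (sign p)))"]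
    by (simp add: col_antisym_def comb.scale_sum_right)
  finally show "perm_el q \<star> col_antisym n w = scale_comb (of_int (sign q)) (col_antisym n w)" .
  have "col_antisym n w \<star> perm_el q
      = (\<Sum>p\<in>stab n w. scale_comb (of_int (sign q)) (Poly_Mapping.single (p \<circ> q) (of_int (sign (p \<circ> q)))))"
    unfolding col_antisym_def comb_mult_sum_left comb_mult_single scale_comb_single
    by (rule sum.cong) (auto simp: s(2))
  also have "\<dots> = scale_comb (of_int (sign q)) (col_antisym n w)"
    using sum_stab_compose(2)[OF q, where F = "\<lambda>p. scale_comb (of_int (sign q)) (Poly_Mapping.single p (of_int (sign p)))"]
    by (simp add: col_antisym_def comb.scale_sum_right)
  finally show "col_antisym n w \<star> perm_el q = scale_comb (of_int (sign q)) (col_antisym n w)" .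
qed

lemma stab_inv_iff: "p permutes {..<n} \<Longrightarrow> pinv p \<in> stab n w \<longleftrightarrow> p \<in> stab n w"
  using stab_inv[of p n w] stab_inv[of "pinv p" n w] by (auto simp: permutes_inv_inv)

lemma group_algebra_eqI:
  assumes "a \<in> group_algebra n" "b \<in> group_algebra n" "\<And>p. p permutes {..<n} \<Longrightarrow> lk a p = lk b p"
  shows "a = b"
  using assms group_algebra_lookup by (intro poly_mapping_eqI) metis

lemma star_row_sym: "star n (row_sym n w) = row_sym n w"
  by (rule group_algebra_eqI[OF star_in row_sym_in])
     (simp add: lookup_star row_sym_in lookup_row_sym stab_inv_iff)

lemma star_col_antisym: "star n (col_antisym n w) = col_antisym n w"
  by (rule group_algebra_eqI[OF star_in col_antisym_in])
     (auto simp: lookup_star col_antisym_in lookup_col_antisym stab_inv_iff sign_inverse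
       permutes_imp_permutation[of "{..<n}"])

text \<open>The transposition of \<open>x\<close> and \<open>y\<close> is absorbed by the row
  symmetrizer on the left. Carried across \<open>t\<close> it becomes a transposition within a
  column, which changes the sign on the right; so the product equals its own negative.\<close>

lemma row_col_vanish:
  assumes t: "t permutes {..<n}" and xy: "x < n" "y < n" "x \<noteq> y" "w x = w y"
    and v: "v (pinv t x) = v (pinv t y)"
  shows "row_sym n w \<star> perm_el t \<star> col_antisym n v = 0"
proof -
  let ?t' = "pinv t"
  define r where "r = Transposition.transpose x y"
  define q where "q = Transposition.transpose (?t' x) (?t' y)"
  have lt: "?t' x < n" "?t' y < n" using xy permutes_in_image[OF permutes_inv[OF t]] by auto
  have ne: "?t' x \<noteq> ?t' y" using xy(3) permutes_inverses(1)[OF t] by metis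
  have r: "r \<in> stab n w"
    using xy by (auto simp: stab_def r_def transpose_def intro!: permutes_swap_id)
  have q: "q \<in> stab n v"
    using lt v by (auto simp: stab_def q_def transpose_def intro!: permutes_swap_id)
  have "r \<circ> t = t \<circ> q"
  proof
    fix z
    have "z = ?t' x \<longleftrightarrow> t z = x" "z = ?t' y \<longleftrightarrow> t z = y" using permutes_inverses[OF t] by metis+
    then show "(r \<circ> t) z = (t \<circ> q) z"
      using permutes_inverses(1)[OF t] by (auto simp: r_def q_def transpose_def)
  qed
  then have "perm_el r \<star> perm_el t = perm_el t \<star> perm_el q" by (simp add: comb_mult_single)
  then have "row_sym n w \<star> perm_el t \<star> col_antisym n v = row_sym n w \<star> perm_el t \<star> (perm_el q \<star> col_antisym n v)"
    using row_sym_absorb(2)[OF r] by (metis comb_mult_assoc)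
  also have "\<dots> = - (row_sym n w \<star> perm_el t \<star> col_antisym n v)"
    unfolding col_antisym_absorb(1)[OF q] comb_mult_scale_right
    using ne by (simp add: q_def sign_swap_id)
  finally have "lk (row_sym n w \<star> perm_el t \<star> col_antisym n v) p = 0" for p
    by (metis equal_neg_zero lookup_uminus)
  then show ?thesis by (intro poly_mapping_eqI) simp
qed

text \<open>For the idempotent \<open>e = c / k\<close>, the trace on the left ideal of \<open>c\<close> is the trace of \<open>x \<mapsto> p x e\<close> on the
  whole group algebra.\<close>

lemma trace_on_left_ideal:
  assumes c: "c \<in> group_algebra n" and cc: "c \<star> c = scale_comb k c" and k: "k \<noteq> 0"
    and p: "p permutes {..<n}"
  shows "trace_on ((\<lambda>a. a \<star> c) ` group_algebra n) (\<lambda>v. perm_el p \<star> v)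
    = (\<Sum>t\<in>perms n. lk (perm_el p \<star> perm_el t \<star> c) t) / k"
proof -
  let ?V = "(\<lambda>a. a \<star> c) ` group_algebra n"
  let ?L = "\<lambda>v. perm_el p \<star> v"
  define e where "e = scale_comb (1 / k) c"
  have eV: "a \<star> e \<in> ?V" if "a \<in> group_algebra n" for a
  proof -
    have "a \<star> e = scale_comb (1 / k) a \<star> c" by (simp add: e_def comb_mult_scale_left comb_mult_scale_right)
    then show ?thesis using that group_algebra_scale by blast
  qed
  have fixV: "v \<star> e = v" if "v \<in> ?V" for v
    using that k by (auto simp: e_def comb_mult_scale_right comb_mult_assoc cc)
  have VA: "?V \<subseteq> group_algebra n" using c by (auto intro: group_algebra_mult)
  have LV: "?L v \<in> ?V" if "v \<in> ?V" for v
    using that group_algebra_mult[OF group_algebra_single[OF p]] by (auto simp: comb_mult_assoc[symmetric])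
  have sub: "comb.subspace ?V"
  proof (rule comb.subspaceI)
    show "0 \<in> ?V" by (rule image_eqI[of _ _ 0]) (auto simp: group_algebra_keys)
  next
    fix x y assume "x \<in> ?V" "y \<in> ?V"
    then obtain a b where ab: "a \<in> group_algebra n" "x = a \<star> c" "b \<in> group_algebra n" "y = b \<star> c" by auto
    then have "a + b \<in> group_algebra n" using keys_add[of a b] by (auto simp: group_algebra_keys)
    then show "x + y \<in> ?V" using ab by (auto simp: comb_mult_add_left[symmetric])
  next
    fix d x assume "x \<in> ?V"
    then show "scale_comb d x \<in> ?V"
      by (auto simp: comb_mult_scale_left[symmetric] intro: group_algebra_scale)
  qed
  have "\<exists>B. comb.independent B \<and> comb.span B = ?V"
    using comb.basis_exists[of ?V] comb.span_subspace[OF _ _ sub] by metis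
  \<comment> \<open>The basis that \<open>trace_on\<close> picks has to be used literally; nothing
    is known about it beyond being a basis of the ideal.\<close>
  define B where "B = (SOME B. comb.independent B \<and> comb.span B = ?V)"
  have B: "comb.independent B" "comb.span B = ?V"
    unfolding B_def by (rule someI2_ex[OF \<open>\<exists>B. _ B\<close>], simp)+
  have BV: "b \<in> ?V" if "b \<in> B" for b using comb.span_base[OF that] B(2) by simp
  have finB: "finite B"
  proof -
    have "?V \<subseteq> comb.span (perm_el ` perms n)"
    proof
      fix v assume "v \<in> ?V"
      then have "v \<in> group_algebra n" using VA by blast
      then show "v \<in> comb.span (perm_el ` perms n)"
        by (subst group_algebra_expand, simp)
          (intro comb.span_sum comb.span_scale comb.span_base imageI)
    qed
    then show ?thesis
      using comb.independent_span_bound[of "perm_el ` perms n" B] B(1) BV finite_perms by blast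
  qed
  let ?R = "comb.representation B"
  have expand: "v = (\<Sum>b\<in>B. scale_comb (?R v b) b)" if "v \<in> ?V" for v
  proof -
    have "(\<Sum>b\<in>B. scale_comb (?R v b) b) = (\<Sum>b | ?R v b \<noteq> 0. scale_comb (?R v b) b)"
      by (rule sum.mono_neutral_right) (use finB comb.representation_ne_zero in auto)
    then show ?thesis using comb.sum_nonzero_representation_eq[OF B(1)] that B(2) by simp
  qed
  have "(\<Sum>t\<in>perms n. lk (perm_el p \<star> perm_el t \<star> c) t) / k = (\<Sum>t\<in>perms n. lk (?L (perm_el t \<star> e)) t)"
    by (simp add: e_def comb_mult_scale_right comb_mult_assoc sum_divide_distrib)
  also have "\<dots> = (\<Sum>t\<in>perms n. \<Sum>b\<in>B. ?R (perm_el t \<star> e) b * lk (?L b) t)"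
  proof (intro sum.cong refl)
    fix t assume "t \<in> perms n"
    then have "perm_el t \<star> e \<in> ?V" by (intro eV group_algebra_single) simp
    then show "lk (?L (perm_el t \<star> e)) t = (\<Sum>b\<in>B. ?R (perm_el t \<star> e) b * lk (?L b) t)"
      by (subst expand) (simp_all add: comb_mult_sum_right comb_mult_scale_right lookup_sum)
  qed
  also have "\<dots> = (\<Sum>b\<in>B. \<Sum>t\<in>perms n. ?R (perm_el t \<star> e) b * lk (?L b) t)"
    by (rule sum.swap)
  also have "\<dots> = (\<Sum>b\<in>B. ?R (?L b) b)"
  proof (intro sum.cong refl)
    fix b assume b: "b \<in> B"
    have Lb: "?L b \<in> ?V" using LV BV[OF b] .
    \<comment> \<open>Right multiplication by \<open>e\<close> fixes the ideal, so the coefficients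
      of \<open>?L b\<close> at the permutations \<open>t\<close> also express it through the
      elements \<open>t e\<close> of the span of \<open>B\<close>.\<close>
    have "?L b = ?L b \<star> e" using fixV[OF Lb] by simp
    also have "\<dots> = (\<Sum>t\<in>perms n. scale_comb (lk (?L b) t) (perm_el t)) \<star> e"
      using group_algebra_expand[of "?L b" n] VA Lb by auto
    also have "\<dots> = (\<Sum>t\<in>perms n. scale_comb (lk (?L b) t) (perm_el t \<star> e))"
      by (simp add: comb_mult_sum_left comb_mult_scale_left)
    finally have Lb_eq: "?L b = (\<Sum>t\<in>perms n. scale_comb (lk (?L b) t) (perm_el t \<star> e))" .
    have sp: "perm_el t \<star> e \<in> comb.span B" if "t \<in> perms n" for t
      unfolding B(2) using that by (intro eV group_algebra_single) simp
    have "?R (?L b) b = ?R (\<Sum>t\<in>perms n. scale_comb (lk (?L b) t) (perm_el t \<star> e)) b"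
      using Lb_eq by (rule arg_cong)
    also have "\<dots> = (\<Sum>t\<in>perms n. ?R (scale_comb (lk (?L b) t) (perm_el t \<star> e)) b)"
      by (subst comb.representation_sum[OF B(1)]) (auto intro: comb.span_scale sp)
    also have "\<dots> = (\<Sum>t\<in>perms n. ?R (perm_el t \<star> e) b * lk (?L b) t)"
      by (intro sum.cong refl) (simp add: comb.representation_scale[OF B(1) sp])
    finally show "(\<Sum>t\<in>perms n. ?R (perm_el t \<star> e) b * lk (?L b) t) = ?R (?L b) b" by simp
  qed
  also have "\<dots> = trace_on ?V ?L"
    unfolding trace_on_def B_def[symmetric] Let_def ..
  finally show ?thesis by simp
qed

lemma eta_class_sum:
  assumes w: "w \<in> words n N" and p: "p permutes {..<n}"
  shows "of_nat (card (stab n w)) * eta n N p = class_sum n (row_sym n w) p"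
proof -
  have "class_sum n (row_sym n w) p
      = (\<Sum>t\<in>perms n. lk (row_sym n w) (t \<circ> p \<circ> pinv t))"
    unfolding class_sum_def
    by (subst sum_perms_inv[symmetric]) (auto intro!: sum.cong simp: permutes_inv_inv)
  also have "\<dots> = of_nat (card {t \<in> perms n. t \<circ> p \<circ> pinv t \<in> stab n w})"
    by (simp add: lookup_row_sym sum.If_cases finite_perms Int_def)
  finally show ?thesis by (simp add: eta_conjugates[OF w p])
qed

lemma eta_conj:
  assumes "size N = n" "p permutes {..<n}" "t permutes {..<n}"
  shows "eta n N (t \<circ> p \<circ> pinv t) = eta n N p"
proof -
  obtain w where w: "w \<in> words n N" using words_nonempty[OF assms(1)] by blast
  have "of_nat (card (stab n w)) * eta n N (t \<circ> p \<circ> pinv t) = of_nat (card (stab n w)) * eta n N p"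
    using eta_class_sum[OF w] class_sum_conj[OF assms(3)] assms(2,3) by (simp add: permutes_conj)
  then show ?thesis using card_stab_pos[of n w] by simp
qed

text \<open>The combinatorial input for the theory of symmetrizers: a permutation without collision
  between rows and moved columns factors into a row and a column permutation, and the two groups
  meet trivially.\<close>

locale young_words =
  fixes n :: nat and row :: "nat \<Rightarrow> nat" and col :: "nat \<Rightarrow> nat"
  assumes young_split: "\<And>t. t permutes {..<n} \<Longrightarrow>
      (\<And>x y. x < n \<Longrightarrow> y < n \<Longrightarrow> row x = row y \<Longrightarrow>
        col (pinv t x) = col (pinv t y) \<Longrightarrow> x = y) \<Longrightarrow>
      \<exists>r\<in>stab n row. \<exists>q\<in>stab n col. t = r \<circ> q"
    and trivial_meet: "stab n row \<inter> stab n col = {id}"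
begin

abbreviation "row_el \<equiv> row_sym n row"
abbreviation "col_el \<equiv> col_antisym n col"

definition young :: perm_comb where
  "young = row_el \<star> col_el"

text \<open>By \<open>sandwich_eq\<close> the element between the two symmetrizers is always a
  multiple of \<open>young\<close>. Since \<open>young\<close> has coefficient 1 at the identity,
  the multiple can be read off there.\<close>

definition sandwich :: "perm_comb \<Rightarrow> rat" where
  "sandwich x = lk (row_el \<star> x \<star> col_el) id"

definition scalar :: rat where
  "scalar = lk (young \<star> young) id"

text \<open>This is the character of the left ideal of \<open>young\<close>
  (\<open>trace_on_young\<close>); as a conjugacy sum it has inner products computable in the group
  algebra.\<close>

definition character :: "(nat \<Rightarrow> nat) \<Rightarrow> rat" where
  "character p = class_sum n young p / scalar"

lemma young_in: "young \<in> group_algebra n"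
  unfolding young_def by (intro group_algebra_mult row_sym_in col_antisym_in)

lemma lookup_young_id: "lk young id = 1"
proof -
  have "lk young id = (\<Sum>p\<in>perms n. lk row_el p * lk col_el (pinv p))"
    unfolding young_def by (rule lookup_mult_id[OF row_sym_in])
  also have "\<dots> = (\<Sum>p\<in>{id}. lk row_el p * lk col_el (pinv p))"
  proof (rule sum.mono_neutral_right)
    show "\<forall>p\<in>perms n - {id}. lk row_el p * lk col_el (pinv p) = 0"
    proof
      fix p assume p: "p \<in> perms n - {id}"
      then have "p \<notin> stab n row \<or> p \<notin> stab n col" using trivial_meet by blast
      then show "lk row_el p * lk col_el (pinv p) = 0"
        using p by (auto simp: lookup_row_sym lookup_col_antisym stab_inv_iff)
    qed
  qed (auto simp: finite_perms permutes_id)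
  finally show ?thesis by (simp add: lookup_row_sym lookup_col_antisym id_stab)
qed

lemma sandwich_sum: "sandwich (\<Sum>x\<in>A. scale_comb (c x) (f x)) = (\<Sum>x\<in>A. c x * sandwich (f x))"
  by (simp add: sandwich_def comb_mult_sum_left comb_mult_sum_right comb_mult_scale_left
      comb_mult_scale_right lookup_sum)

text \<open>If \<open>t\<close> factors, the symmetrizers absorb both factors up to a sign;
  otherwise two points collide and \<open>row_col_vanish\<close> gives 0.\<close>

lemma sandwich_perm_el:
  assumes t: "t permutes {..<n}"
  shows "row_el \<star> perm_el t \<star> col_el = scale_comb (sandwich (perm_el t)) young"
proof (cases "\<exists>r\<in>stab n row. \<exists>q\<in>stab n col. t = r \<circ> q")
  case True
  then obtain r q where rq: "r \<in> stab n row" "q \<in> stab n col" "t = r \<circ> q" by blast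
  have e: "perm_el t = perm_el r \<star> perm_el q" by (simp add: rq(3) comb_mult_single)
  have "row_el \<star> perm_el t \<star> col_el = (row_el \<star> perm_el r) \<star> (perm_el q \<star> col_el)"
    unfolding e by (simp only: comb_mult_assoc)
  also have "\<dots> = scale_comb (of_int (sign q)) young"
    unfolding row_sym_absorb(2)[OF rq(1)] col_antisym_absorb(1)[OF rq(2)]
    by (simp add: comb_mult_scale_right young_def)
  finally show ?thesis by (simp add: sandwich_def lookup_young_id)
next
  case False
  then obtain x y where "x < n" "y < n" "row x = row y" "x \<noteq> y"
      "col (pinv t x) = col (pinv t y)"
    using young_split[OF t] by blast
  then have "row_el \<star> perm_el t \<star> col_el = 0" using row_col_vanish[OF t] by blast
  then show ?thesis by (simp add: sandwich_def)
qed

lemma sandwich_eq: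
  assumes "x \<in> group_algebra n"
  shows "row_el \<star> x \<star> col_el = scale_comb (sandwich x) young"
  using assms
proof (induction rule: group_algebra_induct)
  case (sum c)
  have "row_el \<star> (\<Sum>p\<in>perms n. scale_comb (c p) (perm_el p)) \<star> col_el
      = (\<Sum>p\<in>perms n. scale_comb (c p) (row_el \<star> perm_el p \<star> col_el))"
    by (simp add: comb_mult_sum_left comb_mult_sum_right comb_mult_scale_left comb_mult_scale_right)
  also have "\<dots> = (\<Sum>p\<in>perms n. scale_comb (c p * sandwich (perm_el p)) young)"
    by (intro sum.cong refl) (simp add: sandwich_perm_el)
  finally show ?case by (simp add: sandwich_sum comb.scale_sum_left)
qed

lemma young_square: "young \<star> young = scale_comb scalar young"
proof -
  have "young \<star> young = row_el \<star> (col_el \<star> row_el) \<star> col_el" by (simp add: young_def comb_mult_assoc)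
  also have "\<dots> = scale_comb (sandwich (col_el \<star> row_el)) young"
    by (intro sandwich_eq group_algebra_mult row_sym_in col_antisym_in)
  finally show ?thesis by (simp add: scalar_def lookup_young_id)
qed

text \<open>The element \<open>row_el \<star> col_el \<star> row_el\<close> is invariant under inversion, so its square has positive
  coefficient at the identity.\<close>

lemma scalar_pos: "scalar > 0"
proof -
  let ?m = "of_nat (card (stab n row)) :: rat"
  let ?u = "row_el \<star> col_el \<star> row_el"
  have m: "?m > 0" using card_stab_pos[of n row] by simp
  have in': "row_el \<star> col_el \<in> group_algebra n" "?u \<in> group_algebra n"
    by (intro group_algebra_mult row_sym_in col_antisym_in)+
  have "star n ?u = ?u"
    unfolding star_mult[OF in'(1) row_sym_in] star_mult[OF row_sym_in col_antisym_in]
      star_row_sym star_col_antisym by (rule comb_mult_assoc[symmetric])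
  then have inv: "lk ?u (pinv p) = lk ?u p" if "p \<in> perms n" for p
    using lookup_star[OF in'(2), of p] that by simp
  have "lk ?u id = lk (row_el \<star> (row_el \<star> col_el)) id"
    by (rule lookup_mult_id_commute[OF in'(1) row_sym_in])
  also have "\<dots> = ?m"
    unfolding comb_mult_assoc[symmetric] row_sym_square comb_mult_scale_left
    by (simp add: lookup_young_id[unfolded young_def])
  finally have uid: "lk ?u id = ?m" .
  have "lk (?u \<star> ?u) id = (\<Sum>p\<in>perms n. lk ?u p * lk ?u p)"
    unfolding lookup_mult_id[OF in'(2)] by (intro sum.cong refl) (simp add: inv)
  also have "\<dots> > 0"
    by (rule sum_pos2[of _ id]) (use uid m in \<open>auto simp: finite_perms permutes_id\<close>)
  finally have pos: "lk (?u \<star> ?u) id > 0" .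
  \<comment> \<open>The square of \<open>row_el\<close> arises twice, once in the middle and once
    after a rotation under the coefficient at the identity. Each contributes a factor
    \<open>?m\<close>, and \<open>young \<star> young\<close> remains.\<close>
  have "?u \<star> ?u = row_el \<star> col_el \<star> (row_el \<star> row_el) \<star> col_el \<star> row_el"
    by (simp only: comb_mult_assoc)
  also have "\<dots> = scale_comb ?m (row_el \<star> (col_el \<star> row_el \<star> col_el \<star> row_el))"
    by (simp only: row_sym_square comb_mult_scale_left comb_mult_scale_right comb_mult_assoc)
  finally have "?u \<star> ?u = scale_comb ?m (row_el \<star> (col_el \<star> row_el \<star> col_el \<star> row_el))" .
  then have "lk (?u \<star> ?u) id = ?m * lk (row_el \<star> (col_el \<star> row_el \<star> col_el \<star> row_el)) id" by simp
  also have "lk (row_el \<star> (col_el \<star> row_el \<star> col_el \<star> row_el)) id = lk (col_el \<star> row_el \<star> col_el \<star> row_el \<star> row_el) id"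
    by (intro lookup_mult_id_commute[where n = n] group_algebra_mult row_sym_in col_antisym_in)
  also have "col_el \<star> row_el \<star> col_el \<star> row_el \<star> row_el = scale_comb ?m (col_el \<star> (row_el \<star> col_el \<star> row_el))"
    using row_sym_square[of n row] by (simp add: comb_mult_assoc comb_mult_scale_right)
  also have "lk (scale_comb ?m (col_el \<star> (row_el \<star> col_el \<star> row_el))) id = ?m * lk (row_el \<star> col_el \<star> row_el \<star> col_el) id"
    using lookup_mult_id_commute[OF col_antisym_in[of n col] in'(2)] by simp
  also have "row_el \<star> col_el \<star> row_el \<star> col_el = young \<star> young" by (simp add: young_def comb_mult_assoc)
  finally have "lk (?u \<star> ?u) id = ?m * (?m * scalar)" unfolding scalar_def .
  then show ?thesis using pos m by (simp add: zero_less_mult_iff)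
qed

lemma character_conj:
  "s permutes {..<n} \<Longrightarrow> character (s \<circ> p \<circ> pinv s) = character p"
  by (simp add: character_def class_sum_conj)

lemma class_sum_young_inv:
  assumes "p permutes {..<n}"
  shows "class_sum n young (pinv p) = class_sum n young p"
proof -
  have "star n young = col_el \<star> row_el"
    by (simp add: young_def star_mult row_sym_in col_antisym_in star_row_sym star_col_antisym)
  then show ?thesis
    using class_sum_inv[OF young_in assms] class_sum_commute[OF col_antisym_in[of n col]]
    by (simp add: young_def)
qed

lemma class_ip_character:
  assumes "\<And>p t. p permutes {..<n} \<Longrightarrow> t permutes {..<n} \<Longrightarrow> g (t \<circ> p \<circ> pinv t) = g p"
  shows "class_ip n character g = (\<Sum>p\<in>perms n. lk young p * g p) / scalar"
proof -
  have "class_ip n character g = class_ip n (class_sum n young) g / scalar"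
    by (simp add: class_ip_def character_def sum_divide_distrib mult.commute)
  then show ?thesis by (simp add: class_ip_class_sum[OF assms])
qed

lemma sum_young_sandwich:
  "(\<Sum>t\<in>perms n. lk young t * sandwich (x \<star> perm_el t \<star> y)) = sandwich (x \<star> young \<star> y)"
  by (subst (2) group_algebra_expand[OF young_in])
     (simp add: comb_mult_sum_left comb_mult_sum_right comb_mult_scale_left comb_mult_scale_right sandwich_sum)

text \<open>In trace form \<open>young \<star> perm_el t \<star> young\<close> is a multiple of
  \<open>young\<close>, of which the coefficient at \<open>t\<close> is taken. Summing over
  \<open>t\<close> reassembles the cube of \<open>young\<close>, with the square of
  \<open>scalar\<close> at the identity.\<close>

lemma character_norm: "class_ip n character character = 1"
proof -
  have "(\<Sum>p\<in>perms n. lk young p * class_sum n young p)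
      = (\<Sum>p\<in>perms n. lk young p * class_sum n young (pinv p))"
    by (intro sum.cong refl) (simp add: class_sum_young_inv)
  also have "\<dots> = (\<Sum>t\<in>perms n. lk (young \<star> perm_el t \<star> young \<star> perm_el (pinv t)) id)"
    by (rule sum_lookup_class_sum_inv[OF young_in])
  also have "\<dots> = (\<Sum>t\<in>perms n. lk young t * sandwich (col_el \<star> perm_el t \<star> row_el))"
  proof (intro sum.cong refl)
    fix t assume "t \<in> perms n"
    then have t: "t permutes {..<n}" by simp
    have "young \<star> perm_el t \<star> young = row_el \<star> (col_el \<star> perm_el t \<star> row_el) \<star> col_el"
      by (simp add: young_def comb_mult_assoc)
    also have "\<dots> = scale_comb (sandwich (col_el \<star> perm_el t \<star> row_el)) young"
      by (intro sandwich_eq group_algebra_mult row_sym_in col_antisym_in group_algebra_single t)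
    finally show "lk (young \<star> perm_el t \<star> young \<star> perm_el (pinv t)) id
        = lk young t * sandwich (col_el \<star> perm_el t \<star> row_el)"
      by (simp add: comb_mult_scale_left lookup_perm_el_right[OF permutes_inv[OF t]] permutes_inv_inv[OF t])
  qed
  also have "\<dots> = lk (young \<star> young \<star> young) id"
    unfolding sum_young_sandwich by (simp add: sandwich_def young_def comb_mult_assoc)
  also have "\<dots> = scalar * scalar"
    by (simp add: young_square comb_mult_scale_left lookup_young_id)
  finally have "(\<Sum>p\<in>perms n. lk young p * character p) = scalar"
    using scalar_pos by (simp add: character_def sum_divide_distrib[symmetric])
  then show ?thesis using scalar_pos character_conj by (simp add: class_ip_character)
qed

text \<open>Rotation brings \<open>row_sym n w\<close> to the front, facing \<open>col_el\<close>
  across an element of the group algebra: the position in which collisions or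
  \<open>sandwich_eq\<close> can act.\<close>

lemma class_ip_character_eta:
  assumes w: "w \<in> words n N"
  shows "of_nat (card (stab n w)) * class_ip n character (eta n N)
    = (\<Sum>t\<in>perms n. lk (row_sym n w \<star> (perm_el t \<star> row_el) \<star> col_el \<star> perm_el (pinv t)) id) / scalar"
proof -
  have sz: "size N = n" using w by (rule size_word)
  have "of_nat (card (stab n w)) * (\<Sum>p\<in>perms n. lk young p * eta n N p)
      = (\<Sum>p\<in>perms n. lk young p * class_sum n (row_sym n w) (pinv p))"
    unfolding sum_distrib_left
  proof (intro sum.cong refl)
    fix p assume "p \<in> perms n"
    then have p: "p permutes {..<n}" by simp
    show "of_nat (card (stab n w)) * (lk young p * eta n N p)
        = lk young p * class_sum n (row_sym n w) (pinv p)"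
      using eta_class_sum[OF w p] class_sum_inv[OF row_sym_in[of n w] p] star_row_sym[of n w]
      by (simp add: mult.left_commute)
  qed
  also have "\<dots> = (\<Sum>t\<in>perms n. lk (young \<star> perm_el t \<star> row_sym n w \<star> perm_el (pinv t)) id)"
    by (rule sum_lookup_class_sum_inv[OF young_in])
  also have "\<dots> = (\<Sum>t\<in>perms n. lk (young \<star> perm_el (pinv t) \<star> row_sym n w \<star> perm_el t) id)"
    by (subst sum_perms_inv[symmetric]) (auto intro!: sum.cong simp: permutes_inv_inv)
  also have "\<dots> = (\<Sum>t\<in>perms n. lk (row_sym n w \<star> (perm_el t \<star> row_el) \<star> col_el \<star> perm_el (pinv t)) id)"
  proof (intro sum.cong refl)
    fix t assume "t \<in> perms n"
    then have t: "t permutes {..<n}" by simp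
    have "lk ((young \<star> perm_el (pinv t)) \<star> (row_sym n w \<star> perm_el t)) id
        = lk ((row_sym n w \<star> perm_el t) \<star> (young \<star> perm_el (pinv t))) id"
      by (intro lookup_mult_id_commute[where n = n] group_algebra_mult young_in row_sym_in
          group_algebra_single t permutes_inv)
    then show "lk (young \<star> perm_el (pinv t) \<star> row_sym n w \<star> perm_el t) id
        = lk (row_sym n w \<star> (perm_el t \<star> row_el) \<star> col_el \<star> perm_el (pinv t)) id"
      by (simp add: young_def comb_mult_assoc)
  qed
  finally show ?thesis by (simp add: class_ip_character eta_conj[OF sz])
qed

text \<open>For the word of rows the sum reassembles
  \<open>row_el \<star> (young \<star> row_el) \<star> col_el\<close>, which is the order of the row
  group times \<open>young \<star> young\<close>; both the order and \<open>scalar\<close>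
  cancel.\<close>

lemma class_ip_character_row:
  assumes row: "restrict row {..<n} \<in> words n N"
  shows "class_ip n character (eta n N) = 1"
proof -
  let ?w = "restrict row {..<n}"
  let ?m = "of_nat (card (stab n row)) :: rat"
  have m: "?m > 0" using card_stab_pos[of n row] by simp
  have st: "stab n ?w = stab n row"
    using permutes_in_image[of _ "{..<n}"] by (auto simp: stab_def)
  have rs: "row_sym n ?w = row_el" unfolding row_sym_def st ..
  have "(\<Sum>t\<in>perms n. lk (row_el \<star> (perm_el t \<star> row_el) \<star> col_el \<star> perm_el (pinv t)) id)
      = (\<Sum>t\<in>perms n. lk young t * sandwich (perm_el id \<star> perm_el t \<star> row_el))"
  proof (intro sum.cong refl)
    fix t assume "t \<in> perms n"
    then have t: "t permutes {..<n}" by simp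
    have "row_el \<star> (perm_el t \<star> row_el) \<star> col_el = scale_comb (sandwich (perm_el t \<star> row_el)) young"
      by (intro sandwich_eq group_algebra_mult row_sym_in group_algebra_single t)
    then show "lk (row_el \<star> (perm_el t \<star> row_el) \<star> col_el \<star> perm_el (pinv t)) id
        = lk young t * sandwich (perm_el id \<star> perm_el t \<star> row_el)"
      by (simp add: comb_mult_scale_left lookup_perm_el_right[OF permutes_inv[OF t]] permutes_inv_inv[OF t])
  qed
  also have "\<dots> = lk (row_el \<star> (young \<star> row_el) \<star> col_el) id"
    unfolding sum_young_sandwich by (simp add: sandwich_def)
  also have "row_el \<star> (young \<star> row_el) \<star> col_el = scale_comb ?m (young \<star> young)"
    using row_sym_square[of n row] unfolding young_def
    by (metis comb_mult_assoc comb_mult_scale_left)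
  finally have "?m * class_ip n character (eta n N) = ?m * scalar / scalar"
    using class_ip_character_eta[OF row] by (simp only: st rs lookup_scale_comb scalar_def)
  then show ?thesis using m scalar_pos by simp
qed

text \<open>A collision for every \<open>t\<close> annihilates everything between
  \<open>row_sym n w\<close> and \<open>col_el\<close>.\<close>

lemma class_ip_character_vanish:
  assumes w: "w \<in> words n N"
    and coll: "\<And>t. t permutes {..<n} \<Longrightarrow> \<exists>x<n. \<exists>y<n. x \<noteq> y \<and> w x = w y \<and>
      col (pinv t x) = col (pinv t y)"
  shows "class_ip n character (eta n N) = 0"
proof -
  have z: "row_sym n w \<star> perm_el t \<star> col_el = 0" if "t permutes {..<n}" for t
    using coll[OF that] row_col_vanish[OF that, of _ _ w col] by blast
  have z': "row_sym n w \<star> x \<star> col_el = 0" if "x \<in> group_algebra n" for x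
    using that by (induction rule: group_algebra_induct)
      (simp add: comb_mult_sum_left comb_mult_sum_right comb_mult_scale_left comb_mult_scale_right z)
  have "row_sym n w \<star> (perm_el t \<star> row_el) \<star> col_el = 0" if "t permutes {..<n}" for t
    by (intro z' group_algebra_mult row_sym_in group_algebra_single that)
  then have "of_nat (card (stab n w)) * class_ip n character (eta n N) = 0"
    unfolding class_ip_character_eta[OF w] by simp
  then show ?thesis using card_stab_pos[of n w] by simp
qed

lemma trace_on_young:
  assumes p: "p permutes {..<n}"
  shows "trace_on ((\<lambda>a. a \<star> young) ` group_algebra n) (\<lambda>v. perm_el p \<star> v) = character p"
proof -
  have "trace_on ((\<lambda>a. a \<star> young) ` group_algebra n) (\<lambda>v. perm_el p \<star> v)
      = (\<Sum>t\<in>perms n. lk (perm_el p \<star> perm_el t \<star> young) t) / scalar"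
    using scalar_pos by (intro trace_on_left_ideal young_in young_square p) simp
  also have "(\<Sum>t\<in>perms n. lk (perm_el p \<star> perm_el t \<star> young) t) = class_sum n young (pinv p)"
    unfolding class_sum_def
  proof (intro sum.cong refl)
    fix t assume "t \<in> perms n"
    then have t: "t permutes {..<n}" by simp
    show "lk (perm_el p \<star> perm_el t \<star> young) t = lk young (pinv t \<circ> pinv p \<circ> t)"
      by (simp add: comb_mult_assoc lookup_perm_el_left[OF p] lookup_perm_el_left[OF t] comp_assoc)
  qed
  finally show ?thesis by (simp add: character_def class_sum_young_inv[OF p])
qed

end

section \<open>The irreducible characters\<close>

lemma cells_Cons: "cells (x # xs) = {0} \<times> {..<x} \<union> (\<lambda>(i, j). (Suc i, j)) ` cells xs"
proof -
  have "(i, j) \<in> cells (x # xs) \<longleftrightarrow> (i, j) \<in> {0} \<times> {..<x} \<union> (\<lambda>(i, j). (Suc i, j)) ` cells xs" for i j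
    by (cases i) (auto simp: cells_def image_iff)
  then show ?thesis by auto
qed

lemma reading_tableau_bij: "bij_betw (reading_tableau \<mu>) (cells \<mu>) {..<sum_list \<mu>}"
proof (induction \<mu>)
  case Nil
  then show ?case by (simp add: cells_def bij_betw_def)
next
  case (Cons x \<mu>)
  let ?up = "\<lambda>(i, j). (Suc i, j) :: nat \<times> nat"
  let ?r = "reading_tableau (x # \<mu>)"
  have "bij_betw ?r ({0} \<times> {..<x}) {..<x}"
    by (rule bij_betwI[where g = "\<lambda>j. (0, j)"]) (auto simp: reading_tableau_def)
  moreover have "bij_betw ?r (?up ` cells \<mu>) {x..<x + sum_list \<mu>}"
  proof -
    have "bij_betw ?up (cells \<mu>) (?up ` cells \<mu>)" by (auto simp: bij_betw_def inj_on_def)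
    moreover have "bij_betw ((+) x) {..<sum_list \<mu>} {x..<x + sum_list \<mu>}"
      by (rule bij_betwI[where g = "\<lambda>y. y - x"]) auto
    then have "bij_betw ((+) x \<circ> reading_tableau \<mu>) (cells \<mu>) {x..<x + sum_list \<mu>}"
      using Cons.IH by (rule bij_betw_trans[rotated])
    moreover have "?r \<circ> ?up = (+) x \<circ> reading_tableau \<mu>"
      by (auto simp: fun_eq_iff reading_tableau_def)
    ultimately show ?thesis using bij_betw_comp_iff by metis
  qed
  ultimately have "bij_betw ?r ({0} \<times> {..<x} \<union> ?up ` cells \<mu>) ({..<x} \<union> {x..<x + sum_list \<mu>})"
    by (rule bij_betw_combine) auto
  then show ?case by (simp add: cells_Cons ivl_disj_un)
qed

definition cell_of :: "nat list \<Rightarrow> nat \<Rightarrow> nat \<times> nat" where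
  "cell_of \<mu> = inv_into (cells \<mu>) (reading_tableau \<mu>)"

text \<open>Labels each number by the row of its cell in the reading tableau. The row group thereby
  becomes a stabilizer, like the groups behind the permutation characters.\<close>

definition row_word :: "nat list \<Rightarrow> nat \<Rightarrow> nat" where
  "row_word \<mu> x = fst (cell_of \<mu> x)"

definition col_word :: "nat list \<Rightarrow> nat \<Rightarrow> nat" where
  "col_word \<mu> x = snd (cell_of \<mu> x)"

lemma cell_of_bij: "bij_betw (cell_of \<mu>) {..<sum_list \<mu>} (cells \<mu>)"
  unfolding cell_of_def by (rule bij_betw_inv_into[OF reading_tableau_bij])

lemma cell_of_reading: "c \<in> cells \<mu> \<Longrightarrow> cell_of \<mu> (reading_tableau \<mu> c) = c"
  unfolding cell_of_def by (rule bij_betw_inv_into_left[OF reading_tableau_bij])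

lemma card_word_cells:
  "card {x. x < sum_list \<mu> \<and> P (row_word \<mu> x) (col_word \<mu> x)} = card {c \<in> cells \<mu>. P (fst c) (snd c)}"
proof (rule bij_betw_same_card)
  have "inj_on (cell_of \<mu>) {..<sum_list \<mu>}" "cell_of \<mu> ` {..<sum_list \<mu>} = cells \<mu>"
    using cell_of_bij[of \<mu>] by (auto simp: bij_betw_def)
  moreover from this have "{c \<in> cells \<mu>. P (fst c) (snd c)}
      = cell_of \<mu> ` {x \<in> {..<sum_list \<mu>}. P (fst (cell_of \<mu> x)) (snd (cell_of \<mu> x))}"
    using Compr_image_eq[of "cell_of \<mu>" "{..<sum_list \<mu>}" "\<lambda>c. P (fst c) (snd c)"] by simp
  ultimately show "bij_betw (cell_of \<mu>) {x. x < sum_list \<mu> \<and> P (row_word \<mu> x) (col_word \<mu> x)} {c \<in> cells \<mu>. P (fst c) (snd c)}"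
    by (auto simp: bij_betw_def row_word_def col_word_def intro: inj_on_subset)
qed

lemma word_cell_inj:
  assumes "x < sum_list \<mu>" "y < sum_list \<mu>" "row_word \<mu> x = row_word \<mu> y" "col_word \<mu> x = col_word \<mu> y"
  shows "x = y"
proof -
  have "cell_of \<mu> x = cell_of \<mu> y" using assms(3,4) by (simp add: row_word_def col_word_def prod_eq_iff)
  then show ?thesis using cell_of_bij[of \<mu>] assms(1,2) by (auto simp: bij_betw_def dest: inj_onD)
qed

lemma block_stabilizer:
  "{p. p permutes {..<n} \<and> (\<forall>i. p ` {x. x < n \<and> f x = i} = {x. x < n \<and> f x = i})} = stab n f"
proof (intro equalityI subsetI)
  fix p assume "p \<in> {p. p permutes {..<n} \<and> (\<forall>i. p ` {x. x < n \<and> f x = i} = {x. x < n \<and> f x = i})}"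
  then have p: "p permutes {..<n}" "\<And>i. p ` {x. x < n \<and> f x = i} = {x. x < n \<and> f x = i}" by auto
  have "f (p x) = f x" if "x < n" for x using p(2)[of "f x"] that by blast
  then show "p \<in> stab n f" using p by (simp add: stab_def)
next
  fix p assume p: "p \<in> stab n f"
  have "p ` {x. x < n \<and> f x = i} = {x. x < n \<and> f x = i}" for i
  proof (rule endo_inj_surj)
    show "p ` {x. x < n \<and> f x = i} \<subseteq> {x. x < n \<and> f x = i}"
      using p permutes_in_image[of p "{..<n}"] by (auto simp: stab_def)
  qed (use p in \<open>auto simp: stab_def intro: permutes_inj_on\<close>)
  then show "p \<in> {p. p permutes {..<n} \<and> (\<forall>i. p ` {x. x < n \<and> f x = i} = {x. x < n \<and> f x = i})}"
    using p by (simp add: stab_def)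
qed

lemma reading_image:
  "reading_tableau \<mu> ` {c \<in> cells \<mu>. P c} = {x. x < sum_list \<mu> \<and> P (cell_of \<mu> x)}"
proof (intro equalityI subsetI)
  fix x assume "x \<in> reading_tableau \<mu> ` {c \<in> cells \<mu>. P c}"
  then show "x \<in> {x. x < sum_list \<mu> \<and> P (cell_of \<mu> x)}"
    using reading_tableau_bij[of \<mu>] by (auto simp: bij_betw_def cell_of_reading)
next
  fix x assume x: "x \<in> {x. x < sum_list \<mu> \<and> P (cell_of \<mu> x)}"
  then have "reading_tableau \<mu> (cell_of \<mu> x) = x"
    unfolding cell_of_def by (intro bij_betw_inv_into_right[OF reading_tableau_bij]) simp
  moreover have "cell_of \<mu> x \<in> cells \<mu>" using x cell_of_bij[of \<mu>] by (auto simp: bij_betw_def)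
  ultimately show "x \<in> reading_tableau \<mu> ` {c \<in> cells \<mu>. P c}" using x by (metis (mono_tags) imageI mem_Collect_eq)
qed

lemma row_group_stab: "row_group \<mu> = stab (sum_list \<mu>) (row_word \<mu>)"
  unfolding row_group_def Let_def reading_image row_word_def[symmetric] by (rule block_stabilizer)

lemma column_group_stab: "column_group \<mu> = stab (sum_list \<mu>) (col_word \<mu>)"
  unfolding column_group_def Let_def reading_image col_word_def[symmetric] by (rule block_stabilizer)

section \<open>Collisions between words and column labels\<close>

lemma initial_segment:
  assumes "finite A" "\<And>i j. j \<in> A \<Longrightarrow> i < j \<Longrightarrow> i \<in> A"
  shows "A = {..<card A}"
proof -
  have "A = {..<n} \<Longrightarrow> card A = n" for n by simp
  moreover have "\<exists>n. A = {..<n}"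
  proof (cases "A = {}")
    case False
    have "A = {..<Suc (Max A)}"
      using Max_in[OF assms(1) False] Max_ge[OF assms(1)] assms(2)
      by (auto simp: less_Suc_eq_le) (metis le_neq_implies_less)
    then show ?thesis by blast
  qed auto
  ultimately show ?thesis by metis
qed

text \<open>With \<open>h\<close> the length of column \<open>j\<close>, the right-hand side is \<open>min k h\<close>; the left-hand side is at most
  \<open>k\<close> since \<open>w\<close> is injective on a fibre of \<open>d\<close>, and at most the number \<open>h\<close> of letters \<open>j\<close> in \<open>d\<close>.\<close>

lemma fibre_bound:
  assumes mu: "sorted_wrt (\<ge>) \<mu>"
    and d: "image_mset d (mset_set {..<sum_list \<mu>}) = image_mset (col_word \<mu>) (mset_set {..<sum_list \<mu>})"
    and inj: "\<And>x y. x < sum_list \<mu> \<Longrightarrow> y < sum_list \<mu> \<Longrightarrow> w x = w y \<Longrightarrow> d x = d y \<Longrightarrow> x = y"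
  shows "card {x. x < sum_list \<mu> \<and> w x < k \<and> d x = j}
    \<le> card {x. x < sum_list \<mu> \<and> row_word \<mu> x < k \<and> col_word \<mu> x = j}"
proof -
  let ?n = "sum_list \<mu>" and ?A = "{i. j < shape_of \<mu> i}"
  have "?A \<subseteq> {..<length \<mu>}" by (auto simp: shape_of_def split: if_splits)
  then have finA: "finite ?A" by (rule finite_subset) simp
  have "shape_of \<mu> i' \<le> shape_of \<mu> i" if "i \<le> i'" for i i'
    using that shape_of_shape[OF mu] by (auto simp: shape_def intro: lift_Suc_antimono_le)
  then have A: "?A = {..<card ?A}" by (intro initial_segment finA) (auto intro: less_le_trans)
  have card_seg: "card {c \<in> cells \<mu>. fst c < k \<and> snd c = j} = card ({..<k} \<inter> ?A)" for k
  proof -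
    have "{c \<in> cells \<mu>. fst c < k \<and> snd c = j} = ({..<k} \<inter> ?A) \<times> {j}"
      by (auto simp: cells_boxes boxes_def)
    then show ?thesis by (simp add: card_cartesian_product)
  qed
  have "card {x. x < ?n \<and> w x < k \<and> d x = j} \<le> k"
    using card_inj_on_le[of w "{x. x < ?n \<and> w x < k \<and> d x = j}" "{..<k}"] inj
    by (auto simp: inj_on_def)
  moreover have "card {x. x < ?n \<and> w x < k \<and> d x = j} \<le> card {x \<in> {..<?n}. d x = j}"
    by (rule card_mono) auto
  moreover have "card {x \<in> {..<?n}. d x = j} = card {x \<in> {..<?n}. col_word \<mu> x = j}"
    using d count_image_mset_set[of "{..<?n}" d j] count_image_mset_set[of "{..<?n}" "col_word \<mu>" j] by simp
  moreover have "card {x \<in> {..<?n}. col_word \<mu> x = j} = card ?A"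
  proof -
    have "{x \<in> {..<?n}. col_word \<mu> x = j} = {x. x < ?n \<and> col_word \<mu> x = j}" by auto
    moreover have "{c \<in> cells \<mu>. snd c = j} = ?A \<times> {j}" by (auto simp: cells_boxes boxes_def)
    ultimately show ?thesis
      using card_word_cells[of \<mu> "\<lambda>_ c. c = j"] by (simp add: card_cartesian_product)
  qed
  moreover have "card {x. x < ?n \<and> row_word \<mu> x < k \<and> col_word \<mu> x = j} = min k (card ?A)"
    unfolding card_word_cells[of \<mu> "\<lambda>r c. r < k \<and> c = j"] card_seg
  proof -
    have "{..<k} \<inter> ?A = {..<min k (card ?A)}" by (subst A) auto
    then show "card ({..<k} \<inter> ?A) = min k (card ?A)" by simp
  qed
  ultimately show ?thesis by simp
qed

lemma card_split_fibres:
  assumes "finite J" "\<And>x. x < n \<Longrightarrow> d x \<in> J"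
  shows "card {x. x < n \<and> w x < k} = (\<Sum>j\<in>J. card {x. x < (n :: nat) \<and> w x < k \<and> d x = j})"
proof -
  have "{x. x < n \<and> w x < k} = (\<Union>j\<in>J. {x. x < n \<and> w x < k \<and> d x = j})" using assms by auto
  also have "card \<dots> = (\<Sum>j\<in>J. card {x. x < n \<and> w x < k \<and> d x = j})"
    using assms(1) by (intro card_UN_disjoint) auto
  finally show ?thesis .
qed

text \<open>Among pairs of words without a repeated pair of letters, the row and column words are
  extremal. Summing \<open>fibre_bound\<close> over the letters of \<open>d\<close> gives the
  inequality, and equality of the sums forces equality in every fibre.\<close>

lemma words_bound:
  assumes mu: "sorted_wrt (\<ge>) \<mu>"
    and d: "image_mset d (mset_set {..<sum_list \<mu>}) = image_mset (col_word \<mu>) (mset_set {..<sum_list \<mu>})"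
    and inj: "\<And>x y. x < sum_list \<mu> \<Longrightarrow> y < sum_list \<mu> \<Longrightarrow> w x = w y \<Longrightarrow> d x = d y \<Longrightarrow> x = y"
  shows "card {x. x < sum_list \<mu> \<and> w x < k} \<le> sum (shape_of \<mu>) {..<k}"
    and "card {x. x < sum_list \<mu> \<and> w x < k} = sum (shape_of \<mu>) {..<k} \<Longrightarrow>
      card {x. x < sum_list \<mu> \<and> w x < k \<and> d x = j}
        = card {x. x < sum_list \<mu> \<and> row_word \<mu> x < k \<and> col_word \<mu> x = j}"
proof -
  \<comment> \<open>The letter \<open>j\<close> is inserted so that its fibre is among the summands
    even if it is no column of \<mu>.\<close>
  let ?n = "sum_list \<mu>" and ?J = "insert j (col_word \<mu> ` {..<sum_list \<mu>})"
  have "set_mset (image_mset d (mset_set {..<?n})) = set_mset (image_mset (col_word \<mu>) (mset_set {..<?n}))"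
    using d by (rule arg_cong)
  then have dJ: "d x \<in> ?J" if "x < ?n" for x using that by auto
  have w: "card {x. x < ?n \<and> w x < k} = (\<Sum>j\<in>?J. card {x. x < ?n \<and> w x < k \<and> d x = j})"
    by (rule card_split_fibres) (use dJ in auto)
  have "card {x. x < ?n \<and> row_word \<mu> x < k}
      = (\<Sum>j\<in>?J. card {x. x < ?n \<and> row_word \<mu> x < k \<and> col_word \<mu> x = j})"
    by (rule card_split_fibres) auto
  moreover have "card {x. x < ?n \<and> row_word \<mu> x < k} = sum (shape_of \<mu>) {..<k}"
    using card_word_cells[of \<mu> "\<lambda>r _. r < k"] by (simp add: card_cells_rows)
  ultimately have r: "sum (shape_of \<mu>) {..<k}
      = (\<Sum>j\<in>?J. card {x. x < ?n \<and> row_word \<mu> x < k \<and> col_word \<mu> x = j})" by simp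
  note bound = fibre_bound[OF mu d inj]
  show "card {x. x < ?n \<and> w x < k} \<le> sum (shape_of \<mu>) {..<k}"
    unfolding w r by (intro sum_mono bound)
  show "card {x. x < ?n \<and> w x < k \<and> d x = j} = card {x. x < ?n \<and> row_word \<mu> x < k \<and> col_word \<mu> x = j}"
    if "card {x. x < ?n \<and> w x < k} = sum (shape_of \<mu>) {..<k}"
    using that unfolding w r by (rule sum_mono_inv) (auto intro: bound)
qed

lemma col_word_permute:
  assumes "t permutes {..<n}"
  shows "image_mset (f \<circ> pinv t) (mset_set {..<n}) = image_mset f (mset_set {..<n})"
proof -
  have "image_mset (pinv t) (mset_set {..<n}) = mset_set {..<n}"
    using permutes_inv[OF assms] by (simp add: image_mset_mset_set permutes_inj_on permutes_image)
  then show ?thesis by (simp add: multiset.map_comp[symmetric])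
qed

text \<open>Without collision the bounds of \<open>words_bound\<close> are attained for every
  \<open>k\<close>, so rows paired with moved columns have the same joint content as rows paired
  with columns. A permutation \<open>r\<close> matching the two pairings preserves rows,
  \<open>pinv t \<circ> r\<close> preserves columns, and \<open>t\<close> is \<open>r\<close> times
  the inverse of the latter.\<close>

lemma young_words_partition:
  assumes mu: "sorted_wrt (\<ge>) \<mu>"
  shows "young_words (sum_list \<mu>) (row_word \<mu>) (col_word \<mu>)"
proof
  let ?n = "sum_list \<mu>" and ?row = "row_word \<mu>" and ?col = "col_word \<mu>"
  show "stab ?n ?row \<inter> stab ?n ?col = {id}"
  proof
    show "stab ?n ?row \<inter> stab ?n ?col \<subseteq> {id}"
    proof
      fix p assume p: "p \<in> stab ?n ?row \<inter> stab ?n ?col"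
      then have pn: "p permutes {..<?n}" by (simp add: stab_def)
      have "p x = x" for x
      proof (cases "x < ?n")
        case True
        then have "p x < ?n" using permutes_in_image[OF pn] by simp
        then show ?thesis using word_cell_inj[of "p x" \<mu> x] p True by (simp add: stab_def)
      qed (use pn in \<open>simp add: permutes_def\<close>)
      then show "p \<in> {id}" by auto
    qed
  qed (simp add: id_stab)
  fix t assume t: "t permutes {..<?n}"
  let ?t' = "pinv t"
  assume inj: "\<And>x y. x < ?n \<Longrightarrow> y < ?n \<Longrightarrow> ?row x = ?row y \<Longrightarrow> ?col (?t' x) = ?col (?t' y) \<Longrightarrow> x = y"
  let ?d = "?col \<circ> ?t'"
  have d: "image_mset ?d (mset_set {..<?n}) = image_mset ?col (mset_set {..<?n})"
    by (rule col_word_permute[OF t])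
  have rk: "card {x. x < ?n \<and> ?row x < k} = sum (shape_of \<mu>) {..<k}" for k
    using card_word_cells[of \<mu> "\<lambda>r _. r < k"] by (simp add: card_cells_rows)
  have eqk: "card {x. x < ?n \<and> ?row x < k \<and> ?d x = j} = card {x. x < ?n \<and> ?row x < k \<and> ?col x = j}" for k j
    by (rule words_bound(2)[OF mu d _ rk]) (use inj in auto)
  have diff: "card {x \<in> {..<?n}. (?row x, e x) = (i, j)}
      = card {x. x < ?n \<and> ?row x < Suc i \<and> e x = j} - card {x. x < ?n \<and> ?row x < i \<and> e x = j}" for e i and j :: nat
  proof -
    have "{x \<in> {..<?n}. (?row x, e x) = (i, j)}
        = {x. x < ?n \<and> ?row x < Suc i \<and> e x = j} - {x. x < ?n \<and> ?row x < i \<and> e x = j}" by auto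
    moreover have fin: "finite {x. x < ?n \<and> ?row x < i \<and> e x = j}" by simp
    moreover have sub: "{x. x < ?n \<and> ?row x < i \<and> e x = j} \<subseteq> {x. x < ?n \<and> ?row x < Suc i \<and> e x = j}"
      using less_SucI by blast
    ultimately show ?thesis using card_Diff_subset[OF fin sub] by (simp only:)
  qed
  have "image_mset (\<lambda>x. (?row x, ?col x)) (mset_set {..<?n}) = image_mset (\<lambda>x. (?row x, ?d x)) (mset_set {..<?n})"
  proof (rule multiset_eqI)
    fix c :: "nat \<times> nat"
    obtain i j where c: "c = (i, j)" by (cases c)
    show "count (image_mset (\<lambda>x. (?row x, ?col x)) (mset_set {..<?n})) c
        = count (image_mset (\<lambda>x. (?row x, ?d x)) (mset_set {..<?n})) c"
      unfolding c count_image_mset_set[OF finite_lessThan] diff[of ?col] diff[of ?d] eqk ..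
  qed
  then obtain r where r: "r permutes {..<?n}" "\<forall>x\<in>{..<?n}. (?row x, ?col x) = (?row (r x), ?d (r x))"
    by (rule image_mset_eq_implies_permutes[OF finite_lessThan])
  let ?q = "?t' \<circ> r"
  have q: "?q \<in> stab ?n ?col"
    using r permutes_inv[OF t] by (auto simp: stab_def permutes_compose)
  have "t = r \<circ> pinv ?q"
  proof -
    have "pinv ?q = pinv r \<circ> t"
      using o_inv_distrib[OF permutes_bij[OF permutes_inv[OF t]] permutes_bij[OF r(1)]]
        permutes_inv_inv[OF t] by simp
    then show ?thesis by (simp add: comp_assoc[symmetric] permutes_inv_o[OF r(1)])
  qed
  moreover have "r \<in> stab ?n ?row" using r by (auto simp: stab_def)
  ultimately show "\<exists>r\<in>stab ?n ?row. \<exists>q\<in>stab ?n ?col. t = r \<circ> q"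
    using stab_inv[OF q] by blast
qed

lemma row_word_content:
  "restrict (row_word \<mu>) {..<sum_list \<mu>} \<in> words (sum_list \<mu>) (jt_content \<mu> id)"
proof -
  let ?n = "sum_list \<mu>"
  have "image_mset (restrict (row_word \<mu>) {..<?n}) (mset_set {..<?n}) = image_mset (row_word \<mu>) (mset_set {..<?n})"
    by (rule image_mset_cong) auto
  also have "\<dots> = jt_content \<mu> id"
  proof (rule multiset_eqI)
    fix i
    have "{x \<in> {..<?n}. row_word \<mu> x = i} = {x. x < ?n \<and> row_word \<mu> x = i}" by auto
    moreover have "{c \<in> cells \<mu>. fst c = i} = {i} \<times> {..<shape_of \<mu> i}"
      by (auto simp: cells_boxes boxes_def)
    ultimately have "count (image_mset (row_word \<mu>) (mset_set {..<?n})) i = shape_of \<mu> i"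
      using card_word_cells[of \<mu> "\<lambda>r _. r = i"]
      by (simp add: count_image_mset_set card_cartesian_product)
    then show "count (image_mset (row_word \<mu>) (mset_set {..<?n})) i = count (jt_content \<mu> id) i"
      using count_jt_content[OF id_jt_perms, of \<mu> i] by (simp add: jt_index_def)
  qed
  finally have "image_mset (restrict (row_word \<mu>) {..<?n}) (mset_set {..<?n}) = jt_content \<mu> id" .
  moreover have "restrict (row_word \<mu>) {..<?n} \<in> {..<?n} \<rightarrow>\<^sub>E UNIV" by simp
  ultimately show ?thesis unfolding words_def by blast
qed

text \<open>Both sides have norm 1 and their inner product is 1, since only the identity term of the
  determinant pairs nontrivially with the character of the Specht module.\<close>

theorem irr_character_phi:
  assumes lam: "lam \<turnstile> n" and p: "p permutes {..<n}"
  shows "lk (irr_character lam) p = phi n lam p"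
proof -
  have s: "sorted_wrt (\<ge>) lam" and n: "sum_list lam = n" using lam by (auto simp: partition_of_def)
  interpret young_words n "row_word lam" "col_word lam"
    using young_words_partition[OF s] n by simp
  have eta0: "class_ip n character (eta n (jt_content lam w)) = (if w = id then 1 else 0)"
    if w: "w \<in> jt_perms lam" for w
  proof (cases "w = id")
    case True
    then show ?thesis using class_ip_character_row row_word_content[of lam] n by simp
  next
    case False
    \<comment> \<open>A word of this content has too many letters below \<open>k\<close> for
      \<open>words_bound(1)\<close>, so no \<open>t\<close> is free of collisions.\<close>
    obtain k where k: "sum (shape_of lam) {..<k} < psum (jt_content lam w) k"
      using jt_content_dominates_strict[OF w False] by blast
    obtain v where v: "v \<in> words n (jt_content lam w)"
      using words_nonempty[of "jt_content lam w" n] size_jt_content[OF w] n by blast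
    then have "jt_content lam w = image_mset v (mset_set {..<n})" by (simp add: words_def)
    then have ps: "psum (jt_content lam w) k = card {x. x < n \<and> v x < k}"
      by (simp add: psum_image)
    have "class_ip n character (eta n (jt_content lam w)) = 0"
    proof (rule class_ip_character_vanish[OF v], rule ccontr)
      fix t assume t: "t permutes {..<n}" and
        "\<not> (\<exists>x<n. \<exists>y<n. x \<noteq> y \<and> v x = v y \<and>
          col_word lam (pinv t x) = col_word lam (pinv t y))"
      then have "card {x. x < sum_list lam \<and> v x < k} \<le> sum (shape_of lam) {..<k}"
        using n by (intro words_bound(1)[OF s, where d = "col_word lam \<circ> pinv t"])
          (auto simp: col_word_permute)
      then show False using k ps n by simp
    qed
    then show ?thesis using False by simp
  qed
  have "class_ip n (phi n lam) character
      = (\<Sum>w\<in>jt_perms lam. of_int (sign w) * class_ip n (eta n (jt_content lam w)) character)"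
    unfolding phi_def by (rule class_ip_sum_left)
  also have "\<dots> = (\<Sum>w\<in>jt_perms lam. if w = id then 1 else 0)"
    by (rule sum.cong) (auto simp: class_ip_commute[of n _ character] eta0)
  also have "\<dots> = 1" by (simp add: finite_jt_perms id_jt_perms)
  finally have pc: "class_ip n (phi n lam) character = 1" .
  have pp: "class_ip n (phi n lam) (phi n lam) = 1" by (simp add: class_ip_phi_phi[OF lam lam])
  have S: "(\<Sum>p\<in>perms n. f p * g p) = fact n * class_ip n f g" for f g
    by (simp add: class_ip_def)
  have "(\<Sum>p\<in>perms n. (phi n lam p - character p)\<^sup>2)
      = (\<Sum>p\<in>perms n. phi n lam p * phi n lam p) - 2 * (\<Sum>p\<in>perms n. phi n lam p * character p)
        + (\<Sum>p\<in>perms n. character p * character p)"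
    by (simp add: power2_eq_square algebra_simps sum.distrib sum_subtractf sum_distrib_left)
  also have "\<dots> = 0" unfolding S by (simp add: pc pp character_norm)
  finally have "(\<Sum>p\<in>perms n. (phi n lam p - character p)\<^sup>2) = 0" .
  then have "(phi n lam p - character p)\<^sup>2 = 0"
    using p by (subst (asm) sum_nonneg_eq_0_iff) (auto simp: finite_perms)
  then have phi: "phi n lam p = character p" by simp
  have "young_symmetrizer lam = young"
    by (simp add: young_symmetrizer_def young_def row_sym_def col_antisym_def row_group_stab column_group_stab n)
  then have "lk (irr_character lam) p
      = (\<Sum>q\<in>perms n. if q = p then trace_on ((\<lambda>a. a \<star> young) ` group_algebra n) (\<lambda>v. perm_el q \<star> v) else 0)"
    unfolding irr_character_def lookup_sum specht_module_def n
    by (intro sum.cong) (auto simp: lookup_single when_def)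
  also have "\<dots> = character p" using p by (simp add: finite_perms trace_on_young)
  finally show ?thesis using phi by simp
qed

section \<open>The Frobenius map\<close>

lemma phi_conj:
  assumes "lam \<turnstile> n" "p permutes {..<n}" "t permutes {..<n}"
  shows "phi n lam (t \<circ> p \<circ> pinv t) = phi n lam p"
proof -
  have "size (jt_content lam w) = n" if "w \<in> jt_perms lam" for w
    using size_jt_content[OF that] assms(1) by (simp add: partition_of_def)
  then show ?thesis unfolding phi_def
    by (intro sum.cong refl) (simp add: eta_conj[OF _ assms(2,3)])
qed

lemma charac_cong: "(\<And>p. p permutes {..<n} \<Longrightarrow> f p = g p) \<Longrightarrow> charac n f = charac n g"
  by (rule series_eqI) (simp add: coeff_charac class_ip_def)

lemma charac_add: "charac n (\<lambda>p. f p + g p) = charac n f + charac n g"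
  by (rule series_eqI)
     (simp add: coeff_charac coeff_of_simps class_ip_def distrib_right sum.distrib add_divide_distrib)

lemma charac_scale: "charac n (\<lambda>p. c * f p) = c *\<^sub>s charac n f"
  by (rule series_eqI)
     (simp add: coeff_charac coeff_of_simps class_ip_def sum_distrib_left mult.assoc)

lemma charac_zero: "charac n (\<lambda>p. 0) = 0"
  by (rule series_eqI) (simp add: coeff_charac coeff_of_simps class_ip_def)

lemma charac_sum: "charac n (\<lambda>p. \<Sum>x\<in>A. f x p) = (\<Sum>x\<in>A. charac n (f x))"
  by (induction A rule: infinite_finite_induct) (simp_all add: charac_zero charac_add)

lemma eta_relabel:
  fixes g :: "'b \<Rightarrow> 'b"
  assumes p: "bij g"
  shows "eta n (image_mset g N) s = eta n N s"
proof -
  have inv: "pinv g \<circ> g = id" "g \<circ> pinv g = id"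
    using p by (simp_all add: bij_is_inj surj_iff[THEN iffD1, OF bij_is_surj])
  have im: "image_mset (restrict w {..<n}) (mset_set {..<n}) = image_mset w (mset_set {..<n})" for w :: "nat \<Rightarrow> 'b"
    by (rule image_mset_cong) auto
  have sn: "s x < n \<longleftrightarrow> x < n" if "s permutes {..<n}" for x using permutes_in_image[OF that] by simp
  have to: "restrict (h \<circ> w) {..<n} \<in> {w \<in> words n (image_mset h N). s \<in> stab n w}"
    if "w \<in> {w \<in> words n N. s \<in> stab n w}" for w N and h :: "'b \<Rightarrow> 'b"
  proof -
    have "image_mset (restrict (h \<circ> w) {..<n}) (mset_set {..<n}) = image_mset h N"
      unfolding im using that by (simp add: words_def flip: multiset.map_comp)
    moreover have "s \<in> stab n (restrict (h \<circ> w) {..<n})" using that by (auto simp: stab_def sn)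
    moreover have "restrict (h \<circ> w) {..<n} \<in> {..<n} \<rightarrow>\<^sub>E UNIV" by simp
    ultimately show ?thesis unfolding words_def by blast
  qed
  have undo: "restrict (h' \<circ> restrict (h \<circ> w) {..<n}) {..<n} = w"
    if "w \<in> words n N" "h' \<circ> h = id" for w N and h h' :: "'b \<Rightarrow> 'b"
    using that by (auto simp: words_def fun_eq_iff PiE_def extensional_def)
  let ?A = "{w \<in> words n N. s \<in> stab n w}" and ?B = "{w \<in> words n (image_mset g N). s \<in> stab n w}"
  have "bij_betw (\<lambda>w. restrict (g \<circ> w) {..<n}) ?A ?B"
  proof (rule bij_betwI[where g = "\<lambda>w. restrict (pinv g \<circ> w) {..<n}"])
    show "(\<lambda>w. restrict (g \<circ> w) {..<n}) \<in> ?A \<rightarrow> ?B" by (rule funcsetI) (rule to)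
    have "image_mset (pinv g) (image_mset g N) = N"
      by (simp add: multiset.map_comp inv)
    then show "(\<lambda>w. restrict (pinv g \<circ> w) {..<n}) \<in> ?B \<rightarrow> ?A"
      using to[of _ "image_mset g N" "pinv g"] by auto
    show "restrict (pinv g \<circ> restrict (g \<circ> w) {..<n}) {..<n} = w" if "w \<in> ?A" for w
      using that undo inv(1) by blast
    show "restrict (g \<circ> restrict (pinv g \<circ> w) {..<n}) {..<n} = w" if "w \<in> ?B" for w
      using that undo inv(2) by blast
  qed
  then show ?thesis by (simp add: eta_def bij_betw_same_card)
qed

lemma charac_homogeneous: "homogeneous (charac n f) n"
proof -
  have "eta n M p = 0" if "size M \<noteq> n" for M :: "nat multiset" and p
  proof -
    have "words n M = {}" using size_word that by blast
    then show ?thesis by (simp add: eta_def)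
  qed
  then have "class_ip n f (eta n M) = 0" if "size M \<noteq> n" for M :: "nat multiset"
    using that by (simp add: class_ip_def)
  then show ?thesis by (auto simp: homogeneous_def coeff_charac)
qed

lemma charac_sym: "charac n f \<in> sym_functions"
  using charac_homogeneous[of n f]
  by (auto simp: sym_functions_def coeff_charac eta_relabel homogeneous_def class_ip_def)

lemma charac_expansion: "charac n f = (\<Sum>\<mu> | \<mu> \<turnstile> n. schur_coord \<mu> (charac n f) *\<^sub>s schur \<mu>)"
proof -
  have "degree_le (charac n f) n" using charac_homogeneous[of n f] by (auto simp: homogeneous_def degree_le_def)
  then have "charac n f = (\<Sum>\<mu>\<in>partitions_upto n. schur_coord \<mu> (charac n f) *\<^sub>s schur \<mu>)"
    by (rule schur_expansion[OF charac_sym])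
  also have "\<dots> = (\<Sum>\<mu> | \<mu> \<turnstile> n. schur_coord \<mu> (charac n f) *\<^sub>s schur \<mu>)"
  proof (rule sum.mono_neutral_right)
    have "sum_list \<mu> = n" if "schur_coord \<mu> (charac n f) \<noteq> 0" for \<mu>
      by (rule schur_coord_homogeneous[OF charac_homogeneous that])
    then show "\<forall>\<mu>\<in>partitions_upto n - {\<mu>. \<mu> \<turnstile> n}. schur_coord \<mu> (charac n f) *\<^sub>s schur \<mu> = 0"
      by (metis (no_types, lifting) DiffE mem_Collect_eq partition_sum_list partitions_upto_iff
          series.scale_zero_left)
  qed (simp add: finite_partitions_upto, auto simp: partitions_upto_def)
  finally show ?thesis .
qed

section \<open>The center and the coordinates of its elements\<close>

definition class_function :: "nat \<Rightarrow> ((nat \<Rightarrow> nat) \<Rightarrow> rat) \<Rightarrow> bool" where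
  "class_function n f \<longleftrightarrow> (\<forall>p t. p permutes {..<n} \<longrightarrow> t permutes {..<n} \<longrightarrow>
     f (t \<circ> p \<circ> pinv t) = f p)"

lemma center_iff: "z \<in> group_algebra_center n \<longleftrightarrow> z \<in> group_algebra n \<and> class_function n (lk z)"
proof (intro iffI conjI)
  assume z: "z \<in> group_algebra_center n"
  then show "z \<in> group_algebra n" by (simp add: group_algebra_center_def)
  show "class_function n (lk z)"
    unfolding class_function_def
  proof (intro allI impI)
    fix p t :: "nat \<Rightarrow> nat" assume p: "p permutes {..<n}" and t: "t permutes {..<n}"
    have "lk (z \<star> perm_el t) (t \<circ> p) = lk (perm_el t \<star> z) (t \<circ> p)"
      using z group_algebra_single[OF t] by (auto simp: group_algebra_center_def)
    then show "lk z (t \<circ> p \<circ> pinv t) = lk z p"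
      unfolding lookup_perm_el_left[OF t] lookup_perm_el_right[OF t]
      by (simp add: comp_assoc[symmetric] permutes_inv_o[OF t])
  qed
next
  assume z: "z \<in> group_algebra n \<and> class_function n (lk z)"
  have 1: "z \<star> perm_el t = perm_el t \<star> z" if "t \<in> perms n" for t
  proof (rule group_algebra_eqI)
    have t: "t permutes {..<n}" using that by simp
    show "z \<star> perm_el t \<in> group_algebra n" "perm_el t \<star> z \<in> group_algebra n"
      using z by (auto intro!: group_algebra_mult group_algebra_single t)
    fix p assume p: "p permutes {..<n}"
    let ?q = "pinv t \<circ> p"
    have "?q permutes {..<n}" using p permutes_inv[OF t] by (rule permutes_compose)
    moreover have "t \<circ> ?q \<circ> pinv t = p \<circ> pinv t"
      by (simp add: comp_assoc[symmetric] permutes_inv_o[OF t])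
    ultimately show "lk (z \<star> perm_el t) p = lk (perm_el t \<star> z) p"
      using z t unfolding lookup_perm_el_left[OF t] lookup_perm_el_right[OF t] class_function_def
      by metis
  qed
  have "z \<star> a = a \<star> z" if "a \<in> group_algebra n" for a
    using that by (induction rule: group_algebra_induct)
      (simp add: comb_mult_sum_left comb_mult_sum_right comb_mult_scale_left comb_mult_scale_right 1)
  then show "z \<in> group_algebra_center n" using z by (simp add: group_algebra_center_def)
qed

lemma irr_character_in: "lam \<turnstile> n \<Longrightarrow> irr_character lam \<in> group_algebra n"
  unfolding irr_character_def
  by (intro group_algebra_sum group_algebra_single) (simp add: partition_of_def)

lemma irr_character_center:
  assumes "lam \<turnstile> n"
  shows "irr_character lam \<in> group_algebra_center n"
  using assms
  by (simp add: center_iff irr_character_in class_function_def irr_character_phi permutes_conj phi_conj)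

lemma charac_irr_character: "lam \<turnstile> n \<Longrightarrow> charac n (lk (irr_character lam)) = schur lam"
  using charac_cong[of n "lk (irr_character lam)" "phi n lam"] by (simp add: irr_character_phi charac_phi)

lemma center_charac_inj:
  assumes "y \<in> group_algebra_center n" "z \<in> group_algebra_center n" "charac n (lk y) = charac n (lk z)"
  shows "y = z"
proof (rule group_algebra_eqI)
  show "y \<in> group_algebra n" "z \<in> group_algebra n" using assms by (simp_all add: center_iff)
  fix p assume p: "p permutes {..<n}"
  have "lk y p + (- 1) * lk z p = 0"
  proof (rule charac_separates[OF _ _ p])
    show "charac n (\<lambda>p. lk y p + (- 1) * lk z p) = 0"
      unfolding charac_add charac_scale by (simp add: assms(3) scale_minus_one)
    show "lk y (t \<circ> p \<circ> pinv t) + (- 1) * lk z (t \<circ> p \<circ> pinv t) = lk y p + (- 1) * lk z p"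
      if "p permutes {..<n}" "t permutes {..<n}" for p t
      using assms that by (simp add: center_iff class_function_def)
  qed
  then show "lk y p = lk z p" by simp
qed

text \<open>Both sides are central with the same characteristic, and the characteristic is injective
  on the center. This shows that the irreducible characters span it.\<close>

lemma center_expansion:
  assumes z: "z \<in> group_algebra_center n"
  shows "z = (\<Sum>\<beta> | \<beta> \<turnstile> n. scale_comb (schur_coord \<beta> (charac n (lk z))) (irr_character \<beta>))"
    (is "z = ?s")
proof (rule center_charac_inj[OF z])
  have lk_s: "lk ?s = (\<lambda>p. \<Sum>\<beta> | \<beta> \<turnstile> n. schur_coord \<beta> (charac n (lk z)) * lk (irr_character \<beta>) p)"
    by (simp add: fun_eq_iff lookup_sum)
  show "?s \<in> group_algebra_center n"
    unfolding center_iff class_function_def lk_s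
  proof (intro conjI allI impI)
    show "?s \<in> group_algebra n" by (intro group_algebra_sum group_algebra_scale irr_character_in) simp
  qed (auto intro!: sum.cong simp: irr_character_phi permutes_conj phi_conj)
  have "charac n (lk ?s) = (\<Sum>\<beta> | \<beta> \<turnstile> n. schur_coord \<beta> (charac n (lk z)) *\<^sub>s schur \<beta>)"
    unfolding lk_s charac_sum charac_scale by (intro sum.cong refl) (simp add: charac_irr_character)
  then show "charac n (lk z) = charac n (lk ?s)" using charac_expansion[of n "lk z"] by simp
qed

lemma character_coord_eq:
  assumes z: "z \<in> group_algebra_center n" and \<alpha>: "\<alpha> \<turnstile> n"
  shows "character_coord n z \<alpha> = schur_coord \<alpha> (charac n (lk z))"
proof -
  have "z \<in> comb.span (irr_character ` {\<beta>. \<beta> \<turnstile> n})"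
    by (subst center_expansion[OF z]) (intro comb.span_sum comb.span_scale comb.span_base imageI)
  then show ?thesis
    unfolding character_coord_def
  proof (intro comb.representation_dual_family[where coord = "\<lambda>\<alpha> z. schur_coord \<alpha> (charac n (lk z))"])
    show "schur_coord i (charac n (lk (x + y))) = schur_coord i (charac n (lk x)) + schur_coord i (charac n (lk y))"
      for i x y
      using charac_add[of n "lk x" "lk y"] by (simp add: plus_poly_mapping.rep_eq schur_coord_add)
    show "schur_coord i (charac n (lk (scale_comb c x))) = c * schur_coord i (charac n (lk x))" for i c x
      using charac_scale[of n c "lk x"] by (simp add: scale_comb.rep_eq schur_coord_scale)
    show "schur_coord i (charac n (lk (irr_character j))) = (if i = j then 1 else 0)"
      if "i \<in> {\<beta>. \<beta> \<turnstile> n}" "j \<in> {\<beta>. \<beta> \<turnstile> n}" for i j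
      using that by (simp add: charac_irr_character schur_coord_schur)
  qed (use \<alpha> in auto)
qed

lemma frobenius_map_charac:
  assumes "z \<in> group_algebra_center n"
  shows "frobenius_map n z = charac n (lk z)"
  unfolding frobenius_map_def
  by (subst charac_expansion, intro sum.cong refl) (simp add: character_coord_eq[OF assms])

lemma inv_frobenius_map:
  assumes "lam \<turnstile> n"
  shows "inv_into (group_algebra_center n) (frobenius_map n) (schur lam) = irr_character lam"
proof -
  have "inj_on (frobenius_map n) (group_algebra_center n)"
    by (rule inj_onI) (simp add: frobenius_map_charac center_charac_inj)
  moreover have "schur lam = frobenius_map n (irr_character lam)"
    by (simp add: frobenius_map_charac irr_character_center assms charac_irr_character)
  ultimately show ?thesis using irr_character_center[OF assms] by (simp add: inv_into_f_f)
qed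

lemma pointwise_mult_center:
  assumes "y \<in> group_algebra_center n" "z \<in> group_algebra_center n"
  shows "pointwise_mult y z \<in> group_algebra_center n"
proof -
  have "Poly_Mapping.keys (pointwise_mult y z) \<subseteq> Poly_Mapping.keys y"
    by (auto simp: in_keys_iff pointwise_mult.rep_eq)
  then show ?thesis using assms
    by (auto simp: center_iff group_algebra_keys class_function_def pointwise_mult.rep_eq)
qed

lemma inner_product_schur:
  assumes "lam \<turnstile> n" "\<mu> \<turnstile> n"
  shows "inner_product n (schur lam) (schur \<mu>)
      = frobenius_map n (pointwise_mult (irr_character lam) (irr_character \<mu>))"
    and "inner_product n (schur lam) (schur \<mu>) = charac n (\<lambda>p. phi n lam p * phi n \<mu> p)"
proof -
  show *: "inner_product n (schur lam) (schur \<mu>)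
      = frobenius_map n (pointwise_mult (irr_character lam) (irr_character \<mu>))"
    by (simp add: inner_product_def Let_def inv_frobenius_map assms)
  have "frobenius_map n (pointwise_mult (irr_character lam) (irr_character \<mu>))
      = charac n (lk (pointwise_mult (irr_character lam) (irr_character \<mu>)))"
    by (intro frobenius_map_charac pointwise_mult_center irr_character_center assms)
  also have "\<dots> = charac n (\<lambda>p. phi n lam p * phi n \<mu> p)"
    by (rule charac_cong) (simp add: pointwise_mult.rep_eq irr_character_phi[OF assms(1)] irr_character_phi[OF assms(2)])
  finally show "inner_product n (schur lam) (schur \<mu>) = charac n (\<lambda>p. phi n lam p * phi n \<mu> p)"
    using * by simp
qed

section \<open>The Jacobi--Trudi expansion of the operator\<close>

text \<open>Rows with sum 0 are empty. They may be added to index all rows of the determinant, and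
  dropped because a symbol of degree 0 is 1 and leaves no trace in a monomial.\<close>

lemma matrices_zero_rows:
  assumes "I' \<subseteq> I" "\<And>i. i \<in> I - I' \<Longrightarrow> c i = 0"
  shows "matrices c I M = matrices c I' M"
proof -
  have cnt: "count (image_mset fst P) i = 0 \<longleftrightarrow> i \<notin> fst ` set_mset P" for P :: "('a \<times> 'b) multiset" and i
    using not_in_iff[of i "image_mset fst P"] by simp
  show ?thesis
  proof (intro equalityI subsetI)
    fix P assume P: "P \<in> matrices c I M"
    have "i \<in> I'" if i: "i \<in> fst ` set_mset P" for i
    proof (rule ccontr)
      assume "i \<notin> I'"
      moreover have "i \<in> I" using P i by (auto simp: matrices_def)
      ultimately have "count (image_mset fst P) i = 0" using P assms(2)[of i] by (simp add: matrices_def)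
      then show False using cnt i by blast
    qed
    then show "P \<in> matrices c I' M" using P assms(1) by (auto simp: matrices_def)
  next
    fix P assume P: "P \<in> matrices c I' M"
    have "count (image_mset fst P) i = c i" if "i \<in> I" for i
    proof (cases "i \<in> I'")
      case False
      then have "i \<notin> fst ` set_mset P" using P by (auto simp: matrices_def)
      then show ?thesis using cnt[of P i] assms(2)[of i] False that by simp
    qed (use P in \<open>simp add: matrices_def\<close>)
    then show "P \<in> matrices c I M" using P assms(1) by (auto simp: matrices_def)
  qed
qed

text \<open>The operator receives the nonzero degrees in increasing order. Listing the rows by
  degree produces the same list, so the result is a sum over matrices indexed by the original
  rows.\<close>

lemma row_sum_sorted:
  fixes I :: "nat set"
  assumes "finite I"
  shows "row_sum (sorted_list_of_multiset (image_mset c (mset_set {i \<in> I. c i \<noteq> 0}))) A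
    = (\<Sum>P\<in>matrices c I A. hm P)"
proof -
  let ?I = "{i \<in> I. c i \<noteq> 0}"
  define xs where "xs = sort_key c (sorted_list_of_set ?I)"
  have fin: "finite ?I" using assms by simp
  have xs: "distinct xs" "set xs = ?I" "sorted (map c xs)" using fin by (simp_all add: xs_def)
  then have "mset_set ?I = mset xs" using mset_set_set[OF xs(1)] by simp
  then have "sorted_list_of_multiset (image_mset c (mset_set ?I)) = sort (map c xs)"
    by (metis mset_map sorted_list_of_multiset_mset)
  also have "\<dots> = map c xs" using xs(3) by (rule sorted_sort_id)
  finally have "row_sum (sorted_list_of_multiset (image_mset c (mset_set ?I))) A = (\<Sum>P\<in>matrices c ?I A. hm P)"
    using row_sum_matrices[OF xs(1), of c A] xs(2) by simp
  also have "matrices c ?I A = matrices c I A" by (rule matrices_zero_rows[symmetric]) auto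
  finally show ?thesis .
qed

text \<open>The linear extension inside \<open>U_op\<close>, isolated so that it can act on the
  determinant term by term: different permutations may yield the same monomial, so terms can merge
  or cancel among the keys.\<close>

definition h_linear :: "(nat multiset \<Rightarrow> series) \<Rightarrow> h_polynomial \<Rightarrow> series" where
  "h_linear G D = (\<Sum>\<alpha>\<in>Poly_Mapping.keys D. Poly_Mapping.lookup D \<alpha> *\<^sub>s G \<alpha>)"

lemma h_linear_superset:
  assumes "finite S" "Poly_Mapping.keys D \<subseteq> S"
  shows "h_linear G D = (\<Sum>\<alpha>\<in>S. Poly_Mapping.lookup D \<alpha> *\<^sub>s G \<alpha>)"
  unfolding h_linear_def
  by (rule sum.mono_neutral_left) (use assms in \<open>auto simp: in_keys_iff\<close>)

lemma h_linear_add: "h_linear G (D + E) = h_linear G D + h_linear G E"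
proof -
  let ?S = "Poly_Mapping.keys D \<union> Poly_Mapping.keys E"
  have "Poly_Mapping.keys (D + E) \<subseteq> ?S" by (rule keys_add)
  then show ?thesis
    by (simp add: h_linear_superset[of ?S] lookup_add series.scale_left_distrib sum.distrib)
qed

lemma h_linear_sum: "h_linear G (sum D A) = (\<Sum>x\<in>A. h_linear G (D x))"
  by (induction A rule: infinite_finite_induct) (simp_all add: h_linear_add, simp_all add: h_linear_def)

lemma h_linear_single: "h_linear G (Poly_Mapping.single \<alpha> c) = c *\<^sub>s G \<alpha>"
  by (subst h_linear_superset[of "{\<alpha>}"]) auto

lemma prod_h_symbol:
  assumes "finite I"
  shows "(\<Prod>i\<in>I. h_symbol (k i)) = (if \<exists>i\<in>I. k i < 0 then 0
    else Poly_Mapping.single (image_mset (\<lambda>i. nat (k i)) (mset_set {i \<in> I. nat (k i) \<noteq> 0})) 1)"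
  using assms
proof (induction I rule: finite_induct)
  case empty
  show ?case by simp
next
  case (insert i I)
  have "{j \<in> insert i I. nat (k j) \<noteq> 0}
      = (if nat (k i) = 0 then {j \<in> I. nat (k j) \<noteq> 0} else insert i {j \<in> I. nat (k j) \<noteq> 0})" by auto
  then have "image_mset (\<lambda>i. nat (k i)) (mset_set {j \<in> insert i I. nat (k j) \<noteq> 0})
      = (if nat (k i) = 0 then {#} else {#nat (k i)#}) + image_mset (\<lambda>i. nat (k i)) (mset_set {j \<in> I. nat (k j) \<noteq> 0})"
    using insert.hyps by simp
  then show ?case using insert
    by (auto simp: h_symbol_def mult_single)
qed

lemma signof_single: "(signof p :: h_polynomial) * Poly_Mapping.single \<alpha> c = Poly_Mapping.single \<alpha> (of_int (sign p) * c)"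
  by (cases "evenperm p") (simp_all add: sign_def single_uminus)

text \<open>Since the indices in a term of the Jacobi--Trudi determinant add up to \<open>n\<close>, the term is recovered
  from the rows below the first.\<close>

lemma coeff_U_op:
  assumes lam: "lam \<turnstile> n" and mu: "\<mu> \<turnstile> n" and n: "n > 0"
  shows "coeff_of (U_op (tl lam) (schur \<mu>)) M
    = (\<Sum>w\<in>jt_perms lam. of_int (sign w) * schur_coord \<mu> (\<Sum>P\<in>margins (jt_content lam w) M. hm P))"
proof -
  let ?l = "length lam" and ?k = "jt_index lam"
  let ?G = "\<lambda>\<alpha>. h_monomial_op (sorted_list_of_multiset \<alpha>) (schur \<mu>)"
  let ?\<alpha> = "\<lambda>w. image_mset (\<lambda>i. nat (?k w i)) (mset_set {i \<in> {1..<?l}. nat (?k w i) \<noteq> 0})"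
  let ?W = "{w. w permutes {0..<?l}}"
  have sum: "sum_list lam = n" using lam by (simp add: partition_of_def)
  then obtain x xs where lx: "lam = x # xs" using n by (cases lam) auto
  have l: "length (tl lam) + 1 = ?l" "0 < ?l" by (simp_all add: lx)
  have entry: "(\<Prod>i=0..<?l. h_matrix (tl lam) $$ (i, w i)) = (\<Prod>i\<in>{1..<?l}. h_symbol (?k w i))"
    if w: "w permutes {0..<?l}" for w
  proof -
    have wl: "w i < ?l" if "i < ?l" for i using that permutes_in_image[OF w] by simp
    \<comment> \<open>Entry \<open>i - 1\<close> of \<open>tl lam\<close> is entry \<open>i\<close>
      of \<open>lam\<close>, so below row 0 this is the Jacobi--Trudi matrix of
      \<open>lam\<close>.\<close>
    have h: "h_matrix (tl lam) $$ (i, w i) = (if i = 0 then 1 else h_symbol (?k w i))" if "i < ?l" for i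
      using that wl[OF that] l
      by (cases i) (auto simp: h_matrix_def lx jt_index_def shape_of_def algebra_simps)
    have "(\<Prod>i=0..<?l. h_matrix (tl lam) $$ (i, w i)) = (\<Prod>i\<in>{0..<?l}. if i = 0 then 1 else h_symbol (?k w i))"
      by (rule prod.cong) (auto simp: h)
    also have "\<dots> = (\<Prod>i\<in>{1..<?l}. h_symbol (?k w i))"
      by (rule prod.mono_neutral_cong_right) auto
    finally show ?thesis .
  qed
  have "U_op (tl lam) (schur \<mu>) = h_linear ?G (det (h_matrix (tl lam)))"
    by (simp add: U_op_def h_linear_def Let_def)
  also have "det (h_matrix (tl lam)) = (\<Sum>w\<in>?W. signof w * (\<Prod>i\<in>{1..<?l}. h_symbol (?k w i)))"
  proof -
    have "dim_row (h_matrix (tl lam)) = ?l" "dim_col (h_matrix (tl lam)) = ?l" using l by (simp_all add: h_matrix_def)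
    then show ?thesis unfolding det_def by (auto intro!: sum.cong simp: entry)
  qed
  also have "h_linear ?G \<dots> = (\<Sum>w\<in>?W. if \<exists>i\<in>{1..<?l}. ?k w i < 0 then 0 else of_int (sign w) *\<^sub>s ?G (?\<alpha> w))"
    unfolding h_linear_sum
    by (rule sum.cong[OF refl]) (auto simp: prod_h_symbol signof_single h_linear_single, simp add: h_linear_def)
  finally have U: "coeff_of (U_op (tl lam) (schur \<mu>)) M
      = (\<Sum>w\<in>?W. if \<exists>i\<in>{1..<?l}. ?k w i < 0 then 0 else of_int (sign w) * coeff_of (?G (?\<alpha> w)) M)"
    by (auto simp: coeff_of_sum coeff_of_simps intro!: sum.cong)
  have total: "(\<Sum>i<?l. ?k w i) = int n" if w: "w permutes {..<?l}" for w
  proof -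
    have "(\<Sum>i<?l. int (w i)) = (\<Sum>i<?l. int i)" using sum.permute[OF w, of int] by (simp add: o_def)
    moreover have "(\<Sum>i<?l. int (shape_of lam i)) = int n"
      unfolding sum[symmetric] by (simp add: shape_of_def sum_list_sum_nth lessThan_atLeast0)
    ultimately show ?thesis by (simp add: jt_index_def sum.distrib sum_subtractf)
  qed
  have size: "int (sum_list (sorted_list_of_multiset (?\<alpha> w))) = int n - ?k w 0"
    if w: "w permutes {..<?l}" and nonneg: "\<forall>i\<in>{1..<?l}. 0 \<le> ?k w i" for w
  proof -
    have "sum_list (sorted_list_of_multiset (?\<alpha> w)) = sum_mset (?\<alpha> w)"
      by (subst sum_mset_sum_list[symmetric]) (simp only: mset_sorted_list_of_multiset)
    also have "\<dots> = (\<Sum>i\<in>{i \<in> {1..<?l}. nat (?k w i) \<noteq> 0}. nat (?k w i))"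
      by (simp add: sum_unfold_sum_mset)
    also have "\<dots> = (\<Sum>i\<in>{1..<?l}. nat (?k w i))"
      by (rule sum.mono_neutral_left) auto
    finally have "int (sum_list (sorted_list_of_multiset (?\<alpha> w))) = (\<Sum>i\<in>{1..<?l}. ?k w i)"
      using nonneg by simp
    moreover have "(\<Sum>i<?l. ?k w i) = ?k w 0 + (\<Sum>i\<in>{1..<?l}. ?k w i)"
      using l(2) by (simp add: lessThan_atLeast0 sum.atLeast_Suc_lessThan)
    ultimately show ?thesis using total[OF w] by simp
  qed
  \<comment> \<open>The row of ones admits permutations that have a negative degree in row 0 of the
    Jacobi--Trudi matrix. The remaining degrees then exceed \<open>n\<close> in total, and the
    operator kills \<open>schur \<mu>\<close>.\<close>
  have zero: "coeff_of (?G (?\<alpha> w)) M = 0"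
    if w: "w permutes {..<?l}" and nonneg: "\<forall>i\<in>{1..<?l}. 0 \<le> ?k w i" and neg: "?k w 0 < 0" for w
  proof -
    have "n < sum_list (sorted_list_of_multiset (?\<alpha> w))" using size[OF w nonneg] neg by simp
    then show ?thesis unfolding coeff_h_monomial_op_schur[OF mu] by (intro sum.neutral) auto
  qed
  have main: "coeff_of (?G (?\<alpha> w)) M = schur_coord \<mu> (\<Sum>P\<in>margins (jt_content lam w) M. hm P)"
    if w: "w \<in> jt_perms lam" for w
  proof -
    define c where "c = count (jt_content lam w)"
    have c: "?k w i = int (c i)" for i using count_jt_content[OF w] by (simp add: c_def)
    have wp: "w permutes {..<?l}" using w by (simp add: jt_perms_def)
    let ?\<beta> = "sorted_list_of_multiset (?\<alpha> w)"
    \<comment> \<open>Here row 0 returns: the part \<open>B\<close> supplied by the skewed function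
      has the size of that row, although the monomial lacks its factor.\<close>
    have sz: "size B + sum_list ?\<beta> = n \<longleftrightarrow> size B = c 0" for B :: "nat multiset"
      using size[OF wp] by (simp add: c) presburger
    have rs: "row_sum ?\<beta> A = (\<Sum>P\<in>matrices c {1..<?l} A. hm P)" for A
      using row_sum_sorted[of "{1..<?l}" c A] by (simp add: c)
    have hm0: "hm (image_mset (Pair 0) B + Q) = hm Q * hm B" if "Q \<in> matrices c {1..<?l} A" for A B Q
    proof -
      have "set_mset (image_mset (Pair 0) B) \<inter> set_mset Q = {}" using that by (auto simp: matrices_def)
      then show ?thesis by (simp add: hm_add_disjoint hm_image_inj inj_on_def mult.commute)
    qed
    have "margins (jt_content lam w) M = matrices c (insert 0 {1..<?l}) M"
      unfolding margins_matrices c_def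
      by (rule matrices_zero_rows[symmetric])
         (use set_jt_content[of lam w] l(2) in \<open>auto simp: subset_iff not_in_iff\<close>)
    then have "(\<Sum>P\<in>margins (jt_content lam w) M. hm P)
        = (\<Sum>(B, A) | B + A = M \<and> size B = c 0. \<Sum>Q\<in>matrices c {1..<?l} A. hm (image_mset (Pair 0) B + Q))"
      by (simp add: sum_matrices_insert)
    also have "\<dots> = (\<Sum>(B, A) | B + A = M \<and> size B = c 0. row_sum ?\<beta> A * hm B)"
      unfolding rs sum_distrib_right
      by (rule sum.cong[OF refl], clarify, rule sum.cong[OF refl]) (rule hm0)
    also have "\<dots> = (\<Sum>(A, B) | A + B = M \<and> size B = c 0. row_sum ?\<beta> A * hm B)"
      by (rule sum.reindex_bij_witness[where i = prod.swap and j = prod.swap]) (auto simp: ac_simps)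
    finally show ?thesis
      unfolding coeff_h_monomial_op_schur[OF mu] sz
      by (simp add: schur_coord_sum case_prod_unfold)
  qed
  have "(\<Sum>w\<in>?W. if \<exists>i\<in>{1..<?l}. ?k w i < 0 then 0 else of_int (sign w) * coeff_of (?G (?\<alpha> w)) M)
      = (\<Sum>w\<in>jt_perms lam. of_int (sign w) * schur_coord \<mu> (\<Sum>P\<in>margins (jt_content lam w) M. hm P))"
  proof (rule sum.mono_neutral_cong_right)
    show "jt_perms lam \<subseteq> ?W" by (auto simp: jt_perms_def lessThan_atLeast0)
    show "\<forall>w\<in>?W - jt_perms lam. (if \<exists>i\<in>{1..<?l}. ?k w i < 0 then 0
        else of_int (sign w) * coeff_of (?G (?\<alpha> w)) M) = 0"
    proof
      fix w assume w: "w \<in> ?W - jt_perms lam"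
      then have wp: "w permutes {..<?l}" by (simp add: lessThan_atLeast0)
      show "(if \<exists>i\<in>{1..<?l}. ?k w i < 0 then 0 else of_int (sign w) * coeff_of (?G (?\<alpha> w)) M) = 0"
      proof (cases "\<exists>i\<in>{1..<?l}. ?k w i < 0")
        case False
        then have nonneg: "\<forall>i\<in>{1..<?l}. 0 \<le> ?k w i" by auto
        obtain i where "i < ?l" "?k w i < 0" using w wp by (auto simp: jt_perms_def not_le)
        then have "?k w 0 < 0" using False by (cases "i = 0") auto
        then show ?thesis using zero[OF wp nonneg] by simp
      qed simp
    qed
    fix w assume w: "w \<in> jt_perms lam"
    then have "\<not> (\<exists>i\<in>{1..<?l}. ?k w i < 0)" by (auto simp: jt_perms_def not_less)
    then show "(if \<exists>i\<in>{1..<?l}. ?k w i < 0 then 0 else of_int (sign w) * coeff_of (?G (?\<alpha> w)) M)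
        = of_int (sign w) * schur_coord \<mu> (\<Sum>P\<in>margins (jt_content lam w) M. hm P)"
      using main[OF w] by simp
  qed (simp add: finite_permutations)
  with U show ?thesis by simp
qed

theorem theorem1:
  fixes n :: nat and lam \<mu> :: "nat list"
  assumes "n > 0" and "lam \<turnstile> n" and "\<mu> \<turnstile> n"
  shows "U_op (tl lam) (schur \<mu>) = inner_product n (schur lam) (schur \<mu>) \<and>
         inner_product n (schur lam) (schur \<mu>)
           = (\<Sum>\<alpha> | \<alpha> \<turnstile> n. kronecker_coeff lam \<mu> \<alpha> *\<^sub>s schur \<alpha>)"
proof
  show "U_op (tl lam) (schur \<mu>) = inner_product n (schur lam) (schur \<mu>)"
    unfolding inner_product_schur(2)[OF assms(2,3)]
    by (rule series_eqI) (simp add: coeff_U_op[OF assms(2,3,1)] coeff_charac_phi_phi[OF assms(2)])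
  show "inner_product n (schur lam) (schur \<mu>) = (\<Sum>\<alpha> | \<alpha> \<turnstile> n. kronecker_coeff lam \<mu> \<alpha> *\<^sub>s schur \<alpha>)"
    unfolding inner_product_schur(1)[OF assms(2,3)] frobenius_map_def kronecker_coeff_def
    by (intro sum.cong refl) (simp add: partition_of_def)
qed

end
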